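(* Let $a,b>0$, $1<p<5$, $k\ge2$. Suppose $V\in L^\infty(\mathbb{R}^3)$, $0<\inf_{\mathbb{R}^3}V\le\sup_{\mathbb{R}^3}V<\infty$, and $V\in C^1(\mathbb{R}^3)$. Let $a_1,\dots,a_k\in\mathbb{R}^3$ be distinct points, and let $u_\epsilon$ be a $k$-peak solution of $$-\left(\epsilon^2a+\epsilon b\int_{\mathbb{R}^3}|\nabla u|^2\right)\Delta u+V(x)u=u^p,\qquad u>0\quad\text{in }\mathbb{R}^3,$$ with local maximum points $y_\epsilon^i\to a_i$ as $\epsilon\to0$, of the form $$u_\epsilon(x)=\sum_{i=1}^kw^i\!\left(\frac{x-y_\epsilon^i}{\epsilon}\right)+\varphi_\epsilon(x),\qquad\|\varphi_\epsilon\|_\epsilon=o(\epsilon^{3/2}),$$ where $(w^1,\dots,w^k)$ is the unique positive radial solution to the system $$-\left(a+b\sum_{l=1}^k\int_{\mathbb{R}^3}|\nabla w^l|^2\right)\Delta w^i+V(a_i)w^i=(w^i)^p\ \text{ in }\mathbb{R}^3,\qquad w^i>0,\quad w^i\in H^1(\mathbb{R}^3),\qquad i=1,\dots,k.$$ Then $\nabla V(a_i)=0$ for each $i=1,\dots,k$.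
   Context: Norm: $\|u\|_\epsilon^2=\int_{\mathbb{R}^3}(\epsilon^2a|\nabla u|^2+V(x)u^2)$. The system for $(w^1,\dots,w^k)$ has exactly one positive radial solution. Definition ($k$-peak solution). A family $u_\epsilon$ (for $\epsilon>0$ small) of solutions of the equation is called a $k$-peak solution if: (i) $u_\epsilon$ has $k$ local maximum points $y_\epsilon^j\in\mathbb{R}^3$, $j=1,\dots,k$, with $y_\epsilon^j\to a_j$ for some $a_j\in\mathbb{R}^3$ as $\epsilon\to0$; (ii) for any given $\tau>0$ there exists $R\gg1$ such that $|u_\epsilon(x)|\le\tau$ for $x\in\mathbb{R}^3\setminus\bigcup_{j=1}^kB_{R\epsilon}(y_\epsilon^j)$; (iii) there exists $C>0$ (independent of $\epsilon$) such that $\int_{\mathbb{R}^3}(\epsilon^2a|\nabla u_\epsilon|^2+u_\epsilon^2)\le C\epsilon^3$. *)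

theory Defs
  imports "HOL-Analysis.Analysis" "HOL-Library.Landau_Symbols"
begin

definition C1 :: "(real^3 \<Rightarrow> real) \<Rightarrow> bool" where
  "C1 f \<longleftrightarrow> (\<exists>f'. (\<forall>x. GDERIV f x :> f' x) \<and> continuous_on UNIV f')"

definition locally_integrable :: "(real^3 \<Rightarrow> 'b::euclidean_space) \<Rightarrow> bool" where
  "locally_integrable f \<longleftrightarrow>
     f \<in> borel_measurable borel \<and> (\<forall>K. compact K \<longrightarrow> set_integrable lborel K f)"

text \<open>Test functions are continuously differentiable with compact support.  By mollification
  this class yields the same weak gradients as the smooth compactly supported functions.\<close>

definition weak_gradient :: "(real^3 \<Rightarrow> real) \<Rightarrow> (real^3 \<Rightarrow> real^3) \<Rightarrow> bool" where
  "weak_gradient u g \<longleftrightarrow>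
     locally_integrable u \<and> locally_integrable g \<and>
     (\<forall>\<phi> \<phi>'. (\<forall>x. GDERIV \<phi> x :> \<phi>' x) \<and> continuous_on UNIV \<phi>' \<and> compact (closure {x. \<phi> x \<noteq> 0}) \<longrightarrow>
        (LINT x|lborel. u x *\<^sub>R \<phi>' x) = - (LINT x|lborel. \<phi> x *\<^sub>R g x))"

text \<open>Weak gradients are unique up to null sets, so that the integrals below do not depend on
  the representative chosen here.\<close>

definition wgrad :: "(real^3 \<Rightarrow> real) \<Rightarrow> real^3 \<Rightarrow> real^3" where
  "wgrad u = (SOME g. weak_gradient u g)"

definition H1 :: "(real^3 \<Rightarrow> real) set" where
  "H1 = {u. u \<in> borel_measurable borel \<and> integrable lborel (\<lambda>x. (u x)\<^sup>2) \<and>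
            (\<exists>g. weak_gradient u g \<and> integrable lborel (\<lambda>x. (norm (g x))\<^sup>2))}"

definition dirichlet :: "(real^3 \<Rightarrow> real) \<Rightarrow> real" where
  "dirichlet u = (LINT x|lborel. (norm (wgrad u x))\<^sup>2)"

definition eps_norm :: "real \<Rightarrow> (real^3 \<Rightarrow> real) \<Rightarrow> real \<Rightarrow> (real^3 \<Rightarrow> real) \<Rightarrow> real" where
  "eps_norm a V \<epsilon> u =
     sqrt (LINT x|lborel. \<epsilon>\<^sup>2 * a * (norm (wgrad u x))\<^sup>2 + V x * (u x)\<^sup>2)"

text \<open>Positive finite-energy solution of \<open>- m \<Delta>u + W u = u\<^sup>p\<close> for a constant \<open>m\<close> and a bounded
  potential \<open>W\<close>, in the weak (variational) sense.  For \<open>1 < p < 5\<close> all the integrals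
  converge by the Sobolev embedding of \<open>H1\<close>.  The function itself is required to be
  continuous, to fix the representative to which pointwise statements such as
  positivity and local maxima refer; by elliptic regularity every weak solution has one.\<close>

definition positive_solution ::
    "real \<Rightarrow> (real^3 \<Rightarrow> real) \<Rightarrow> real \<Rightarrow> (real^3 \<Rightarrow> real) \<Rightarrow> bool" where
  "positive_solution m W p u \<longleftrightarrow>
     u \<in> H1 \<and> continuous_on UNIV u \<and> (\<forall>x. 0 < u x) \<and>
     (\<forall>v\<in>H1. (LINT x|lborel. m * (wgrad u x \<bullet> wgrad v x) + W x * u x * v x)
            = (LINT x|lborel. u x powr p * v x))"

definition kirchhoff_solution ::
    "real \<Rightarrow> real \<Rightarrow> real \<Rightarrow> (real^3 \<Rightarrow> real) \<Rightarrow> real \<Rightarrow> (real^3 \<Rightarrow> real) \<Rightarrow> bool" where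
  "kirchhoff_solution a b p V \<epsilon> u \<longleftrightarrow>
     positive_solution (\<epsilon>\<^sup>2 * a + \<epsilon> * b * dirichlet u) V p u"

definition radial :: "(real^3 \<Rightarrow> real) \<Rightarrow> bool" where
  "radial f \<longleftrightarrow> (\<forall>x y. norm x = norm y \<longrightarrow> f x = f y)"

definition limit_system_solution ::
    "real \<Rightarrow> real \<Rightarrow> real \<Rightarrow> (real^3 \<Rightarrow> real) \<Rightarrow> nat \<Rightarrow> (nat \<Rightarrow> real^3) \<Rightarrow>
     (nat \<Rightarrow> real^3 \<Rightarrow> real) \<Rightarrow> bool" where
  "limit_system_solution a b p V k \<xi> w \<longleftrightarrow>
     (\<forall>i\<in>{1..k}. radial (w i) \<and>
        positive_solution (a + b * (\<Sum>l=1..k. dirichlet (w l))) (\<lambda>x. V (\<xi> i)) p (w i))"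

definition local_max_point :: "(real^3 \<Rightarrow> real) \<Rightarrow> real^3 \<Rightarrow> bool" where
  "local_max_point u z \<longleftrightarrow> (\<forall>\<^sub>F x in nhds z. u x \<le> u z)"

text \<open>The family \<open>u \<epsilon>\<close> concentrates at \<open>\<xi> 1, \<dots>, \<xi> k\<close> with local maximum points
  \<open>y \<epsilon> 1, \<dots>, y \<epsilon> k\<close>.\<close>

definition k_peak_solution ::
    "real \<Rightarrow> real \<Rightarrow> real \<Rightarrow> (real^3 \<Rightarrow> real) \<Rightarrow> nat \<Rightarrow> (real \<Rightarrow> real^3 \<Rightarrow> real) \<Rightarrow>
     (real \<Rightarrow> nat \<Rightarrow> real^3) \<Rightarrow> (nat \<Rightarrow> real^3) \<Rightarrow> bool" where
  "k_peak_solution a b p V k u y \<xi> \<longleftrightarrow>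
     (\<forall>\<^sub>F \<epsilon> in at_right 0. kirchhoff_solution a b p V \<epsilon> (u \<epsilon>)) \<and>
     (\<forall>\<^sub>F \<epsilon> in at_right 0. inj_on (y \<epsilon>) {1..k} \<and> (\<forall>j\<in>{1..k}. local_max_point (u \<epsilon>) (y \<epsilon> j))) \<and>
     (\<forall>j\<in>{1..k}. ((\<lambda>\<epsilon>. y \<epsilon> j) \<longlongrightarrow> \<xi> j) (at_right 0)) \<and>
     (\<forall>\<tau>>0. \<exists>R>1. \<forall>\<^sub>F \<epsilon> in at_right 0.
        \<forall>x. x \<notin> (\<Union>j\<in>{1..k}. ball (y \<epsilon> j) (R * \<epsilon>)) \<longrightarrow> \<bar>u \<epsilon> x\<bar> \<le> \<tau>) \<and>
     (\<exists>C>0. \<forall>\<^sub>F \<epsilon> in at_right 0.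
        (LINT x|lborel. \<epsilon>\<^sup>2 * a * (norm (wgrad (u \<epsilon>) x))\<^sup>2 + (u \<epsilon> x)\<^sup>2) \<le> C * \<epsilon> ^ 3)"

end

theory Submission
  imports Defs
begin

text \<open>
  Suppose that \<open>e = \<nabla>V (\<xi> i)\<close> does not vanish.  Formally one multiplies the equation by
  \<open>\<eta> \<partial>\<^sub>e u\<close>, where \<open>\<eta>\<close> is a cutoff around \<open>\<xi> i\<close>, and integrates by parts.  In every term the
  derivative ends up either on \<open>\<eta>\<close>, which is constant outside a shell around \<open>\<xi> i\<close>, or on \<open>V\<close>,
  which increases in direction \<open>e\<close> near \<open>\<xi> i\<close> at a rate bounded below.  Hence the mass of \<open>u\<close> in a small
  ball around \<open>\<xi> i\<close> is at most a constant times the energy of \<open>u\<close> in the shell, with a constant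
  that depends neither on \<open>\<epsilon>\<close> nor on \<open>u\<close> (\<open>local_pohozaev_estimate\<close>).  For the peak solution these two
  quantities have different orders.  All peaks stay away from the shell, so that only the tails of
  the profiles and the remainder contribute there, and the energy is \<open>o(\<epsilon>\<^sup>3)\<close>
  (\<open>energy_away_from_peaks_le\<close>).  The ball contains the \<open>i\<close>-th peak, whose mass is of order
  \<open>\<epsilon>\<^sup>3\<close> (\<open>peak_mass_lower_bound\<close>).  This is a contradiction.

  The weak formulation does not provide the second derivatives that would make \<open>\<eta> \<partial>\<^sub>e u\<close> an
  admissible test function.  The symmetric difference quotient \<open>(u(x + h e) - u(x - h e)) / 2h\<close> replaces
  \<open>\<partial>\<^sub>e u\<close>: in a quadratic expression \<open>\<integral> \<kappa>(x) g(x) \<bullet> (g(x + w) - g(x - w))\<close> a translation of the second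
  half moves the difference onto \<open>\<kappa>\<close> (\<open>integral_symmetric_difference\<close>), for \<open>g = \<nabla>u\<close> as well as for
  \<open>g = u\<close>, and square integrability of \<open>g\<close> suffices.  The term in which \<open>\<nabla>\<eta>\<close> meets the difference quotient
  is controlled by the \<open>L\<^sup>2\<close> bound for difference quotients of Sobolev functions
  (\<open>weak_gradient_difference_square_integral_le\<close>), and the power \<open>u\<^sup>p\<close> is treated by the mean value
  theorem and the continuity of \<open>u\<close>, with an error that disappears as \<open>h \<rightarrow> 0\<close>.

  Since \<open>wgrad\<close> is an arbitrary choice among the weak gradients, computing with it rests
  on their uniqueness up to null sets, hence on the fundamental lemma of the calculus of variations.
\<close>

section \<open>Local integrability and affine substitutions\<close>

definition test_function :: "(real^3 \<Rightarrow> real) \<Rightarrow> (real^3 \<Rightarrow> real^3) \<Rightarrow> bool" where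
  "test_function \<psi> \<psi>' \<longleftrightarrow>
     (\<forall>x. GDERIV \<psi> x :> \<psi>' x) \<and> continuous_on UNIV \<psi>' \<and> compact (closure {x. \<psi> x \<noteq> 0})"

definition square_integrable :: "('a::euclidean_space \<Rightarrow> 'b::euclidean_space) \<Rightarrow> bool" where
  "square_integrable f \<longleftrightarrow> f \<in> borel_measurable borel \<and> integrable lborel (\<lambda>x. (norm (f x))\<^sup>2)"

lemma borel_measurable_affine:
  fixes f :: "'a::euclidean_space \<Rightarrow> 'b::euclidean_space"
  assumes "f \<in> borel_measurable borel"
  shows "(\<lambda>x. f (t + c *\<^sub>R x)) \<in> borel_measurable borel"
proof -
  have "(\<lambda>x. t + c *\<^sub>R x) \<in> borel_measurable (borel :: 'a measure)" by measurable
  from measurable_compose[OF this assms] show ?thesis .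
qed

lemma
  fixes f :: "'a::euclidean_space \<Rightarrow> 'b::euclidean_space"
  assumes c: "c \<noteq> 0" and f: "f \<in> borel_measurable borel"
  shows lborel_integrable_affine_iff:
      "integrable lborel (\<lambda>x. f (t + c *\<^sub>R x)) \<longleftrightarrow> integrable lborel f"
    and lborel_integral_affine:
      "(LBINT x. f (t + c *\<^sub>R x)) = (LBINT x. f x) /\<^sub>R \<bar>c\<bar> ^ DIM('a)"
proof -
  let ?T = "\<lambda>x::'a. t + c *\<^sub>R x"
  have T: "?T \<in> measurable lborel borel" by measurable
  have m: "f \<in> borel_measurable (distr lborel borel ?T)" using f by simp
  have "integrable lborel f \<longleftrightarrow>
      integrable (density (distr lborel borel ?T) (\<lambda>_. ennreal (\<bar>c\<bar> ^ DIM('a)))) f"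
    using lborel_affine[OF c, of t] by (rule arg_cong[where f = "\<lambda>M. integrable M f"])
  also have "\<dots> \<longleftrightarrow> integrable (distr lborel borel ?T) (\<lambda>x. \<bar>c\<bar> ^ DIM('a) *\<^sub>R f x)"
    using m by (subst integrable_density) auto
  also have "\<dots> \<longleftrightarrow> integrable (distr lborel borel ?T) f"
    using integrable_scaleR_right[of "1 / \<bar>c\<bar> ^ DIM('a)" "distr lborel borel ?T" "\<lambda>x. \<bar>c\<bar> ^ DIM('a) *\<^sub>R f x"] c
    by auto
  also have "\<dots> \<longleftrightarrow> integrable lborel (\<lambda>x. f (?T x))"
    using f by (subst integrable_distr_eq[OF T]) auto
  finally show "integrable lborel (\<lambda>x. f (?T x)) \<longleftrightarrow> integrable lborel f" by simp
  have "(LBINT x. f x) =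
      (LINT x|density (distr lborel borel ?T) (\<lambda>_. ennreal (\<bar>c\<bar> ^ DIM('a))). f x)"
    using lborel_affine[OF c, of t] by (rule arg_cong[where f = "\<lambda>M. integral\<^sup>L M f"])
  also have "\<dots> = (LINT x|distr lborel borel ?T. \<bar>c\<bar> ^ DIM('a) *\<^sub>R f x)"
    using m by (subst integral_density) auto
  also have "\<dots> = \<bar>c\<bar> ^ DIM('a) *\<^sub>R (LINT x|distr lborel borel ?T. f x)"
    by simp
  also have "(LINT x|distr lborel borel ?T. f x) = (LBINT x. f (?T x))"
    using f by (subst integral_distr[OF T]) auto
  finally show "(LBINT x. f (?T x)) = (LBINT x. f x) /\<^sub>R \<bar>c\<bar> ^ DIM('a)"
    using c by simp
qed

lemma lborel_integral_translate:
  fixes f :: "'a::euclidean_space \<Rightarrow> 'b::euclidean_space"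
  assumes "f \<in> borel_measurable borel"
  shows "(LBINT x. f (x + w)) = (LBINT x. f x)"
  using lborel_integral_affine[of 1 f w] assms by (simp add: add.commute)

lemma lborel_integrable_translate_iff:
  fixes f :: "'a::euclidean_space \<Rightarrow> 'b::euclidean_space"
  assumes "f \<in> borel_measurable borel"
  shows "integrable lborel (\<lambda>x. f (x + w)) \<longleftrightarrow> integrable lborel f"
  using lborel_integrable_affine_iff[of 1 f w] assms by (simp add: add.commute)

lemma abs_integral_le:
  fixes f g :: "'a \<Rightarrow> real"
  assumes g: "integrable M g" and f: "f \<in> borel_measurable M" and le: "\<And>x. \<bar>f x\<bar> \<le> g x"
  shows "\<bar>LINT x|M. f x\<bar> \<le> (LINT x|M. g x)"
proof -
  have "integrable M f"
    by (rule Bochner_Integration.integrable_bound[OF g f])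
      (use order_trans[OF le abs_ge_self] in \<open>auto intro!: AE_I2\<close>)
  then have "(LINT x|M. \<bar>f x\<bar>) \<le> (LINT x|M. g x)" by (intro integral_mono integrable_abs g le)
  then show ?thesis by (rule order_trans[OF integral_abs_bound])
qed

text \<open>A factor that is merely continuous is harmless, because it is bounded on each compact set.\<close>
lemma locally_integrable_dominated:
  fixes f :: "real^3 \<Rightarrow> 'b::euclidean_space" and F :: "real^3 \<Rightarrow> 'c::euclidean_space"
    and c :: "real^3 \<Rightarrow> 'd::euclidean_space"
  assumes f: "locally_integrable f" and F: "F \<in> borel_measurable borel"
    and c: "continuous_on UNIV c" and le: "\<And>x. norm (F x) \<le> norm (c x) * norm (f x)"
  shows "locally_integrable F"
  unfolding locally_integrable_def set_integrable_def
proof (intro conjI allI impI)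
  show [measurable]: "F \<in> borel_measurable borel" by fact
  fix K :: "(real^3) set" assume K: "compact K"
  then have [measurable]: "K \<in> sets borel" by (rule borel_compact)
  have "bounded (c ` K)"
    by (rule compact_imp_bounded[OF compact_continuous_image[OF continuous_on_subset[OF c] K]]) simp
  then obtain C where C: "\<And>x. x \<in> K \<Longrightarrow> norm (c x) \<le> C" unfolding bounded_iff by blast
  have "integrable lborel (\<lambda>x. indicator K x *\<^sub>R f x)"
    using f K unfolding locally_integrable_def set_integrable_def by blast
  then have "integrable lborel (\<lambda>x. C * norm (indicator K x *\<^sub>R f x))"
    by (intro integrable_mult_right integrable_norm)
  then show "integrable lborel (\<lambda>x. indicator K x *\<^sub>R F x)"
  proof (rule Bochner_Integration.integrable_bound)
    show "AE x in lborel. norm (indicator K x *\<^sub>R F x) \<le> norm (C * norm (indicator K x *\<^sub>R f x))"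
    proof (rule AE_I2)
      fix x
      have "norm (F x) \<le> C * norm (f x)" if "x \<in> K"
        using le[of x] mult_right_mono[OF C[OF that], of "norm (f x)"] by simp
      then show "norm (indicator K x *\<^sub>R F x) \<le> norm (C * norm (indicator K x *\<^sub>R f x))"
        by (cases "x \<in> K") auto
    qed
  qed measurable
qed

lemma locally_integrable_imp_integrable:
  assumes F: "locally_integrable F" and K: "compact K" and z: "\<And>x. x \<notin> K \<Longrightarrow> F x = 0"
  shows "integrable lborel F"
proof -
  have "integrable lborel (\<lambda>x. indicator K x *\<^sub>R F x)"
    using F K unfolding locally_integrable_def set_integrable_def by blast
  moreover have "(\<lambda>x. indicator K x *\<^sub>R F x) = F" using z by (auto simp: indicator_def fun_eq_iff)
  ultimately show ?thesis by simp
qed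

lemma locally_integrable_scaleR:
  assumes f: "locally_integrable f" and c: "continuous_on UNIV \<psi>"
  shows "locally_integrable (\<lambda>x. \<psi> x *\<^sub>R f x)"
proof (rule locally_integrable_dominated[OF f _ c])
  have [measurable]: "f \<in> borel_measurable borel" using f by (simp add: locally_integrable_def)
  have [measurable]: "\<psi> \<in> borel_measurable borel" by (rule borel_measurable_continuous_onI[OF c])
  show "(\<lambda>x. \<psi> x *\<^sub>R f x) \<in> borel_measurable borel" by measurable
qed simp

lemma locally_integrable_scaleR':
  assumes f: "locally_integrable f" and c: "continuous_on UNIV \<psi>"
  shows "locally_integrable (\<lambda>x. f x *\<^sub>R \<psi> x)"
proof (rule locally_integrable_dominated[OF f _ c])
  have [measurable]: "f \<in> borel_measurable borel" using f by (simp add: locally_integrable_def)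
  have [measurable]: "\<psi> \<in> borel_measurable borel" by (rule borel_measurable_continuous_onI[OF c])
  show "(\<lambda>x. f x *\<^sub>R \<psi> x) \<in> borel_measurable borel" by measurable
qed simp

lemma locally_integrable_scaleR_integrable:
  fixes f :: "real^3 \<Rightarrow> 'b::euclidean_space" and \<psi> :: "real^3 \<Rightarrow> real"
  assumes "locally_integrable f" and "compact K" and "continuous_on UNIV \<psi>"
    and z: "\<And>x. x \<notin> K \<Longrightarrow> \<psi> x = 0"
  shows "integrable lborel (\<lambda>x. \<psi> x *\<^sub>R f x)"
  by (rule locally_integrable_imp_integrable[OF locally_integrable_scaleR[OF assms(1,3)] assms(2)]) (simp add: z)

lemma locally_integrable_scaleR_integrable':
  fixes f :: "real^3 \<Rightarrow> real" and \<psi> :: "real^3 \<Rightarrow> 'b::euclidean_space"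
  assumes "locally_integrable f" and "compact K" and "continuous_on UNIV \<psi>"
    and z: "\<And>x. x \<notin> K \<Longrightarrow> \<psi> x = 0"
  shows "integrable lborel (\<lambda>x. f x *\<^sub>R \<psi> x)"
  by (rule locally_integrable_imp_integrable[OF locally_integrable_scaleR'[OF assms(1,3)] assms(2)]) (simp add: z)

lemma locally_integrable_add:
  "locally_integrable f \<Longrightarrow> locally_integrable g \<Longrightarrow> locally_integrable (\<lambda>x. f x + g x)"
  by (auto simp: locally_integrable_def intro!: set_integral_add(1))

lemma integrable_const_indicator_compact: "compact K \<Longrightarrow> integrable lborel (\<lambda>x::real^3. C * indicator K x :: real)"
  using emeasure_compact_finite[of K]
  by (intro integrable_mult_right integrable_real_indicator) (auto intro: borel_compact)

lemma square_integrable_imp_locally_integrable: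
  fixes f :: "real^3 \<Rightarrow> 'b::euclidean_space"
  assumes "square_integrable f" shows "locally_integrable f"
  unfolding locally_integrable_def set_integrable_def
proof (intro conjI allI impI)
  show m[measurable]: "f \<in> borel_measurable borel" using assms by (simp add: square_integrable_def)
  fix K :: "(real^3) set" assume K: "compact K"
  then have [measurable]: "K \<in> sets borel" by (rule borel_compact)
  have "integrable lborel (\<lambda>x. 1 * indicator K x + (norm (f x))\<^sup>2)"
    using assms by (intro Bochner_Integration.integrable_add integrable_const_indicator_compact K)
      (simp add: square_integrable_def)
  then show "integrable lborel (\<lambda>x. indicator K x *\<^sub>R f x)"
  proof (rule Bochner_Integration.integrable_bound)
    show "AE x in lborel. norm (indicator K x *\<^sub>R f x) \<le> norm (1 * indicator K x + (norm (f x))\<^sup>2)"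
    proof (rule AE_I2)
      fix x
      have "norm (f x) \<le> 1 + (norm (f x))\<^sup>2"
        using sum_squares_bound[of 1 "norm (f x)"] norm_ge_zero[of "f x"] unfolding power_one by linarith
      then show "norm (indicator K x *\<^sub>R f x) \<le> norm (1 * indicator K x + (norm (f x))\<^sup>2)"
        by (auto simp: indicator_def)
    qed
  qed simp
qed

section \<open>Test functions and weak gradients\<close>

lemma GDERIV_continuous: assumes "\<And>x. GDERIV f x :> f' x" shows "continuous_on UNIV f"
proof (rule continuous_at_imp_continuous_on, rule ballI)
  fix x show "isCont f x" by (rule has_derivative_continuous[OF assms[unfolded gderiv_def]])
qed

text \<open>The gradient vanishes off the support as well: the complement of the closed support is open, and
  the function is constant there.\<close>
lemma test_functionD:
  fixes \<psi> :: "real^3 \<Rightarrow> real"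
  assumes t: "test_function \<psi> \<psi>'"
  defines "K \<equiv> closure {x. \<psi> x \<noteq> 0}"
  shows "compact K" "GDERIV \<psi> x :> \<psi>' x" "continuous_on UNIV \<psi>'" "continuous_on UNIV \<psi>"
    "x \<notin> K \<Longrightarrow> \<psi> x = 0" "x \<notin> K \<Longrightarrow> \<psi>' x = 0"
proof -
  have d: "GDERIV \<psi> x :> \<psi>' x" for x using t by (auto simp: test_function_def)
  show "compact K" "continuous_on UNIV \<psi>'" "GDERIV \<psi> x :> \<psi>' x"
    using t by (auto simp: test_function_def K_def)
  show "continuous_on UNIV \<psi>" by (rule GDERIV_continuous[OF d])
  have z: "\<psi> x = 0" if "x \<notin> K" for x using that closure_subset[of "{x. \<psi> x \<noteq> 0}"] by (auto simp: K_def)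
  then show "\<psi> x = 0" if "x \<notin> K" using that .
  show "\<psi>' x = 0" if "x \<notin> K"
  proof -
    have "((\<lambda>x. 0) has_derivative (\<lambda>h. h \<bullet> \<psi>' x)) (at x)"
    proof (rule has_derivative_transform_within_open)
      show "(\<psi> has_derivative (\<lambda>h. h \<bullet> \<psi>' x)) (at x)" using d by (simp add: gderiv_def)
      show "open (- K)" "x \<in> - K" using that by (auto simp: K_def)
    qed (use z in auto)
    then have "(\<lambda>h. h \<bullet> \<psi>' x) = (\<lambda>h. 0)"
      by (rule has_derivative_unique) (rule has_derivative_const)
    then have "\<psi>' x \<bullet> \<psi>' x = 0" by (rule fun_cong)
    then show ?thesis by simp
  qed
qed

lemma test_functionI:
  assumes "\<And>x. GDERIV \<psi> x :> \<psi>' x" "continuous_on UNIV \<psi>'" "compact K" "\<And>x. x \<notin> K \<Longrightarrow> \<psi> x = 0"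
  shows "test_function \<psi> \<psi>'"
  unfolding test_function_def
proof (intro conjI allI)
  have "closure {x. \<psi> x \<noteq> 0} \<subseteq> K"
    using assms by (intro closure_minimal) (auto intro: compact_imp_closed)
  then show "compact (closure {x. \<psi> x \<noteq> 0})"
    using assms(3) by (metis closed_closure compact_Int_closed inf.absorb_iff2)
qed (use assms in auto)

lemma weak_gradient_alt:
  "weak_gradient u g \<longleftrightarrow> locally_integrable u \<and> locally_integrable g \<and>
     (\<forall>\<psi> \<psi>'. test_function \<psi> \<psi>' \<longrightarrow> (LBINT x. u x *\<^sub>R \<psi>' x) = - (LBINT x. \<psi> x *\<^sub>R g x))"
  by (simp add: weak_gradient_def test_function_def)

lemma test_function_mult:
  assumes t: "test_function \<psi> \<psi>'" and e: "\<And>x. GDERIV \<eta> x :> \<eta>' x" and c: "continuous_on UNIV \<eta>'"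
  shows "test_function (\<lambda>x. \<psi> x * \<eta> x) (\<lambda>x. \<psi> x *\<^sub>R \<eta>' x + \<eta> x *\<^sub>R \<psi>' x)"
proof -
  let ?K = "closure {x. \<psi> x \<noteq> 0}"
  note K = test_functionD[OF t]
  have ce: "continuous_on UNIV \<eta>" by (rule GDERIV_continuous[OF e])
  have c': "continuous_on UNIV (\<lambda>x. \<psi> x *\<^sub>R \<eta>' x + \<eta> x *\<^sub>R \<psi>' x)"
    by (rule continuous_on_add[OF continuous_on_scaleR[OF K(4) c] continuous_on_scaleR[OF ce K(3)]])
  have d: "GDERIV (\<lambda>x. \<psi> x * \<eta> x) x :> \<psi> x *\<^sub>R \<eta>' x + \<eta> x *\<^sub>R \<psi>' x" for x
    by (rule GDERIV_mult[OF K(2) e])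
  have z: "\<psi> x * \<eta> x = 0" if "x \<notin> ?K" for x using K(5)[OF that] by simp
  show ?thesis
    by (rule test_functionI[OF d c' K(1) z])
qed

lemma GDERIV_affine:
  assumes "GDERIV f (t + c *\<^sub>R x) :> D"
  shows "GDERIV (\<lambda>x. f (t + c *\<^sub>R x)) x :> c *\<^sub>R D"
proof -
  have "((\<lambda>x. t + c *\<^sub>R x) has_derivative (\<lambda>h. c *\<^sub>R h)) (at x)"
    using has_derivative_add[OF has_derivative_const has_derivative_scaleR_right[OF has_derivative_ident]] by simp
  from has_derivative_compose[OF this assms[unfolded gderiv_def]] show ?thesis
    unfolding gderiv_def inner_scaleR_left inner_scaleR_right .
qed

lemma test_function_affine:
  assumes t: "test_function \<psi> \<psi>'" and c: "c \<noteq> 0"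
  shows "test_function (\<lambda>x. \<psi> (t + c *\<^sub>R x)) (\<lambda>x. c *\<^sub>R \<psi>' (t + c *\<^sub>R x))"
proof -
  let ?K = "closure {x. \<psi> x \<noteq> 0}"
  note K = test_functionD[OF t]
  let ?L = "(\<lambda>z. (z - t) /\<^sub>R c) ` ?K"
  show ?thesis
  proof (rule test_functionI[of _ _ ?L])
    show "compact ?L" by (intro compact_continuous_image continuous_intros K)
    show "\<psi> (t + c *\<^sub>R x) = 0" if "x \<notin> ?L" for x
    proof (rule K(5), rule notI)
      assume "t + c *\<^sub>R x \<in> ?K"
      then have "(t + c *\<^sub>R x - t) /\<^sub>R c \<in> ?L" by blast
      with that c show False by simp
    qed
    show "continuous_on UNIV (\<lambda>x. c *\<^sub>R \<psi>' (t + c *\<^sub>R x))"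
      by (rule continuous_on_scaleR[OF continuous_on_const continuous_on_compose2[OF K(3)]])
        (intro continuous_intros subset_UNIV)+
    show "GDERIV (\<lambda>x. \<psi> (t + c *\<^sub>R x)) x :> c *\<^sub>R \<psi>' (t + c *\<^sub>R x)" for x
      by (rule GDERIV_affine[OF K(2)])
  qed
qed

lemma weak_gradient_add:
  assumes "weak_gradient u g" "weak_gradient v h"
  shows "weak_gradient (\<lambda>x. u x + v x) (\<lambda>x. g x + h x)"
  unfolding weak_gradient_alt
proof (intro conjI allI impI)
  show "locally_integrable (\<lambda>x. u x + v x)" "locally_integrable (\<lambda>x. g x + h x)"
    using assms by (auto simp: weak_gradient_alt intro!: locally_integrable_add)
  fix \<psi> \<psi>' assume t: "test_function \<psi> \<psi>'"
  let ?K = "closure {x. \<psi> x \<noteq> 0}"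
  note K = test_functionD[OF t]
  have li: "locally_integrable u" "locally_integrable v" "locally_integrable g" "locally_integrable h"
    using assms by (auto simp: weak_gradient_alt)
  note i1 = locally_integrable_scaleR_integrable'[OF li(1) K(1) K(3) K(6)]
    locally_integrable_scaleR_integrable'[OF li(2) K(1) K(3) K(6)]
  note i2 = locally_integrable_scaleR_integrable[OF li(3) K(1) K(4) K(5)]
    locally_integrable_scaleR_integrable[OF li(4) K(1) K(4) K(5)]
  have "(LBINT x. (u x + v x) *\<^sub>R \<psi>' x) = (LBINT x. u x *\<^sub>R \<psi>' x) + (LBINT x. v x *\<^sub>R \<psi>' x)"
    unfolding scaleR_add_left by (rule Bochner_Integration.integral_add[OF i1])
  also have "\<dots> = - (LBINT x. \<psi> x *\<^sub>R g x) + - (LBINT x. \<psi> x *\<^sub>R h x)"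
    using assms t by (simp add: weak_gradient_alt)
  also have "\<dots> = - ((LBINT x. \<psi> x *\<^sub>R g x) + (LBINT x. \<psi> x *\<^sub>R h x))" by simp
  also have "(LBINT x. \<psi> x *\<^sub>R g x) + (LBINT x. \<psi> x *\<^sub>R h x) = (LBINT x. \<psi> x *\<^sub>R (g x + h x))"
    unfolding scaleR_add_right by (rule Bochner_Integration.integral_add[OF i2, symmetric])
  finally show "(LBINT x. (u x + v x) *\<^sub>R \<psi>' x) = - (LBINT x. \<psi> x *\<^sub>R (g x + h x))" .
qed

text \<open>The product of a test function with a continuously differentiable \<open>\<eta>\<close> is again a test function; the
  rule follows by inserting it into the definition.  Constant \<open>\<eta>\<close> yields scalar multiples.\<close>
lemma weak_gradient_mult:
  assumes w: "weak_gradient u g" and e: "\<And>x. GDERIV \<eta> x :> \<eta>' x" and c: "continuous_on UNIV \<eta>'"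
  shows "weak_gradient (\<lambda>x. \<eta> x * u x) (\<lambda>x. u x *\<^sub>R \<eta>' x + \<eta> x *\<^sub>R g x)"
  unfolding weak_gradient_alt
proof (intro conjI allI impI)
  have u: "locally_integrable u" and g: "locally_integrable g"
    using w by (auto simp: weak_gradient_alt)
  have ce: "continuous_on UNIV \<eta>" by (rule GDERIV_continuous[OF e])
  show "locally_integrable (\<lambda>x. \<eta> x * u x)" using locally_integrable_scaleR[OF u ce] by simp
  show "locally_integrable (\<lambda>x. u x *\<^sub>R \<eta>' x + \<eta> x *\<^sub>R g x)"
    by (intro locally_integrable_add locally_integrable_scaleR[OF g ce] locally_integrable_scaleR'[OF u c])
  fix \<psi> \<psi>' assume t: "test_function \<psi> \<psi>'"
  let ?K = "closure {x. \<psi> x \<noteq> 0}"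
  note K = test_functionD[OF t]
  have i1: "integrable lborel (\<lambda>x. u x *\<^sub>R (\<psi> x *\<^sub>R \<eta>' x))"
    by (rule locally_integrable_scaleR_integrable'[OF u K(1) continuous_on_scaleR[OF K(4) c]]) (drule K(5), simp)
  have i2: "integrable lborel (\<lambda>x. u x *\<^sub>R (\<eta> x *\<^sub>R \<psi>' x))"
    by (rule locally_integrable_scaleR_integrable'[OF u K(1) continuous_on_scaleR[OF ce K(3)]]) (drule K(6), simp)
  have i3: "integrable lborel (\<lambda>x. (\<psi> x * \<eta> x) *\<^sub>R g x)"
    by (rule locally_integrable_scaleR_integrable[OF g K(1) continuous_on_mult[OF K(4) ce]]) (drule K(5), simp)
  have "(LBINT x. u x *\<^sub>R (\<psi> x *\<^sub>R \<eta>' x + \<eta> x *\<^sub>R \<psi>' x)) = - (LBINT x. (\<psi> x * \<eta> x) *\<^sub>R g x)"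
    using w test_function_mult[OF t e c] by (auto simp: weak_gradient_alt)
  then have "(LBINT x. u x *\<^sub>R (\<psi> x *\<^sub>R \<eta>' x)) + (LBINT x. u x *\<^sub>R (\<eta> x *\<^sub>R \<psi>' x))
      = - (LBINT x. (\<psi> x * \<eta> x) *\<^sub>R g x)"
    using i1 i2 by (simp add: scaleR_add_right del: scaleR_scaleR)
  then show "(LBINT x. (\<eta> x * u x) *\<^sub>R \<psi>' x) = - (LBINT x. \<psi> x *\<^sub>R (u x *\<^sub>R \<eta>' x + \<eta> x *\<^sub>R g x))"
    using i1 i3 by (simp add: scaleR_add_right mult.commute algebra_simps eq_neg_iff_add_eq_0 )
qed

text \<open>Translations (\<open>c = 1\<close>) give the difference quotients, and \<open>c = 1 / \<epsilon>\<close> the rescaled profiles.\<close>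
lemma weak_gradient_affine:
  assumes w: "weak_gradient u g" and c: "c \<noteq> 0"
  shows "weak_gradient (\<lambda>x. u (t + c *\<^sub>R x)) (\<lambda>x. c *\<^sub>R g (t + c *\<^sub>R x))"
  unfolding weak_gradient_alt
proof (intro conjI allI impI)
  have u: "locally_integrable u" and g: "locally_integrable g"
    using w by (auto simp: weak_gradient_alt)
  have [measurable]: "u \<in> borel_measurable borel" "g \<in> borel_measurable borel"
    using u g by (auto simp: locally_integrable_def)
  have li: "locally_integrable (\<lambda>x. f (t + c *\<^sub>R x))" if f: "locally_integrable f"
    for f :: "real^3 \<Rightarrow> 'b::euclidean_space"
    unfolding locally_integrable_def set_integrable_def
  proof (intro conjI allI impI)
    have fm[measurable]: "f \<in> borel_measurable borel" using f by (simp add: locally_integrable_def)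
    show "(\<lambda>x. f (t + c *\<^sub>R x)) \<in> borel_measurable borel" by (rule borel_measurable_affine[OF fm])
    fix K :: "(real^3) set" assume K: "compact K"
    let ?L = "(\<lambda>x. t + c *\<^sub>R x) ` K"
    have L: "compact ?L" by (intro compact_continuous_image continuous_intros K)
    then have [measurable]: "?L \<in> sets borel" by (rule borel_compact)
    have "integrable lborel (\<lambda>x. indicator ?L x *\<^sub>R f x)"
      using f L unfolding locally_integrable_def set_integrable_def by blast
    then have "integrable lborel (\<lambda>x. indicator ?L (t + c *\<^sub>R x) *\<^sub>R f (t + c *\<^sub>R x))"
      by (subst lborel_integrable_affine_iff[OF c]) auto
    moreover have "indicator ?L (t + c *\<^sub>R x) = (indicator K x :: real)" for x
      using c by (auto simp: indicator_def)
    ultimately show "integrable lborel (\<lambda>x. indicator K x *\<^sub>R f (t + c *\<^sub>R x))" by simp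
  qed
  show "locally_integrable (\<lambda>x. u (t + c *\<^sub>R x))" by (rule li[OF u])
  show "locally_integrable (\<lambda>x. c *\<^sub>R g (t + c *\<^sub>R x))"
    using li[OF g] by (auto simp: locally_integrable_def set_integrable_def intro!: integrable_scaleR_right
        simp: scaleR_left_commute[of _ c] simp del: scaleR_scaleR)
  fix \<psi> \<psi>' assume T: "test_function \<psi> \<psi>'"
  then have [measurable]: "\<psi> \<in> borel_measurable borel" "\<psi>' \<in> borel_measurable borel"
    by (auto intro: borel_measurable_continuous_onI test_functionD[OF T])
  \<comment> \<open>The inverse substitution \<open>x \<mapsto> s + d x\<close> is applied to the test function.\<close>
  define s where "s = - t /\<^sub>R c"
  define d where "d = 1 / c"
  have d: "d \<noteq> 0" using c by (simp add: d_def)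
  have inv: "s + d *\<^sub>R (t + c *\<^sub>R x) = x" for x
    using c by (simp add: s_def d_def scaleR_add_right divide_inverse)
  from test_function_affine[OF T d, of s]
  have T': "test_function (\<lambda>x. \<psi> (s + d *\<^sub>R x)) (\<lambda>x. d *\<^sub>R \<psi>' (s + d *\<^sub>R x))" .
  have [measurable]: "(\<lambda>x. \<psi> (s + d *\<^sub>R x)) \<in> borel_measurable borel"
      "(\<lambda>x. \<psi>' (s + d *\<^sub>R x)) \<in> borel_measurable borel"
    by (rule borel_measurable_affine; simp)+
  have E: "(LBINT x. u x *\<^sub>R (d *\<^sub>R \<psi>' (s + d *\<^sub>R x))) = - (LBINT x. \<psi> (s + d *\<^sub>R x) *\<^sub>R g x)"
    using w T' unfolding weak_gradient_alt by blast
  have "(LBINT x. u (t + c *\<^sub>R x) *\<^sub>R (d *\<^sub>R \<psi>' x)) =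
      (LBINT x. u x *\<^sub>R (d *\<^sub>R \<psi>' (s + d *\<^sub>R x))) /\<^sub>R \<bar>c\<bar> ^ DIM(real^3)"
    using lborel_integral_affine[OF c, of "\<lambda>x. u x *\<^sub>R (d *\<^sub>R \<psi>' (s + d *\<^sub>R x))" t] by (simp add: inv)
  also have "\<dots> = - ((LBINT x. \<psi> (s + d *\<^sub>R x) *\<^sub>R g x) /\<^sub>R \<bar>c\<bar> ^ DIM(real^3))"
    by (simp only: E scaleR_minus_right)
  also have "\<dots> = - (LBINT x. \<psi> x *\<^sub>R g (t + c *\<^sub>R x))"
    using lborel_integral_affine[OF c, of "\<lambda>x. \<psi> (s + d *\<^sub>R x) *\<^sub>R g x" t] by (simp add: inv)
  finally have "c *\<^sub>R (d *\<^sub>R (LBINT x. u (t + c *\<^sub>R x) *\<^sub>R \<psi>' x)) =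
      - (c *\<^sub>R (LBINT x. \<psi> x *\<^sub>R g (t + c *\<^sub>R x)))"
    by (simp add: scaleR_left_commute[of _ d] del: scaleR_scaleR)
  then show "(LBINT x. u (t + c *\<^sub>R x) *\<^sub>R \<psi>' x) = - (LBINT x. \<psi> x *\<^sub>R (c *\<^sub>R g (t + c *\<^sub>R x)))"
    using c by (simp add: d_def scaleR_left_commute[of _ c] del: scaleR_scaleR) simp
qed

section \<open>Continuously differentiable cutoffs\<close>

definition pos_square :: "real \<Rightarrow> real" where "pos_square s = (max 0 s)\<^sup>2"

lemma DERIV_pos_square: "DERIV pos_square s :> 2 * max 0 s"
proof -
  consider "s > 0" | "s < 0" | "s = 0" by linarith
  then show ?thesis
  proof cases
    case 1
    have "DERIV (\<lambda>s. s\<^sup>2) s :> 2 * s" by (auto intro!: derivative_eq_intros)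
    then show ?thesis using 1
      by (auto simp: pos_square_def intro: has_field_derivative_transform_within_open[of _ _ _ "{0<..}"])
  next
    case 2
    have "DERIV (\<lambda>s. 0) s :> 0" by (auto intro!: derivative_eq_intros)
    then show ?thesis using 2
      by (intro has_field_derivative_transform_within_open[of "\<lambda>s. 0" _ s "{..<0}" pos_square])
        (auto simp: pos_square_def)
  next
    case 3
    have "((\<lambda>h. (pos_square (0 + h) - pos_square 0) / h) \<longlongrightarrow> 0) (at 0)"
    proof (rule Lim_null_comparison)
      show "\<forall>\<^sub>F h in at 0. norm ((pos_square (0 + h) - pos_square 0) / h) \<le> \<bar>h\<bar>"
        by (auto simp: pos_square_def max_def power2_eq_square)
      show "((\<lambda>h::real. \<bar>h\<bar>) \<longlongrightarrow> 0) (at 0)" by (auto intro!: tendsto_eq_intros)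
    qed
    then show ?thesis using 3 by (simp add: DERIV_def)
  qed
qed

text \<open>Composing the \<open>C\<^sup>1\<close> function \<open>s \<mapsto> max(0, s)\<^sup>2\<close> with itself, up to reflections, gives a \<open>C\<^sup>1\<close> step that is 0 up to 0 and
  1 from 1 on.\<close>
definition smooth_step :: "real \<Rightarrow> real" where "smooth_step t = pos_square (1 - pos_square (1 - t))"
definition smooth_step' :: "real \<Rightarrow> real" where
  "smooth_step' t = 4 * max 0 (1 - pos_square (1 - t)) * max 0 (1 - t)"

lemma continuous_on_pos_square [continuous_intros]:
  "continuous_on S f \<Longrightarrow> continuous_on S (\<lambda>x. pos_square (f x))"
  unfolding pos_square_def by (intro continuous_intros)

lemma DERIV_smooth_step: "DERIV smooth_step t :> smooth_step' t"
proof -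
  have "DERIV (\<lambda>t. 1 - pos_square (1 - t)) t :> - (2 * max 0 (1 - t) * - 1)"
    by (auto intro!: derivative_eq_intros DERIV_chain2[OF DERIV_pos_square])
  from DERIV_chain2[OF DERIV_pos_square this] show ?thesis
    by (simp add: smooth_step_def[abs_def] smooth_step'_def mult_ac)
qed

lemma continuous_on_smooth_step' [continuous_intros]:
  "continuous_on S f \<Longrightarrow> continuous_on S (\<lambda>x. smooth_step' (f x))"
  unfolding smooth_step'_def by (intro continuous_intros)

lemma smooth_step_nonpos: "t \<le> 0 \<Longrightarrow> smooth_step t = 0"
proof -
  assume "t \<le> 0"
  then have "1 \<le> (max 0 (1 - t))\<^sup>2" by (simp add: one_le_power)
  then show "smooth_step t = 0" by (simp add: smooth_step_def pos_square_def)
qed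

lemma smooth_step_ge1: "1 \<le> t \<Longrightarrow> smooth_step t = 1"
  by (simp add: smooth_step_def pos_square_def)

lemma smooth_step_bounds: "0 \<le> smooth_step t" "smooth_step t \<le> 1"
proof -
  show "0 \<le> smooth_step t" by (simp add: smooth_step_def pos_square_def)
  have "max 0 (1 - pos_square (1 - t)) \<le> 1" by (simp add: pos_square_def)
  then show "smooth_step t \<le> 1" unfolding smooth_step_def pos_square_def[of "1 - _"]
    by (intro power_le_one) auto
qed

lemma smooth_step'_zero: "t \<le> 0 \<Longrightarrow> smooth_step' t = 0" "1 \<le> t \<Longrightarrow> smooth_step' t = 0"
proof -
  assume "t \<le> 0"
  then have "1 \<le> (max 0 (1 - t))\<^sup>2" by (simp add: one_le_power)
  then show "smooth_step' t = 0" by (simp add: smooth_step'_def pos_square_def)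
qed (simp add: smooth_step'_def)

section \<open>The fundamental lemma of the calculus of variations\<close>

text \<open>The sets over which the integral of \<open>F\<close> vanishes form a Dynkin system, so the hypothesis extends from
  the generator to all Borel sets, in particular to the sets where \<open>F\<close> is positive or negative.\<close>
lemma integral_mult_indicator_zero_imp_AE_zero:
  fixes F :: "'a::euclidean_space \<Rightarrow> real"
  assumes F: "integrable lborel F" and S: "Int_stable S" and sp: "borel = sigma UNIV S"
    and U: "UNIV \<in> S"
    and z: "\<And>A. A \<in> S \<Longrightarrow> (LBINT x. indicator A x *\<^sub>R F x) = 0"
  shows "AE x in lborel. F x = 0"
proof -
  have SB: "sigma_sets UNIV S = sets borel" by (subst sp) simp
  have all: "(LBINT x. indicator A x *\<^sub>R F x) = 0" if "A \<in> sigma_sets UNIV S" for A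
  proof (rule sigma_sets_induct_disjoint[OF S _ that, of "\<lambda>A. (LBINT x. indicator A x *\<^sub>R F x) = 0"])
    show "S \<subseteq> Pow UNIV" by simp
    show "(LBINT x. indicator A x *\<^sub>R F x) = 0" if "A \<in> S" for A by (rule z[OF that])
    show "(LBINT x. indicator {} x *\<^sub>R F x) = 0" by simp
  next
    fix A assume compl: "A \<in> sigma_sets UNIV S" "(LBINT x. indicator A x *\<^sub>R F x) = 0" 
    have [measurable]: "A \<in> sets borel" using compl(1) SB by simp
    have "(LBINT x. indicator (UNIV - A) x *\<^sub>R F x)
        = (LBINT x. indicator UNIV x *\<^sub>R F x - indicator A x *\<^sub>R F x)"
      by (intro Bochner_Integration.integral_cong) (auto simp: indicator_def)
    also have "\<dots> = (LBINT x. indicator UNIV x *\<^sub>R F x) - (LBINT x. indicator A x *\<^sub>R F x)"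
      by (rule Bochner_Integration.integral_diff; rule integrable_mult_indicator[OF _ F]; simp)
    finally show "(LBINT x. indicator (UNIV - A) x *\<^sub>R F x) = 0" using z[OF U] compl(2) by simp
  next
    fix A :: "nat \<Rightarrow> 'a set"
    assume union: "disjoint_family A" "range A \<subseteq> sigma_sets UNIV S"
      "\<And>i. (LBINT x. indicator (A i) x *\<^sub>R F x) = 0"
    have Am: "A i \<in> sets borel" for i using union(2) SB by auto
    have int: "set_integrable lborel (\<Union>i. A i) F"
      unfolding set_integrable_def by (rule integrable_mult_indicator[OF _ F]) (use Am in auto)
    have "set_lebesgue_integral lborel (\<Union>i. A i) F = (\<Sum>i. set_lebesgue_integral lborel (A i) F)"
    proof (rule lebesgue_integral_countable_add)
      show "A i \<inter> A j = {}" if "i \<noteq> j" for i j using union(1) that by (auto simp: disjoint_family_on_def)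
    qed (use int Am in auto)
    then show "(LBINT x. indicator (\<Union>i. A i) x *\<^sub>R F x) = 0"
      using union(3) by (simp add: set_lebesgue_integral_def)
  qed
  have [measurable]: "F \<in> borel_measurable borel" using F by simp
  have "AE x in lborel. c * F x \<le> 0" if c: "c = 1 \<or> c = -1" for c :: real
  proof -
    define A where "A = {x. 0 < c * F x}"
    have A[measurable]: "A \<in> sets borel" unfolding A_def by measurable
    have "(LBINT x. c * (indicator A x *\<^sub>R F x)) = 0"
      using all[of A] A SB by simp
    moreover have "integrable lborel (\<lambda>x. c * (indicator A x *\<^sub>R F x))"
      by (intro integrable_mult_right integrable_mult_indicator F) simp
    moreover have "AE x in lborel. 0 \<le> c * (indicator A x *\<^sub>R F x)"
      by (auto simp: A_def indicator_def)
    ultimately have "AE x in lborel. c * (indicator A x *\<^sub>R F x) = 0"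
      using integral_nonneg_eq_0_iff_AE by blast
    then show ?thesis by eventually_elim (auto simp: A_def indicator_def)
  qed
  from this[of 1] this[of "-1"] show ?thesis
    by (auto elim!: eventually_elim2)
qed

text \<open>Equal to 1 on the ball of radius \<open>r\<close> and to 0 where the distance is at least \<open>\<surd>2 r\<close>; the weaker radius
  \<open>2 r\<close> is used throughout.\<close>
definition cutoff :: "real^3 \<Rightarrow> real \<Rightarrow> real^3 \<Rightarrow> real" where
  "cutoff z r x = smooth_step (2 - ((x - z) \<bullet> (x - z)) / r\<^sup>2)"
definition cutoff' :: "real^3 \<Rightarrow> real \<Rightarrow> real^3 \<Rightarrow> real^3" where
  "cutoff' z r x = (smooth_step' (2 - ((x - z) \<bullet> (x - z)) / r\<^sup>2) * (- 2 / r\<^sup>2)) *\<^sub>R (x - z)"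

lemma GDERIV_cutoff: "GDERIV (cutoff z r) x :> cutoff' z r x"
proof -
  have "GDERIV (\<lambda>x. 2 - ((x - z) \<bullet> (x - z)) / r\<^sup>2) x :> (- 2 / r\<^sup>2) *\<^sub>R (x - z)"
    unfolding gderiv_def divide_inverse
    by (rule derivative_eq_intros refl | simp)+
      (auto simp: fun_eq_iff inner_commute inner_diff_left inner_diff_right algebra_simps)
  from GDERIV_DERIV_compose[OF this DERIV_smooth_step] show ?thesis
    by (simp add: cutoff_def[abs_def] cutoff'_def)
qed

lemma continuous_cutoff': "continuous_on UNIV (cutoff' z r)"
  unfolding cutoff'_def[abs_def] smooth_step'_def pos_square_def divide_inverse by (intro continuous_intros)

lemma inner_diff_self_eq_dist_square: "(x - z) \<bullet> (x - z) = (dist x z)\<^sup>2"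
  by (simp add: dist_norm power2_norm_eq_inner)

lemma cutoff_eq_1: assumes "0 < r" "dist x z \<le> r" shows "cutoff z r x = 1"
proof -
  have "(dist x z)\<^sup>2 \<le> r\<^sup>2" using assms by (intro power_mono) auto
  then show ?thesis using assms unfolding cutoff_def inner_diff_self_eq_dist_square by (intro smooth_step_ge1) (simp add: field_simps)
qed

lemma cutoff_eq_0: assumes "0 < r" "2 * r \<le> dist x z" shows "cutoff z r x = 0"
proof -
  have "(2 * r)\<^sup>2 \<le> (dist x z)\<^sup>2" using assms by (intro power_mono) auto
  then have "2 * r\<^sup>2 \<le> (dist x z)\<^sup>2" using zero_le_power2[of r] unfolding power_mult_distrib power2_eq_square[of "2::real"] by linarith
  then show ?thesis using assms unfolding cutoff_def inner_diff_self_eq_dist_square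
    by (intro smooth_step_nonpos) (simp add: pos_le_divide_eq power_mult_distrib)
qed

lemma cutoff'_eq_0: assumes "0 < r" "dist x z \<le> r \<or> 2 * r \<le> dist x z" shows "cutoff' z r x = 0"
proof -
  from assms(2) have "smooth_step' (2 - ((x - z) \<bullet> (x - z)) / r\<^sup>2) = 0"
  proof
    assume "dist x z \<le> r"
    then have "(dist x z)\<^sup>2 \<le> r\<^sup>2" using assms by (intro power_mono) auto
    then show ?thesis using assms(1) unfolding inner_diff_self_eq_dist_square by (intro smooth_step'_zero) (simp add: field_simps)
  next
    assume "2 * r \<le> dist x z"
    then have "(2 * r)\<^sup>2 \<le> (dist x z)\<^sup>2" using assms by (intro power_mono) auto
    then have "2 * r\<^sup>2 \<le> (dist x z)\<^sup>2" using zero_le_power2[of r] unfolding power_mult_distrib power2_eq_square[of "2::real"] by linarith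
    then show ?thesis using assms(1) unfolding inner_diff_self_eq_dist_square
      by (intro smooth_step'_zero(1)) (simp add: pos_le_divide_eq power_mult_distrib)
  qed
  then show ?thesis by (simp add: cutoff'_def)
qed

lemma cutoff_bounds: "0 \<le> cutoff z r x" "cutoff z r x \<le> 1"
  by (simp_all add: cutoff_def smooth_step_bounds)

lemma test_function_cutoff: "0 < r \<Longrightarrow> test_function (cutoff z r) (cutoff' z r)"
proof (rule test_functionI[OF GDERIV_cutoff continuous_cutoff', of "cball z (2 * r)"])
  show "cutoff z r x = 0" if "0 < r" "x \<notin> cball z (2 * r)" for x
    using that by (intro cutoff_eq_0) (auto simp: dist_commute)
qed auto

text \<open>Positivity sets of nonnegative \<open>C\<^sup>1\<close> functions are suited to the fundamental lemma: they are closed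
  under intersection (multiply the functions), their indicators are limits of \<open>C\<^sup>1\<close> functions,
  and they include the half-spaces, which generate the Borel sets.\<close>
lemma sigma_positivity_sets:
  "borel = sigma UNIV {A::(real^3) set. \<exists>P P'. (\<forall>x. GDERIV P x :> P' x) \<and> continuous_on UNIV P' \<and>
      (\<forall>x. 0 \<le> P x) \<and> A = {x. 0 < P x}}" (is "_ = sigma _ ?S")
proof (rule borel_eq_sigmaI1[OF borel_eq_halfspace_greater, where F = "\<lambda>A. A", unfolded image_ident])
  fix A :: "(real^3) set" assume "A \<in> (\<lambda>(a, i). {x. a < x \<bullet> i}) ` (UNIV \<times> Basis)"
  then obtain a i where A: "A = {x. a < x \<bullet> i}" by auto
  have g: "GDERIV (\<lambda>x. pos_square (x \<bullet> i - a)) x :> (2 * max 0 (x \<bullet> i - a)) *\<^sub>R i" for x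
  proof (rule GDERIV_DERIV_compose[OF _ DERIV_pos_square])
    show "GDERIV (\<lambda>x. x \<bullet> i - a) x :> i" unfolding gderiv_def
      by (rule derivative_eq_intros refl | simp)+
  qed
  have "A \<in> ?S"
  proof (rule CollectI, intro exI conjI allI)
    show "GDERIV (\<lambda>x. pos_square (x \<bullet> i - a)) x :> (2 * max 0 (x \<bullet> i - a)) *\<^sub>R i" for x by (rule g)
    show "continuous_on UNIV (\<lambda>x. (2 * max 0 (x \<bullet> i - a)) *\<^sub>R i)" by (intro continuous_intros)
    show "A = {x. 0 < pos_square (x \<bullet> i - a)}" by (auto simp: A pos_square_def max_def)
  qed (simp add: pos_square_def)
  then show "A \<in> sets (sigma UNIV ?S)" by (simp add: sigma_sets.Basic)
next
  fix A assume "A \<in> ?S"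
  then obtain P P' where P: "\<And>x. GDERIV P x :> P' x" "A = {x::real^3. 0 < P x}" by blast
  have "continuous_on UNIV P" by (rule GDERIV_continuous[OF P(1)])
  then show "A \<in> sets borel"
    unfolding P(2) by (intro borel_open open_Collect_less continuous_intros)
qed

text \<open>For a fixed test function \<open>\<psi>\<close>, the functions \<open>smooth_step (n P)\<close> converge to the indicator of
  \<open>{x. 0 < P x}\<close>, and \<open>\<psi> smooth_step (n P)\<close> is a test function.  Hence the integrable function \<open>\<psi> f\<close> has zero
  integral over all positivity sets, and it vanishes almost everywhere.  Cutoffs of growing
  radius for \<open>\<psi>\<close> then exhaust the space.\<close>
lemma AE_zero_if_integral_test_function_zero:
  fixes f :: "real^3 \<Rightarrow> real"
  assumes f: "locally_integrable f"
    and z: "\<And>\<psi> \<psi>'. test_function \<psi> \<psi>' \<Longrightarrow> (LBINT x. \<psi> x * f x) = 0"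
  shows "AE x in lborel. f x = 0"
proof -
  let ?S = "{A::(real^3) set. \<exists>P P'. (\<forall>x. GDERIV P x :> P' x) \<and> continuous_on UNIV P' \<and>
      (\<forall>x. 0 \<le> P x) \<and> A = {x. 0 < P x}}"
  have fm[measurable]: "f \<in> borel_measurable borel" using f by (simp add: locally_integrable_def)
  have loc: "AE x in lborel. \<psi> x * f x = 0" if t: "test_function \<psi> \<psi>'" for \<psi> \<psi>'
  proof (rule integral_mult_indicator_zero_imp_AE_zero[OF _ _ sigma_positivity_sets])
    note K = test_functionD[OF t]
    have [measurable]: "\<psi> \<in> borel_measurable borel" by (rule borel_measurable_continuous_onI[OF K(4)])
    show F: "integrable lborel (\<lambda>x. \<psi> x * f x)"
      using locally_integrable_scaleR_integrable[OF f K(1,4,5)] by simp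
    show "Int_stable ?S"
    proof (rule Int_stableI)
      fix A B assume "A \<in> ?S" "B \<in> ?S"
      then obtain P P' Q Q' where
        P: "\<And>x. GDERIV P x :> P' x" "continuous_on UNIV P'" "\<And>x. 0 \<le> P x" "A = {x. 0 < P x}" and
        Q: "\<And>x. GDERIV Q x :> Q' x" "continuous_on UNIV Q'" "\<And>x. 0 \<le> Q x" "B = {x. 0 < Q x}"
        by blast
      have c: "continuous_on UNIV P" "continuous_on UNIV Q"
        by (rule GDERIV_continuous[OF P(1)], rule GDERIV_continuous[OF Q(1)])
      show "A \<inter> B \<in> ?S"
      proof (rule CollectI, intro exI conjI allI)
        show "GDERIV (\<lambda>x. P x * Q x) x :> P x *\<^sub>R Q' x + Q x *\<^sub>R P' x" for x
          by (rule GDERIV_mult[OF P(1) Q(1)])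
        show "continuous_on UNIV (\<lambda>x. P x *\<^sub>R Q' x + Q x *\<^sub>R P' x)"
          by (rule continuous_on_add[OF continuous_on_scaleR[OF c(1) Q(2)] continuous_on_scaleR[OF c(2) P(2)]])
        show "0 \<le> P x * Q x" for x using P(3) Q(3) by simp
        show "A \<inter> B = {x. 0 < P x * Q x}"
          using P(3) Q(3) by (auto simp: P(4) Q(4) zero_less_mult_iff not_less[symmetric])
      qed
    qed
    show "UNIV \<in> ?S"
    proof (rule CollectI, intro exI conjI allI)
      show "GDERIV (\<lambda>x. 1) x :> 0" for x :: "real^3" by (rule GDERIV_const)
    qed auto
    fix A assume "A \<in> ?S"
    then obtain P P' where
        P: "\<And>x. GDERIV P x :> P' x" "continuous_on UNIV P'" "\<And>x. 0 \<le> P x" "A = {x. 0 < P x}"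
      by blast
    have c: "continuous_on UNIV P" by (rule GDERIV_continuous[OF P(1)])
    have [measurable]: "P \<in> borel_measurable borel" by (rule borel_measurable_continuous_onI[OF c])
    have [measurable]: "A \<in> sets borel" unfolding P(4) by measurable
    have [measurable]: "smooth_step \<in> borel_measurable borel"
      unfolding smooth_step_def[abs_def] pos_square_def by measurable
    have "(\<lambda>n. LBINT x. smooth_step (real n * P x) * (\<psi> x * f x)) \<longlonglongrightarrow>
        (LBINT x. indicator A x *\<^sub>R (\<psi> x * f x))"
    proof (rule integral_dominated_convergence)
      show "integrable lborel (\<lambda>x. norm (\<psi> x * f x))" using F by (rule integrable_norm)
      show "AE x in lborel. norm (smooth_step (real n * P x) * (\<psi> x * f x)) \<le> norm (\<psi> x * f x)" for n
      proof (rule AE_I2)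
        fix x show "norm (smooth_step (real n * P x) * (\<psi> x * f x)) \<le> norm (\<psi> x * f x)"
          using smooth_step_bounds[of "real n * P x"] mult_right_mono[of "smooth_step (real n * P x)" 1 "norm (\<psi> x * f x)"]
          unfolding norm_mult[of "smooth_step _"] by simp
      qed
      show "AE x in lborel. (\<lambda>n. smooth_step (real n * P x) * (\<psi> x * f x)) \<longlonglongrightarrow> indicator A x *\<^sub>R (\<psi> x * f x)"
      proof (rule AE_I2)
        fix x
        have "(\<lambda>n. smooth_step (real n * P x)) \<longlonglongrightarrow> indicator A x"
        proof (cases "0 < P x")
          case True
          have "\<forall>\<^sub>F n in sequentially. smooth_step (real n * P x) = 1"
          proof -
            obtain N :: nat where N: "1 / P x < real N" using reals_Archimedean2 by blast
            show ?thesis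
            proof (rule eventually_sequentiallyI[of N])
              fix n assume "N \<le> n"
              then have "1 / P x \<le> real n" using N by linarith
              then show "smooth_step (real n * P x) = 1" using True by (intro smooth_step_ge1) (simp add: field_simps)
            qed
          qed
          then show ?thesis using True by (simp add: P(4) tendsto_eventually)
        next
          case False
          then have "P x = 0" using P(3)[of x] by simp
          then show ?thesis by (simp add: P(4) smooth_step_nonpos)
        qed
        then show "(\<lambda>n. smooth_step (real n * P x) * (\<psi> x * f x)) \<longlonglongrightarrow> indicator A x *\<^sub>R (\<psi> x * f x)"
          by (simp add: tendsto_mult_right)
      qed
    qed measurable
    moreover have "(LBINT x. smooth_step (real n * P x) * (\<psi> x * f x)) = 0" for n
    proof -
      have g: "GDERIV (\<lambda>x. smooth_step (real n * P x)) x :> smooth_step' (real n * P x) *\<^sub>R (real n *\<^sub>R P' x)" for x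
      proof (rule GDERIV_DERIV_compose[OF _ DERIV_smooth_step])
        show "GDERIV (\<lambda>x. real n * P x) x :> real n *\<^sub>R P' x"
          using GDERIV_mult[OF GDERIV_const P(1)] by simp
      qed
      have cc: "continuous_on UNIV (\<lambda>x. smooth_step' (real n * P x) *\<^sub>R (real n *\<^sub>R P' x))"
        by (rule continuous_on_scaleR[OF continuous_on_smooth_step'[OF continuous_on_mult[OF continuous_on_const c]]
            continuous_on_scaleR[OF continuous_on_const P(2)]])
      show ?thesis using z[OF test_function_mult[OF t g cc]] by (simp add: mult_ac)
    qed
    ultimately show "(LBINT x. indicator A x *\<^sub>R (\<psi> x * f x)) = 0"
      by (simp add: LIMSEQ_const_iff)
  qed
  have "AE x in lborel. \<forall>n::nat. cutoff 0 (real (Suc n)) x * f x = 0"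
    unfolding AE_all_countable by (intro allI loc[OF test_function_cutoff]) simp
  then show ?thesis
  proof eventually_elim
    case (elim x)
    obtain N :: nat where "norm x < real N" using reals_Archimedean2 by blast
    then have "cutoff 0 (real (Suc N)) x = 1" by (intro cutoff_eq_1) auto
    then show ?case using elim[rule_format, of N] by simp
  qed
qed

lemma weak_gradientD:
  "weak_gradient u g \<Longrightarrow> test_function \<psi> \<psi>' \<Longrightarrow>
    (LBINT x. u x *\<^sub>R \<psi>' x) = - (LBINT x. \<psi> x *\<^sub>R g x)"
  unfolding weak_gradient_alt by blast

lemma weak_gradient_unique:
  assumes "weak_gradient u g" "weak_gradient u h"
  shows "AE x in lborel. g x = h x"
proof -
  have g: "locally_integrable g" and h: "locally_integrable h"
    using assms by (auto simp: weak_gradient_alt)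
  have "AE x in lborel. (g x - h x) \<bullet> i = 0" if "i \<in> Basis" for i
  proof (rule AE_zero_if_integral_test_function_zero)
    have sg: "integrable lborel (\<lambda>x. indicator K x *\<^sub>R g x)" "integrable lborel (\<lambda>x. indicator K x *\<^sub>R h x)"
      if "compact K" for K
      using g h that by (auto simp: locally_integrable_def set_integrable_def)
    have [measurable]: "g \<in> borel_measurable borel" "h \<in> borel_measurable borel"
      using g h by (auto simp: locally_integrable_def)
    show "locally_integrable (\<lambda>x. (g x - h x) \<bullet> i)"
      unfolding locally_integrable_def set_integrable_def
    proof (intro conjI allI impI)
      fix K :: "(real^3) set" assume "compact K"
      from integrable_inner_left[OF Bochner_Integration.integrable_diff[OF sg[OF this]], of i]
      show "integrable lborel (\<lambda>x. indicator K x *\<^sub>R ((g x - h x) \<bullet> i))"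
        by (simp add: inner_diff_left algebra_simps)
    qed measurable
    fix \<psi> \<psi>' assume t: "test_function \<psi> \<psi>'"
    note K = test_functionD[OF t]
    have ig: "integrable lborel (\<lambda>x. \<psi> x *\<^sub>R g x)" "integrable lborel (\<lambda>x. \<psi> x *\<^sub>R h x)"
      using locally_integrable_scaleR_integrable[OF g K(1,4,5)]
        locally_integrable_scaleR_integrable[OF h K(1,4,5)] by auto
    have eq: "(LBINT x. \<psi> x *\<^sub>R g x) = (LBINT x. \<psi> x *\<^sub>R h x)"
      using weak_gradientD[OF assms(1) t] weak_gradientD[OF assms(2) t] by simp
    have "(LBINT x. \<psi> x * ((g x - h x) \<bullet> i)) = (LBINT x. (\<psi> x *\<^sub>R g x) \<bullet> i - (\<psi> x *\<^sub>R h x) \<bullet> i)"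
      by (simp add: inner_diff_left algebra_simps)
    also have "\<dots> = (LBINT x. (\<psi> x *\<^sub>R g x) \<bullet> i) - (LBINT x. (\<psi> x *\<^sub>R h x) \<bullet> i)"
      by (rule Bochner_Integration.integral_diff; rule integrable_inner_left; rule ig)
    also have "\<dots> = (LBINT x. \<psi> x *\<^sub>R g x) \<bullet> i - (LBINT x. \<psi> x *\<^sub>R h x) \<bullet> i"
      using ig by (simp add: integral_inner_left del: inner_scaleR_left)
    finally show "(LBINT x. \<psi> x * ((g x - h x) \<bullet> i)) = 0" using eq by simp
  qed
  then have "AE x in lborel. \<forall>i\<in>Basis. (g x - h x) \<bullet> i = 0"
    by (intro AE_finite_allI) auto
  then show ?thesis
    by eventually_elim (metis eq_iff_diff_eq_0 euclidean_all_zero_iff)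
qed

section \<open>Square-integrable functions and the Sobolev space\<close>

text \<open>A crude form of Young's inequality; the constant does not matter for the estimates below.\<close>
lemma prod_le_sum_squares: "0 \<le> a \<Longrightarrow> 0 \<le> b \<Longrightarrow> a * b \<le> a\<^sup>2 + (b::real)\<^sup>2"
proof -
  assume "0 \<le> a" "0 \<le> b"
  then have "0 \<le> a * b" by simp
  moreover have "2 * (a * b) \<le> a\<^sup>2 + b\<^sup>2" using sum_squares_bound[of a b] by (simp add: mult.assoc)
  ultimately show ?thesis by linarith
qed

lemma square_integrable_measurable: "square_integrable f \<Longrightarrow> f \<in> borel_measurable borel"
  by (simp add: square_integrable_def)

lemma square_integrable_cong_AE:
  assumes "square_integrable f" "g \<in> borel_measurable borel" "AE x in lborel. f x = g x"
  shows "square_integrable g"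
proof -
  have [measurable]: "f \<in> borel_measurable borel" "g \<in> borel_measurable borel"
    using assms by (auto simp: square_integrable_def)
  have "integrable lborel (\<lambda>x. (norm (g x))\<^sup>2) \<longleftrightarrow> integrable lborel (\<lambda>x. (norm (f x))\<^sup>2)"
  proof (rule integrable_cong_AE)
    show "AE x in lborel. (norm (g x))\<^sup>2 = (norm (f x))\<^sup>2" using assms(3) by eventually_elim simp
  qed measurable
  then show ?thesis using assms by (simp add: square_integrable_def)
qed

lemma square_integrable_dominated:
  fixes f :: "'a::euclidean_space \<Rightarrow> 'b::euclidean_space" and g :: "'a \<Rightarrow> 'c::euclidean_space"
  assumes "square_integrable f" "g \<in> borel_measurable borel" "\<And>x. norm (g x) \<le> C * norm (f x)"
  shows "square_integrable g"
  unfolding square_integrable_def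
proof
  show [measurable]: "g \<in> borel_measurable borel" by fact
  have "integrable lborel (\<lambda>x. C\<^sup>2 * (norm (f x))\<^sup>2)"
    using assms by (intro integrable_mult_right) (simp add: square_integrable_def)
  then show "integrable lborel (\<lambda>x. (norm (g x))\<^sup>2)"
  proof (rule Bochner_Integration.integrable_bound)
    show "AE x in lborel. norm ((norm (g x))\<^sup>2) \<le> norm (C\<^sup>2 * (norm (f x))\<^sup>2)"
    proof (rule AE_I2)
      fix x
      have "(norm (g x))\<^sup>2 \<le> (C * norm (f x))\<^sup>2" by (rule power_mono[OF assms(3)]) simp
      then show "norm ((norm (g x))\<^sup>2) \<le> norm (C\<^sup>2 * (norm (f x))\<^sup>2)" by (simp add: power_mult_distrib)
    qed
  qed measurable
qed

lemma norm_add_sq_le: "(norm (a + b))\<^sup>2 \<le> 2 * (norm a)\<^sup>2 + 2 * (norm b)\<^sup>2"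
proof -
  have "(norm (a + b))\<^sup>2 \<le> (norm a + norm b)\<^sup>2" by (rule power_mono[OF norm_triangle_ineq]) simp
  also have "\<dots> \<le> 2 * (norm a)\<^sup>2 + 2 * (norm b)\<^sup>2"
    using zero_le_power2[of "norm a - norm b"] by (simp add: power2_sum power2_diff)
  finally show ?thesis .
qed

lemma square_integrable_add:
  assumes f: "square_integrable f" and g: "square_integrable g"
  shows "square_integrable (\<lambda>x. f x + g x)"
  unfolding square_integrable_def
proof
  note [measurable] = assms[THEN square_integrable_measurable]
  show "(\<lambda>x. f x + g x) \<in> borel_measurable borel" by measurable
  have "integrable lborel (\<lambda>x. 2 * (norm (f x))\<^sup>2 + 2 * (norm (g x))\<^sup>2)"
    using assms by (intro Bochner_Integration.integrable_add integrable_mult_right) (auto simp: square_integrable_def)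
  then show "integrable lborel (\<lambda>x. (norm (f x + g x))\<^sup>2)"
    by (rule Bochner_Integration.integrable_bound) (use norm_add_sq_le in \<open>auto intro!: AE_I2\<close>)
qed

lemma square_integrable_affine:
  fixes f :: "'a::euclidean_space \<Rightarrow> 'b::euclidean_space"
  assumes "square_integrable f" "c \<noteq> 0"
  shows "square_integrable (\<lambda>x. f (t + c *\<^sub>R x))"
proof -
  have [measurable]: "f \<in> borel_measurable borel" using assms by (auto simp: square_integrable_def)
  have "integrable lborel (\<lambda>x. (norm (f (t + c *\<^sub>R x)))\<^sup>2) = integrable lborel (\<lambda>x. (norm (f x))\<^sup>2)"
    by (rule lborel_integrable_affine_iff[OF assms(2), of "\<lambda>x. (norm (f x))\<^sup>2"]) measurable
  then show ?thesis
    using assms borel_measurable_affine[of f t c] by (simp add: square_integrable_def)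
qed

lemma square_integrable_translate:
  fixes f :: "'a::euclidean_space \<Rightarrow> 'b::euclidean_space"
  assumes "square_integrable f" shows "square_integrable (\<lambda>x. f (x + w))"
  using square_integrable_affine[OF assms, of 1 w] by (simp add: add.commute)

lemma square_integrable_prod:
  fixes f g :: "'a::euclidean_space \<Rightarrow> real"
  assumes "square_integrable f" "square_integrable g"
  shows "integrable lborel (\<lambda>x. f x * g x)"
proof -
  note [measurable] = assms[THEN square_integrable_measurable]
  have "integrable lborel (\<lambda>x. (norm (f x))\<^sup>2 + (norm (g x))\<^sup>2)"
    using assms by (intro Bochner_Integration.integrable_add) (auto simp: square_integrable_def)
  then show ?thesis
  proof (rule Bochner_Integration.integrable_bound)
    show "AE x in lborel. norm (f x * g x) \<le> norm ((norm (f x))\<^sup>2 + (norm (g x))\<^sup>2)"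
    proof (rule AE_I2)
      fix x show "norm (f x * g x) \<le> norm ((norm (f x))\<^sup>2 + (norm (g x))\<^sup>2)"
        using prod_le_sum_squares[of "\<bar>f x\<bar>" "\<bar>g x\<bar>"] by (simp add: abs_mult)
    qed
  qed measurable
qed

lemma square_integrable_norm: "square_integrable f \<Longrightarrow> square_integrable (\<lambda>x. norm (f x))"
  by (rule square_integrable_dominated[of f _ 1]) (auto simp: square_integrable_def)

lemma square_integrable_inner:
  fixes f g :: "'a::euclidean_space \<Rightarrow> 'b::euclidean_space"
  assumes "square_integrable f" "square_integrable g"
  shows "integrable lborel (\<lambda>x. f x \<bullet> g x)"
proof -
  note [measurable] = assms[THEN square_integrable_measurable]
  from square_integrable_prod[OF square_integrable_norm square_integrable_norm, OF assms]
  show ?thesis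
    by (rule Bochner_Integration.integrable_bound) (auto intro!: AE_I2 simp: Cauchy_Schwarz_ineq2)
qed

lemma continuous_compact_support_bounded:
  fixes f :: "'a::t2_space \<Rightarrow> 'b::real_normed_vector"
  assumes "compact K" "continuous_on UNIV f" "\<And>x. x \<notin> K \<Longrightarrow> f x = 0"
  shows "\<exists>C\<ge>0. \<forall>x. norm (f x) \<le> C"
proof -
  have "bounded (f ` K)"
    by (rule compact_imp_bounded[OF compact_continuous_image[OF continuous_on_subset[OF assms(2)] assms(1)]]) simp
  then obtain C where C: "\<And>x. x \<in> K \<Longrightarrow> norm (f x) \<le> C" unfolding bounded_iff by blast
  have "norm (f x) \<le> max C 0" for x using C[of x] assms(3)[of x] by (cases "x \<in> K") auto
  then show ?thesis by (intro exI[of _ "max C 0"]) auto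
qed

lemma integrable_continuous_compact_support:
  fixes f :: "'a::euclidean_space \<Rightarrow> real"
  assumes K: "compact K" and c: "continuous_on UNIV f" and z: "\<And>x. x \<notin> K \<Longrightarrow> f x = 0"
  shows "integrable lborel f"
proof -
  have "(\<lambda>x. indicator K x *\<^sub>R f x) = f" using z by (auto simp: indicator_def fun_eq_iff)
  then show ?thesis using borel_integrable_compact[OF K continuous_on_subset[OF c subset_UNIV]] by simp
qed

lemma square_integrable_continuous_compact_support:
  fixes f :: "'a::euclidean_space \<Rightarrow> 'b::euclidean_space"
  assumes K: "compact K" and c: "continuous_on UNIV f" and z: "\<And>x. x \<notin> K \<Longrightarrow> f x = 0"
  shows "square_integrable f"
  unfolding square_integrable_def
proof
  show "f \<in> borel_measurable borel" by (rule borel_measurable_continuous_onI[OF c])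
  have "continuous_on UNIV (\<lambda>x. (norm (f x))\<^sup>2)" by (intro continuous_intros c)
  then show "integrable lborel (\<lambda>x. (norm (f x))\<^sup>2)"
    by (rule integrable_continuous_compact_support[OF K]) (simp add: z)
qed

lemma H1I: "square_integrable u \<Longrightarrow> weak_gradient u g \<Longrightarrow> square_integrable g \<Longrightarrow> u \<in> H1"
  by (auto simp: H1_def square_integrable_def)

lemma H1_square_integrable: "u \<in> H1 \<Longrightarrow> square_integrable u"
  by (auto simp: H1_def square_integrable_def)

lemma weak_gradient_wgrad: "weak_gradient u g \<Longrightarrow> weak_gradient u (wgrad u)"
  unfolding wgrad_def by (rule someI[of "weak_gradient u"])

lemma wgrad_AE: "weak_gradient u g \<Longrightarrow> AE x in lborel. wgrad u x = g x"
  by (rule weak_gradient_unique[OF weak_gradient_wgrad])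

text \<open>Membership in \<open>H1\<close> provides some square-integrable weak gradient; by uniqueness the chosen one
  agrees with it almost everywhere.\<close>
lemma H1_wgrad:
  assumes "u \<in> H1" shows "weak_gradient u (wgrad u)" "square_integrable (wgrad u)"
proof -
  from assms obtain g where g: "weak_gradient u g" "integrable lborel (\<lambda>x. (norm (g x))\<^sup>2)"
    by (auto simp: H1_def)
  show w: "weak_gradient u (wgrad u)" by (rule weak_gradient_wgrad[OF g(1)])
  have "square_integrable g"
    using g by (auto simp: square_integrable_def weak_gradient_alt locally_integrable_def)
  then show "square_integrable (wgrad u)"
  proof (rule square_integrable_cong_AE)
    show "wgrad u \<in> borel_measurable borel"
      using w by (auto simp: weak_gradient_alt locally_integrable_def)
    show "AE x in lborel. g x = wgrad u x" using wgrad_AE[OF g(1)] by eventually_elim simp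
  qed
qed

lemma square_integrable_cmult:
  fixes f :: "'a::euclidean_space \<Rightarrow> 'b::euclidean_space"
  assumes "square_integrable f" shows "square_integrable (\<lambda>x. c *\<^sub>R f x)"
proof (rule square_integrable_dominated[OF assms, of _ "\<bar>c\<bar>"])
  have [measurable]: "f \<in> borel_measurable borel" using assms by (auto simp: square_integrable_def)
  show "(\<lambda>x. c *\<^sub>R f x) \<in> borel_measurable borel" by measurable
qed simp

lemma H1_add: "u \<in> H1 \<Longrightarrow> v \<in> H1 \<Longrightarrow> (\<lambda>x. u x + v x) \<in> H1"
  by (rule H1I[OF square_integrable_add weak_gradient_add square_integrable_add])
    (rule H1_square_integrable H1_wgrad; assumption)+

lemma weak_gradient_cmult:
  assumes "weak_gradient u g" shows "weak_gradient (\<lambda>x. c * u x) (\<lambda>x. c *\<^sub>R g x)"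
  using weak_gradient_mult[OF assms GDERIV_const continuous_on_const, of c] by simp

lemma H1_cmult: assumes "u \<in> H1" shows "(\<lambda>x. c * u x) \<in> H1"
  using H1I[OF _ weak_gradient_cmult square_integrable_cmult, OF _ H1_wgrad, OF _ assms assms, of c]
    square_integrable_cmult[OF H1_square_integrable[OF assms], of c] by simp

lemma H1_affine:
  assumes u: "u \<in> H1" and c: "c \<noteq> 0" shows "(\<lambda>x. u (t + c *\<^sub>R x)) \<in> H1"
  by (rule H1I[OF square_integrable_affine[OF H1_square_integrable[OF u] c]
        weak_gradient_affine[OF H1_wgrad(1)[OF u] c]
        square_integrable_cmult[OF square_integrable_affine[OF H1_wgrad(2)[OF u] c]]])

lemma H1_mult:
  assumes u: "u \<in> H1" and t: "test_function \<eta> \<eta>'"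
  shows "(\<lambda>x. \<eta> x * u x) \<in> H1"
proof -
  note K = test_functionD[OF t]
  have w: "weak_gradient (\<lambda>x. \<eta> x * u x) (\<lambda>x. u x *\<^sub>R \<eta>' x + \<eta> x *\<^sub>R wgrad u x)"
    by (rule weak_gradient_mult[OF H1_wgrad(1)[OF u] K(2,3)])
  obtain C where C: "\<And>x. norm (\<eta> x) \<le> C" using continuous_compact_support_bounded[OF K(1,4,5)] by blast
  obtain D where D: "\<And>x. norm (\<eta>' x) \<le> D" using continuous_compact_support_bounded[OF K(1,3,6)] by blast
  have [measurable]: "\<eta> \<in> borel_measurable borel" "\<eta>' \<in> borel_measurable borel"
    by (rule borel_measurable_continuous_onI[OF K(4)], rule borel_measurable_continuous_onI[OF K(3)])
  note s = H1_square_integrable[OF u] H1_wgrad(2)[OF u]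
  have [measurable]: "u \<in> borel_measurable borel" "wgrad u \<in> borel_measurable borel"
    using s by (auto simp: square_integrable_def)
  have 1: "square_integrable (\<lambda>x. \<eta> x * u x)"
    by (rule square_integrable_dominated[OF s(1), of _ C]) (use C in \<open>auto simp: abs_mult intro!: mult_right_mono\<close>)
  have 2: "square_integrable (\<lambda>x. \<eta> x *\<^sub>R wgrad u x)"
    by (rule square_integrable_dominated[OF s(2), of _ C]) (use C in \<open>auto intro!: mult_right_mono\<close>)
  have 3: "square_integrable (\<lambda>x. u x *\<^sub>R \<eta>' x)"
    by (rule square_integrable_dominated[OF s(1), of _ D])
      (use D in \<open>auto simp: mult.commute[of "\<bar>_\<bar>"] intro!: mult_right_mono\<close>)
  show "(\<lambda>x. \<eta> x * u x) \<in> H1"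
    by (rule H1I[OF 1 w square_integrable_add[OF 3 2]])
qed

section \<open>Difference quotients of Sobolev functions\<close>

text \<open>Jensen's inequality on the unit interval, from the nonnegative variance of \<open>h\<close>.\<close>
lemma integral_unit_interval_square_le:
  fixes h :: "real \<Rightarrow> real"
  assumes [measurable]: "h \<in> borel_measurable borel"
    and i2: "integrable lborel (\<lambda>s. indicator {0..1} s * (h s)\<^sup>2)"
  shows "(LBINT s. indicator {0..1} s * h s)\<^sup>2 \<le> (LBINT s. indicator {0..1} s * (h s)\<^sup>2)"
proof -
  have i0: "integrable lborel (\<lambda>s. indicator {0..1::real} s :: real)"
    by (rule integrable_real_indicator) auto
  have m0: "(LBINT s. indicator {0..1::real} s :: real) = 1" by simp
  have i1: "integrable lborel (\<lambda>s. indicator {0..1} s * h s)"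
  proof (rule Bochner_Integration.integrable_bound[OF Bochner_Integration.integrable_add[OF i0 i2]])
    show "AE s in lborel. norm (indicator {0..1} s * h s) \<le> norm (indicator {0..1} s + indicator {0..1} s * (h s)\<^sup>2)"
    proof (rule AE_I2)
      fix s show "norm (indicator {0..1} s * h s) \<le> norm (indicator {0..1} s + indicator {0..1} s * (h s)\<^sup>2)"
        using sum_squares_bound[of 1 "\<bar>h s\<bar>"] by (auto simp: indicator_def)
    qed
  qed measurable
  define m where "m = (LBINT s. indicator {0..1} s * h s)"
  have "0 \<le> (LBINT s. indicator {0..1} s * (h s)\<^sup>2 + m\<^sup>2 * indicator {0..1} s - (2 * m) * (indicator {0..1} s * h s))"
  proof (rule Bochner_Integration.integral_nonneg)
    fix s show "0 \<le> indicator {0..1} s * (h s)\<^sup>2 + m\<^sup>2 * indicator {0..1} s - (2 * m) * (indicator {0..1} s * h s)"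
      using zero_le_power2[of "h s - m"] by (auto simp: indicator_def power2_diff mult_ac)
  qed
  also have "\<dots> = (LBINT s. indicator {0..1} s * (h s)\<^sup>2) + m\<^sup>2 * 1 - (2 * m) * m"
    using i0 i1 i2 m0 by (simp add: m_def)
  finally show ?thesis by (simp add: m_def power2_eq_square)
qed

text \<open>This and the next lemma justify the applications of Fubini's theorem: the norm of a translate does not
  depend on the shift \<open>s\<close>, so integrating over \<open>s \<in> {0..1}\<close> costs nothing.\<close>
lemma integrable_pair_shift:
  fixes f :: "real^3 \<Rightarrow> real"
  assumes f: "integrable lborel f"
  shows "integrable (lborel \<Otimes>\<^sub>M lborel) (\<lambda>(x, s::real). indicator {0..1} s * f (x + s *\<^sub>R v))"
    (is "integrable _ ?F")
proof (rule integrableI_bounded)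
  have [measurable]: "f \<in> borel_measurable borel" using f by simp
  show "?F \<in> borel_measurable (lborel \<Otimes>\<^sub>M lborel)" by measurable
  define M where "M = (LBINT x. \<bar>f x\<bar>)"
  have "(\<integral>\<^sup>+z. norm (?F z) \<partial>(lborel \<Otimes>\<^sub>M lborel)) = (\<integral>\<^sup>+s. \<integral>\<^sup>+x. norm (?F (x, s)) \<partial>lborel \<partial>lborel)"
    by (rule lborel_pair.nn_integral_snd[symmetric]) measurable
  also have "\<dots> \<le> (\<integral>\<^sup>+s. ennreal M * indicator {0..1::real} s \<partial>lborel)"
  proof (rule nn_integral_mono)
    fix s :: real
    have i: "integrable lborel (\<lambda>x. \<bar>f (x + s *\<^sub>R v)\<bar>)"
      using lborel_integrable_translate_iff[of f "s *\<^sub>R v"] f by simp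
    have "(\<integral>\<^sup>+x. norm (?F (x, s)) \<partial>lborel) = (\<integral>\<^sup>+x. ennreal \<bar>f (x + s *\<^sub>R v)\<bar> * indicator {0..1} s \<partial>lborel)"
      by (intro nn_integral_cong) (auto simp: indicator_def)
    also have "\<dots> = (\<integral>\<^sup>+x. ennreal \<bar>f (x + s *\<^sub>R v)\<bar> \<partial>lborel) * indicator {0..1} s"
      by (rule nn_integral_multc) measurable
    also have "(\<integral>\<^sup>+x. ennreal \<bar>f (x + s *\<^sub>R v)\<bar> \<partial>lborel) = ennreal M"
      using nn_integral_eq_integral[OF i] lborel_integral_translate[of "\<lambda>x. \<bar>f x\<bar>" "s *\<^sub>R v"] by (simp add: M_def)
    finally show "(\<integral>\<^sup>+x. norm (?F (x, s)) \<partial>lborel) \<le> ennreal M * indicator {0..1} s" by simp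
  qed
  also have "\<dots> < \<infinity>" by (simp add: nn_integral_cmult ennreal_mult_less_top)
  finally show "(\<integral>\<^sup>+z. norm (?F z) \<partial>(lborel \<Otimes>\<^sub>M lborel)) < \<infinity>" .
qed

lemma integrable_pair_translate:
  fixes f :: "real^3 \<Rightarrow> real" and g :: "real^3 \<Rightarrow> real^3"
  assumes f: "square_integrable f" and g: "square_integrable g"
  shows "integrable (lborel \<Otimes>\<^sub>M lborel)
    (\<lambda>(x, s::real). indicator {0..1} s * (f x * (g (x + s *\<^sub>R v) \<bullet> w)))" (is "integrable _ ?F")
proof -
  note [measurable] = assms[THEN square_integrable_measurable]
  have i: "integrable lborel (\<lambda>x. (f x)\<^sup>2)" "integrable lborel (\<lambda>x. (norm (g x))\<^sup>2)"
    using f g by (auto simp: square_integrable_def)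
  have "integrable (lborel \<Otimes>\<^sub>M lborel) (\<lambda>z. norm w * ((\<lambda>(x, s::real). indicator {0..1} s * (f (x + s *\<^sub>R 0))\<^sup>2) z
      + (\<lambda>(x, s::real). indicator {0..1} s * (norm (g (x + s *\<^sub>R v)))\<^sup>2) z))"
    by (intro integrable_mult_right Bochner_Integration.integrable_add integrable_pair_shift i)
  then show ?thesis
  proof (rule Bochner_Integration.integrable_bound)
    show "?F \<in> borel_measurable (lborel \<Otimes>\<^sub>M lborel)" by measurable
    have "\<bar>f x * (g y \<bullet> w)\<bar> \<le> norm w * ((f x)\<^sup>2 + (norm (g y))\<^sup>2)" for x y
    proof -
      have "\<bar>f x * (g y \<bullet> w)\<bar> \<le> \<bar>f x\<bar> * (norm (g y) * norm w)"
        unfolding abs_mult by (rule mult_left_mono[OF Cauchy_Schwarz_ineq2]) simp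
      also have "\<dots> = norm w * (\<bar>f x\<bar> * norm (g y))" by simp
      also have "\<dots> \<le> norm w * ((f x)\<^sup>2 + (norm (g y))\<^sup>2)"
        using prod_le_sum_squares[of "\<bar>f x\<bar>" "norm (g y)"] by (intro mult_left_mono) auto
      finally show ?thesis .
    qed
    then show "AE z in lborel \<Otimes>\<^sub>M lborel. norm (?F z) \<le> norm (norm w *
        ((\<lambda>(x, s::real). indicator {0..1} s * (f (x + s *\<^sub>R 0))\<^sup>2) z
          + (\<lambda>(x, s::real). indicator {0..1} s * (norm (g (x + s *\<^sub>R v)))\<^sup>2) z))"
      by (intro AE_I2) (auto simp: indicator_def split_beta)
  qed
qed

lemma integrable_pair_translate_fst:
  fixes f :: "real^3 \<Rightarrow> real" and g :: "real^3 \<Rightarrow> real^3"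
  assumes f: "square_integrable f" and g: "square_integrable g"
  shows "integrable lborel (\<lambda>x. LBINT s. indicator {0..1::real} s * (f x * (g (x + s *\<^sub>R v) \<bullet> w)))"
    and "(LBINT x. LBINT s. indicator {0..1::real} s * (f x * (g (x + s *\<^sub>R v) \<bullet> w)))
      = (LBINT s. indicator {0..1::real} s * (LBINT x. f x * (g (x + s *\<^sub>R v) \<bullet> w)))"
proof -
  note I = integrable_pair_translate[OF f g, of v w]
  show "integrable lborel (\<lambda>x. LBINT s. indicator {0..1::real} s * (f x * (g (x + s *\<^sub>R v) \<bullet> w)))"
    using lborel_pair.integrable_fst[OF I] by simp
  show "(LBINT x. LBINT s. indicator {0..1::real} s * (f x * (g (x + s *\<^sub>R v) \<bullet> w)))
      = (LBINT s. indicator {0..1::real} s * (LBINT x. f x * (g (x + s *\<^sub>R v) \<bullet> w)))"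
    using lborel_pair.Fubini_integral[OF I] by simp
qed

lemma test_function_difference:
  assumes t: "test_function \<psi> \<psi>'"
  shows "(LBINT s. indicator {0..1::real} s * (\<psi>' (y + s *\<^sub>R v) \<bullet> v)) = \<psi> (y + v) - \<psi> y"
proof -
  note K = test_functionD[OF t]
  have d: "((\<lambda>s. \<psi> (y + s *\<^sub>R v)) has_vector_derivative \<psi>' (y + s *\<^sub>R v) \<bullet> v) (at s within {0..1})" for s
  proof -
    have 1: "((\<lambda>s. y + s *\<^sub>R v) has_derivative (\<lambda>h. h *\<^sub>R v)) (at s)"
      using has_derivative_add[OF has_derivative_const has_derivative_scaleR_left[OF has_derivative_ident]] by simp
    have "((\<lambda>s. \<psi> (y + s *\<^sub>R v)) has_derivative (\<lambda>h. (h *\<^sub>R v) \<bullet> \<psi>' (y + s *\<^sub>R v))) (at s)"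
      by (rule has_derivative_compose[OF 1 K(2)[unfolded gderiv_def]])
    from has_derivative_at_withinI[OF this] show ?thesis
      by (simp add: has_vector_derivative_def inner_commute[of v])
  qed
  have c: "continuous_on {0..1} (\<lambda>s. \<psi>' (y + s *\<^sub>R v) \<bullet> v)"
    by (intro continuous_intros continuous_on_compose2[OF K(3)]) auto
  have "(LINT s:{0..1::real}|lborel. \<psi>' (y + s *\<^sub>R v) \<bullet> v) = \<psi> (y + 1 *\<^sub>R v) - \<psi> (y + 0 *\<^sub>R v)"
    unfolding set_lebesgue_integral_def
    by (rule integral_FTC_Icc[OF _ d c]) simp
  then show ?thesis by (simp add: set_lebesgue_integral_def)
qed

text \<open>The fundamental theorem of calculus along segments, in weak form.  Paired with a test function
  \<open>\<psi>\<close>, the right-hand side becomes by Fubini an average over \<open>s\<close> of integrals of \<open>\<psi>\<close> against translated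
  weak gradients; the definition of the weak gradient moves the derivative to the translates of \<open>\<psi>\<close>, and
  there the classical fundamental theorem applies.  The fundamental lemma removes \<open>\<psi>\<close>.\<close>
lemma weak_gradient_difference:
  assumes w: "weak_gradient u g" and u: "square_integrable u" and g: "square_integrable g"
  shows "AE x in lborel. u (x + v) - u x = (LBINT s. indicator {0..1::real} s * (g (x + s *\<^sub>R v) \<bullet> v))"
proof -
  let ?G = "\<lambda>x. LBINT s. indicator {0..1::real} s * (g (x + s *\<^sub>R v) \<bullet> v)"
  have [measurable]: "u \<in> borel_measurable borel" "g \<in> borel_measurable borel"
    using u g by (auto simp: square_integrable_def)
  have uv: "square_integrable (\<lambda>x. u (x + v))"
    using square_integrable_affine[OF u, of 1 v] by (simp add: add.commute)
  have lu: "locally_integrable u" "locally_integrable (\<lambda>x. u (x + v))"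
    by (rule square_integrable_imp_locally_integrable[OF u], rule square_integrable_imp_locally_integrable[OF uv])
  have [measurable]: "?G \<in> borel_measurable borel"
    using lborel.borel_measurable_lebesgue_integral[of "\<lambda>x s. indicator {0..1::real} s * (g (x + s *\<^sub>R v) \<bullet> v)" lborel]
    by simp
  have GK: "integrable lborel (\<lambda>x. f x * ?G x)" if "square_integrable f" for f
    using integrable_pair_translate_fst(1)[OF that g, of v v] by (simp add: mult.left_commute[of _ "f _"])
  have sK: "square_integrable (indicator K :: real^3 \<Rightarrow> real)" if "compact K" for K
  proof -
    have "(\<lambda>x. (norm (indicator K x :: real))\<^sup>2) = (\<lambda>x. 1 * indicator K x)" by (auto simp: indicator_def)
    then show ?thesis
      using integrable_const_indicator_compact[OF that, of 1] borel_compact[OF that]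
      by (simp add: square_integrable_def)
  qed
  have lG: "locally_integrable ?G"
    unfolding locally_integrable_def set_integrable_def using GK[OF sK] by simp
  have "AE x in lborel. (u (x + v) - u x) - ?G x = 0"
  proof (rule AE_zero_if_integral_test_function_zero)
    show "locally_integrable (\<lambda>x. (u (x + v) - u x) - ?G x)"
      unfolding locally_integrable_def set_integrable_def
    proof (intro conjI allI impI)
      fix K :: "(real^3) set" assume K: "compact K"
      show "integrable lborel (\<lambda>x. indicator K x *\<^sub>R ((u (x + v) - u x) - ?G x))"
        unfolding scaleR_diff_right
        using lu lG K unfolding locally_integrable_def set_integrable_def
        by (intro Bochner_Integration.integrable_diff) blast+
    qed measurable
    fix \<psi> \<psi>' assume t: "test_function \<psi> \<psi>'"
    note K = test_functionD[OF t]
    have s1: "square_integrable \<psi>"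
      by (rule square_integrable_continuous_compact_support[OF K(1,4)]) (rule K(5))
    have s2: "square_integrable \<psi>'"
      by (rule square_integrable_continuous_compact_support[OF K(1,3)]) (rule K(6))
    note s\<psi> = s1 s2
    have s\<psi>v: "square_integrable (\<lambda>x. \<psi> (x - v))"
      using square_integrable_affine[OF s\<psi>(1), of 1 "- v"] by (simp add: add.commute)
    have [measurable]: "\<psi> \<in> borel_measurable borel" "\<psi>' \<in> borel_measurable borel"
      using s\<psi> by (auto simp: square_integrable_def)
    have transfer: "(LBINT x. \<psi> x * (g (x + s *\<^sub>R v) \<bullet> v)) = (LBINT y. u y * (\<psi>' (y + s *\<^sub>R (- v)) \<bullet> (- v)))" for s
    proof -
      have "weak_gradient (\<lambda>x. u (s *\<^sub>R v + 1 *\<^sub>R x)) (\<lambda>x. 1 *\<^sub>R g (s *\<^sub>R v + 1 *\<^sub>R x))"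
        by (rule weak_gradient_affine[OF w]) simp
      then have "weak_gradient (\<lambda>x. u (x + s *\<^sub>R v)) (\<lambda>x. g (x + s *\<^sub>R v))" by (simp add: add.commute)
      from weak_gradientD[OF this t]
      have e: "(LBINT x. \<psi> x *\<^sub>R g (x + s *\<^sub>R v)) = - (LBINT x. u (x + s *\<^sub>R v) *\<^sub>R \<psi>' x)" by simp
      have gs: "square_integrable (\<lambda>x. g (x + s *\<^sub>R v))"
        using square_integrable_affine[OF g, of 1 "s *\<^sub>R v"] by (simp add: add.commute)
      have us: "square_integrable (\<lambda>x. u (x + s *\<^sub>R v))"
        using square_integrable_affine[OF u, of 1 "s *\<^sub>R v"] by (simp add: add.commute)
      have i1: "integrable lborel (\<lambda>x. \<psi> x *\<^sub>R g (x + s *\<^sub>R v))"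
        by (rule locally_integrable_scaleR_integrable[OF square_integrable_imp_locally_integrable[OF gs] K(1,4,5)])
      have i2: "integrable lborel (\<lambda>x. u (x + s *\<^sub>R v) *\<^sub>R \<psi>' x)"
        by (rule locally_integrable_scaleR_integrable'[OF square_integrable_imp_locally_integrable[OF us] K(1,3,6)])
      have "(LBINT x. \<psi> x * (g (x + s *\<^sub>R v) \<bullet> v)) = (LBINT x. (\<psi> x *\<^sub>R g (x + s *\<^sub>R v)) \<bullet> v)"
        by simp
      also have "\<dots> = (LBINT x. \<psi> x *\<^sub>R g (x + s *\<^sub>R v)) \<bullet> v"
        by (rule integral_inner_left) (rule i1)
      also have "\<dots> = - ((LBINT x. u (x + s *\<^sub>R v) *\<^sub>R \<psi>' x) \<bullet> v)"
        unfolding e by simp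
      also have "(LBINT x. u (x + s *\<^sub>R v) *\<^sub>R \<psi>' x) \<bullet> v = (LBINT x. (u (x + s *\<^sub>R v) *\<^sub>R \<psi>' x) \<bullet> v)"
        by (rule integral_inner_left[symmetric]) (rule i2)
      also have "- \<dots> = (LBINT x. u (x + s *\<^sub>R v) * (\<psi>' x \<bullet> (- v)))" by simp
      also have "\<dots> = (LBINT y. u y * (\<psi>' (y + s *\<^sub>R (- v)) \<bullet> (- v)))"
        using lborel_integral_affine[of 1 "\<lambda>y. u y * (\<psi>' (y + s *\<^sub>R (- v)) \<bullet> (- v))" "s *\<^sub>R v"]
        by (simp add: add.commute)
      finally show ?thesis .
    qed
    have "(LBINT x. \<psi> x * ?G x) = (LBINT x. LBINT s. indicator {0..1::real} s * (\<psi> x * (g (x + s *\<^sub>R v) \<bullet> v)))"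
      by (simp add: mult.left_commute[of _ "\<psi> _"])
    also have "\<dots> = (LBINT s. indicator {0..1::real} s * (LBINT x. \<psi> x * (g (x + s *\<^sub>R v) \<bullet> v)))"
      by (rule integrable_pair_translate_fst(2)[OF s\<psi>(1) g])
    also have "\<dots> = (LBINT s. indicator {0..1::real} s * (LBINT y. u y * (\<psi>' (y + s *\<^sub>R (- v)) \<bullet> (- v))))"
      unfolding transfer ..
    also have "\<dots> = (LBINT x. LBINT s. indicator {0..1::real} s * (u x * (\<psi>' (x + s *\<^sub>R (- v)) \<bullet> (- v))))"
      by (rule integrable_pair_translate_fst(2)[OF u s\<psi>(2), symmetric])
    also have "\<dots> = (LBINT x. u x * (LBINT s. indicator {0..1::real} s * (\<psi>' (x + s *\<^sub>R (- v)) \<bullet> (- v))))"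
      by (simp add: mult.left_commute[of _ "u _"] del: scaleR_minus_right inner_minus_right)
    also have "\<dots> = (LBINT x. u x * \<psi> (x - v) - u x * \<psi> x)"
      unfolding test_function_difference[OF t] by (simp add: algebra_simps)
    also have "\<dots> = (LBINT x. u x * \<psi> (x - v)) - (LBINT x. u x * \<psi> x)"
      by (rule Bochner_Integration.integral_diff[OF square_integrable_prod[OF u s\<psi>v] square_integrable_prod[OF u s\<psi>(1)]])
    also have "(LBINT x. u x * \<psi> (x - v)) = (LBINT x. u (x + v) * \<psi> x)"
      using lborel_integral_affine[of 1 "\<lambda>x. u x * \<psi> (x - v)" v] by (simp add: add.commute)
    finally have 1: "(LBINT x. \<psi> x * ?G x) = (LBINT x. u (x + v) * \<psi> x) - (LBINT x. u x * \<psi> x)" .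
    have "(LBINT x. \<psi> x * ((u (x + v) - u x) - ?G x))
        = (LBINT x. (u (x + v) * \<psi> x - u x * \<psi> x) - \<psi> x * ?G x)"
      by (simp add: algebra_simps)
    also have "\<dots> = ((LBINT x. u (x + v) * \<psi> x) - (LBINT x. u x * \<psi> x)) - (LBINT x. \<psi> x * ?G x)"
      using square_integrable_prod[OF u s\<psi>(1)] square_integrable_prod[OF uv s\<psi>(1)] GK[OF s\<psi>(1)]
      by simp
    finally show "(LBINT x. \<psi> x * ((u (x + v) - u x) - ?G x)) = 0" using 1 by simp
  qed
  then show ?thesis by eventually_elim simp
qed

text \<open>The \<open>L\<^sup>2\<close> norm of a difference on \<open>A\<close> is controlled by the gradient on any set \<open>B\<close> that contains
  the segments from \<open>A\<close>: square the previous identity, apply Jensen's inequality, and integrate.\<close>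
lemma weak_gradient_difference_square_integral_le:
  assumes w: "weak_gradient u g" and u: "square_integrable u" and g: "square_integrable g"
    and A: "A \<in> sets borel" and B: "B \<in> sets borel"
    and AB: "\<And>x s. x \<in> A \<Longrightarrow> 0 \<le> s \<Longrightarrow> s \<le> 1 \<Longrightarrow> x + s *\<^sub>R v \<in> B"
  shows "(LBINT x. indicator A x * (u (x + v) - u x)\<^sup>2)
    \<le> (norm v)\<^sup>2 * (LBINT x. indicator B x * (norm (g x))\<^sup>2)"
proof -
  let ?G = "\<lambda>x. LBINT s. indicator {0..1::real} s * (g (x + s *\<^sub>R v) \<bullet> v)"
  define H where "H = (\<lambda>(x, s). indicator {0..1::real} s * (indicator B (x + s *\<^sub>R v) * (norm (g (x + s *\<^sub>R v)))\<^sup>2))"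
  \<comment> \<open>\<open>F\<close> averages the squared gradient, restricted to \<open>B\<close>, along the segment from \<open>x\<close> to \<open>x + v\<close>.\<close>
  define F where "F x = (LBINT s. H (x, s))" for x
  have [measurable]: "u \<in> borel_measurable borel" "g \<in> borel_measurable borel" "A \<in> sets borel" "B \<in> sets borel"
    using u g A B by (auto simp: square_integrable_def)
  have [measurable]: "H \<in> borel_measurable (lborel \<Otimes>\<^sub>M lborel)"
    unfolding H_def by measurable
  have igB: "integrable lborel (\<lambda>x. indicator B x * (norm (g x))\<^sup>2)"
    using integrable_mult_indicator[of B lborel "\<lambda>x. (norm (g x))\<^sup>2"] g by (simp add: square_integrable_def)
  define I where "I = (LBINT x. indicator B x * (norm (g x))\<^sup>2)"
  have I0: "0 \<le> I" unfolding I_def by (rule Bochner_Integration.integral_nonneg) simp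
  have tr: "integrable lborel (\<lambda>x. indicator B (x + s *\<^sub>R v) * (norm (g (x + s *\<^sub>R v)))\<^sup>2)"
    "(LBINT x. indicator B (x + s *\<^sub>R v) * (norm (g (x + s *\<^sub>R v)))\<^sup>2) = I" for s
    using lborel_integrable_affine_iff[of 1 "\<lambda>x. indicator B x * (norm (g x))\<^sup>2" "s *\<^sub>R v"]
      lborel_integral_affine[of 1 "\<lambda>x. indicator B x * (norm (g x))\<^sup>2" "s *\<^sub>R v"] igB
    by (simp_all add: add.commute I_def)
  have H0: "0 \<le> H z" for z by (simp add: H_def split_beta)
  have int: "integrable (lborel \<Otimes>\<^sub>M lborel) H"
    unfolding H_def by (rule integrable_pair_shift[OF igB])
  have int': "integrable (lborel \<Otimes>\<^sub>M lborel) (\<lambda>(x, s). H (x, s))" using int by simp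
  have iF: "integrable lborel F" unfolding F_def using lborel_pair.integrable_fst[OF int'] by simp
  have "(LBINT x. F x) = (LBINT s. LBINT x. H (x, s))"
    unfolding F_def by (rule lborel_pair.Fubini_integral[OF int', symmetric])
  also have "\<dots> = (LBINT s. indicator {0..1::real} s * I)"
    unfolding H_def split_conv by (simp add: tr)
  also have "\<dots> = I" by simp
  finally have FI: "(LBINT x. F x) = I" .
  have F0: "0 \<le> F x" for x unfolding F_def by (rule Bochner_Integration.integral_nonneg) (rule H0)
  have ae: "AE x in lborel. integrable lborel (\<lambda>s. H (x, s))"
    using lborel_pair.AE_integrable_fst[OF int'] by simp
  have main: "AE x in lborel. indicator A x * (u (x + v) - u x)\<^sup>2 \<le> (norm v)\<^sup>2 * F x"
    using ae weak_gradient_difference[OF w u g, of v]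
  proof eventually_elim
    case (elim x)
    show ?case
    proof (cases "x \<in> A")
      case False then show ?thesis using F0 by simp
    next
      case True
      have Hx: "H (x, s) = indicator {0..1} s * (norm (g (x + s *\<^sub>R v)))\<^sup>2" for s
        using AB[OF True, of s] by (auto simp: H_def indicator_def)
      have le: "indicator {0..1} s * (g (x + s *\<^sub>R v) \<bullet> v)\<^sup>2 \<le> (norm v)\<^sup>2 * H (x, s)" for s
      proof -
        have "\<bar>g (x + s *\<^sub>R v) \<bullet> v\<bar>\<^sup>2 \<le> (norm (g (x + s *\<^sub>R v)) * norm v)\<^sup>2"
          by (rule power_mono[OF Cauchy_Schwarz_ineq2]) simp
        then show ?thesis unfolding Hx by (auto simp: indicator_def power_mult_distrib mult.commute)
      qed
      have iR: "integrable lborel (\<lambda>s. (norm v)\<^sup>2 * H (x, s))" using elim(1) by (rule integrable_mult_right)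
      have i2: "integrable lborel (\<lambda>s. indicator {0..1} s * (g (x + s *\<^sub>R v) \<bullet> v)\<^sup>2)"
      proof (rule Bochner_Integration.integrable_bound[OF iR])
        show "AE s in lborel. norm (indicator {0..1} s * (g (x + s *\<^sub>R v) \<bullet> v)\<^sup>2) \<le> norm ((norm v)\<^sup>2 * H (x, s))"
          using le H0 by (intro AE_I2) simp
      qed measurable
      have "(u (x + v) - u x)\<^sup>2 = (LBINT s. indicator {0..1} s * (g (x + s *\<^sub>R v) \<bullet> v))\<^sup>2"
        using elim(2) by simp
      also have "\<dots> \<le> (LBINT s. indicator {0..1} s * (g (x + s *\<^sub>R v) \<bullet> v)\<^sup>2)"
        by (rule integral_unit_interval_square_le[OF _ i2]) measurable
      also have "\<dots> \<le> (LBINT s. (norm v)\<^sup>2 * H (x, s))"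
        by (rule integral_mono[OF i2 iR le])
      also have "\<dots> = (norm v)\<^sup>2 * F x" by (simp add: F_def)
      finally show ?thesis using True by simp
    qed
  qed
  have iR: "integrable lborel (\<lambda>x. (norm v)\<^sup>2 * F x)" using iF by (rule integrable_mult_right)
  have iL: "integrable lborel (\<lambda>x. indicator A x * (u (x + v) - u x)\<^sup>2)"
  proof (rule Bochner_Integration.integrable_bound[OF iR])
    show "AE x in lborel. norm (indicator A x * (u (x + v) - u x)\<^sup>2) \<le> norm ((norm v)\<^sup>2 * F x)"
      using main by eventually_elim (use F0 in simp)
  qed measurable
  have "(LBINT x. indicator A x * (u (x + v) - u x)\<^sup>2) \<le> (LBINT x. (norm v)\<^sup>2 * F x)"
    by (rule integral_mono_AE[OF iL iR main])
  also have "\<dots> = (norm v)\<^sup>2 * I" by (simp add: FI)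
  finally show ?thesis by (simp add: I_def)
qed

section \<open>Translation of quadratic terms\<close>

lemma square_integrable_symmetric_difference:
  fixes f :: "'a::euclidean_space \<Rightarrow> 'b::euclidean_space"
  assumes "square_integrable f" shows "square_integrable (\<lambda>x. f (x + w) - f (x - w))"
  using square_integrable_add[OF square_integrable_translate[OF assms, of w]
    square_integrable_cmult[OF square_integrable_translate[OF assms, of "- w"], of "-1"]] by simp

lemma square_integrable_bounded_mult:
  fixes g :: "'a::euclidean_space \<Rightarrow> 'b::euclidean_space"
  assumes g: "square_integrable g" and [measurable]: "\<kappa> \<in> borel_measurable borel"
    and b: "\<And>x. \<bar>\<kappa> x\<bar> \<le> K"
  shows "square_integrable (\<lambda>x. \<kappa> x *\<^sub>R g x)"
proof (rule square_integrable_dominated[OF g, of _ K])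
  note [measurable] = square_integrable_measurable[OF g]
  show "(\<lambda>x. \<kappa> x *\<^sub>R g x) \<in> borel_measurable borel" by measurable
  show "norm (\<kappa> x *\<^sub>R g x) \<le> K * norm (g x)" for x using mult_right_mono[OF b[of x], of "norm (g x)"] by simp
qed

text \<open>Discrete integration by parts: after the substitution \<open>x \<mapsto> x + w\<close> in the part with \<open>g (x - w)\<close>, both parts
  contain the same product \<open>g x \<bullet> g (x + w)\<close>.  This symmetry, absent for one-sided differences, is
  what dispenses with second derivatives.\<close>
lemma integral_symmetric_difference:
  fixes g :: "'a::euclidean_space \<Rightarrow> 'b::euclidean_space"
  assumes g: "square_integrable g" and km[measurable]: "\<kappa> \<in> borel_measurable borel"
    and b: "\<And>x. \<bar>\<kappa> x\<bar> \<le> K"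
  shows "(LBINT x. \<kappa> x * (g x \<bullet> (g (x + w) - g (x - w))))
      = - (LBINT x. (\<kappa> (x + w) - \<kappa> x) * (g x \<bullet> g (x + w)))"
proof -
  note [measurable] = square_integrable_measurable[OF g]
  have kw[measurable]: "(\<lambda>x. \<kappa> (x + w)) \<in> borel_measurable borel" by measurable
  note gw = square_integrable_translate[OF g, of w] 
  have gw': "square_integrable (\<lambda>x. g (x - w))" using square_integrable_translate[OF g, of "- w"] by simp
  have i1: "integrable lborel (\<lambda>x. \<kappa> x * (g x \<bullet> g (x + w)))"
    using square_integrable_inner[OF square_integrable_bounded_mult[OF g km b] gw] by simp
  have i2: "integrable lborel (\<lambda>x. \<kappa> x * (g x \<bullet> g (x - w)))"
    using square_integrable_inner[OF square_integrable_bounded_mult[OF g km b] gw'] by simp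
  have i3: "integrable lborel (\<lambda>x. \<kappa> (x + w) * (g x \<bullet> g (x + w)))"
    using square_integrable_inner[OF square_integrable_bounded_mult[OF g kw b] gw] by simp
  have "(LBINT x. \<kappa> x * (g x \<bullet> (g (x + w) - g (x - w))))
      = (LBINT x. \<kappa> x * (g x \<bullet> g (x + w))) - (LBINT x. \<kappa> x * (g x \<bullet> g (x - w)))"
    unfolding inner_diff_right right_diff_distrib by (rule Bochner_Integration.integral_diff[OF i1 i2])
  also have "(LBINT x. \<kappa> x * (g x \<bullet> g (x - w))) = (LBINT x. \<kappa> (x + w) * (g x \<bullet> g (x + w)))"
    using lborel_integral_translate[of "\<lambda>x. \<kappa> x * (g x \<bullet> g (x - w))" w] by (simp add: inner_commute)
  also have "(LBINT x. \<kappa> x * (g x \<bullet> g (x + w))) - (LBINT x. \<kappa> (x + w) * (g x \<bullet> g (x + w)))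
      = - (LBINT x. (\<kappa> (x + w) - \<kappa> x) * (g x \<bullet> g (x + w)))"
    unfolding left_diff_distrib Bochner_Integration.integral_diff[OF i3 i1] by simp
  finally show ?thesis .
qed

lemma integrable_indicator_sq:
  assumes "square_integrable g" "S \<in> sets borel"
  shows "integrable lborel (\<lambda>x. indicator S x * (norm (g x))\<^sup>2)"
  using integrable_mult_indicator[of S lborel "\<lambda>x. (norm (g x))\<^sup>2"] assms by (simp add: square_integrable_def)

lemma integral_shifted_product_bound:
  fixes g :: "'a::euclidean_space \<Rightarrow> 'b::euclidean_space"
  assumes g: "square_integrable g" and km[measurable]: "\<kappa> \<in> borel_measurable borel"
    and S[measurable]: "S \<in> sets borel" and K: "0 \<le> K"
    and b: "\<And>x. \<bar>\<kappa> x\<bar> \<le> K * (indicator S x * indicator S (x + w))"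
  shows "\<bar>LBINT x. \<kappa> x * (g x \<bullet> g (x + w))\<bar> \<le> 2 * K * (LBINT x. indicator S x * (norm (g x))\<^sup>2)"
proof -
  note [measurable] = square_integrable_measurable[OF g]
  note i = integrable_indicator_sq[OF g S]
  have i': "integrable lborel (\<lambda>x. indicator S (x + w) * (norm (g (x + w)))\<^sup>2)"
    using lborel_integrable_translate_iff[of "\<lambda>x. indicator S x * (norm (g x))\<^sup>2" w] i by simp
  have iR: "integrable lborel (\<lambda>x. K * (indicator S x * (norm (g x))\<^sup>2 + indicator S (x + w) * (norm (g (x + w)))\<^sup>2))"
    by (intro integrable_mult_right Bochner_Integration.integrable_add i i')
  have le: "\<bar>\<kappa> x * (g x \<bullet> g (x + w))\<bar>
      \<le> K * (indicator S x * (norm (g x))\<^sup>2 + indicator S (x + w) * (norm (g (x + w)))\<^sup>2)" for x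
  proof -
    have "\<bar>\<kappa> x * (g x \<bullet> g (x + w))\<bar> \<le> (K * (indicator S x * indicator S (x + w))) * (norm (g x) * norm (g (x + w)))"
      unfolding abs_mult by (rule mult_mono[OF b Cauchy_Schwarz_ineq2]) (use K in auto)
    also have "\<dots> = K * (indicator S x * indicator S (x + w) * (norm (g x) * norm (g (x + w))))" by simp
    also have "\<dots> \<le> K * (indicator S x * indicator S (x + w) * ((norm (g x))\<^sup>2 + (norm (g (x + w)))\<^sup>2))"
      by (rule mult_left_mono[OF mult_left_mono[OF prod_le_sum_squares] K]) auto
    also have "\<dots> \<le> K * (indicator S x * (norm (g x))\<^sup>2 + indicator S (x + w) * (norm (g (x + w)))\<^sup>2)"
      by (rule mult_left_mono[OF _ K]) (auto simp: indicator_def)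
    finally show ?thesis .
  qed
  have "\<bar>LBINT x. \<kappa> x * (g x \<bullet> g (x + w))\<bar>
      \<le> (LBINT x. K * (indicator S x * (norm (g x))\<^sup>2 + indicator S (x + w) * (norm (g (x + w)))\<^sup>2))"
    by (rule abs_integral_le[OF iR _ le]) measurable
  also have "\<dots> = K * ((LBINT x. indicator S x * (norm (g x))\<^sup>2) + (LBINT x. indicator S (x + w) * (norm (g (x + w)))\<^sup>2))"
    using i i' by simp
  also have "(LBINT x. indicator S (x + w) * (norm (g (x + w)))\<^sup>2) = (LBINT x. indicator S x * (norm (g x))\<^sup>2)"
    by (rule lborel_integral_translate[of "\<lambda>x. indicator S x * (norm (g x))\<^sup>2"]) measurable
  finally show ?thesis by simp
qed

section \<open>The local Pohozaev estimate\<close>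

text \<open>The gradient of \<open>cutoff z r\<close> lives where the distance to \<open>z\<close> lies between \<open>r\<close> and \<open>2 r\<close>; the shell adds room
  for shifts of length at most \<open>r / 4\<close>.\<close>
definition shell :: "real^3 \<Rightarrow> real \<Rightarrow> (real^3) set" where
  "shell z r = {x. r / 2 \<le> dist x z \<and> dist x z \<le> 3 * r}"

lemma compact_shell: "compact (shell z r)"
proof -
  have "closed (shell z r)" unfolding shell_def
    by (intro closed_Collect_conj closed_Collect_le continuous_intros)
  moreover have "bounded (shell z r)"
    by (rule bounded_subset[OF bounded_cball[of z "3 * r"]]) (auto simp: shell_def dist_commute)
  ultimately show ?thesis using compact_eq_bounded_closed by blast
qed

lemma shell_measurable [measurable]: "shell z r \<in> sets borel"
  by (rule borel_compact[OF compact_shell])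

lemma cutoff'_bounded: assumes "0 < r" shows "\<exists>L\<ge>0. \<forall>x. norm (cutoff' z r x) \<le> L"
  using continuous_compact_support_bounded[OF test_functionD(1,3,6)[OF test_function_cutoff[OF assms]]] .

lemma cutoff_lipschitz:
  assumes L: "\<And>x. norm (cutoff' z r x) \<le> L"
  shows "\<bar>cutoff z r (x + w) - cutoff z r x\<bar> \<le> L * norm w"
proof -
  have "norm (cutoff z r (x + w) - cutoff z r x) \<le> L * norm (x + w - x)"
  proof (rule differentiable_bound[of UNIV _ "\<lambda>x h. h \<bullet> cutoff' z r x"])
    show "(cutoff z r has_derivative (\<lambda>h. h \<bullet> cutoff' z r x)) (at x within UNIV)" for x
      using GDERIV_cutoff[of z r x] by (simp add: gderiv_def)
    show "onorm (\<lambda>h. h \<bullet> cutoff' z r x) \<le> L" for x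
    proof (rule onorm_le)
      fix h show "norm (h \<bullet> cutoff' z r x) \<le> L * norm h"
        using Cauchy_Schwarz_ineq2[of h "cutoff' z r x"] mult_left_mono[OF L[of x], of "norm h"]
        by (simp add: mult.commute)
    qed
  qed auto
  then show ?thesis by simp
qed

lemma cutoff_difference_bound:
  assumes r: "0 < r" and L: "\<And>x. norm (cutoff' z r x) \<le> L" and w: "norm w \<le> r / 4"
  shows "\<bar>cutoff z r (x + w) - cutoff z r x\<bar> \<le> L * norm w * (indicator (shell z r) x * indicator (shell z r) (x + w))"
proof (cases "x \<in> shell z r \<and> x + w \<in> shell z r")
  case True then show ?thesis using cutoff_lipschitz[OF L, of x w] by simp
next
  case False
  have "dist (x + w) z \<le> dist x z + norm w" "dist x z \<le> dist (x + w) z + norm w"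
    using norm_triangle_ineq[of "x - z" w] norm_triangle_ineq4[of "x + w - z" w]
    by (simp_all add: dist_norm algebra_simps)
  then have "(dist x z \<le> r \<and> dist (x + w) z \<le> r) \<or> (2 * r \<le> dist x z \<and> 2 * r \<le> dist (x + w) z)"
    using False w r by (auto simp: shell_def)
  then have "cutoff z r (x + w) = cutoff z r x"
    using cutoff_eq_1[OF r] cutoff_eq_0[OF r] by metis
  then show ?thesis using False by auto
qed

lemma dist_add_le:
  fixes y v z :: "'a::real_normed_vector"
  shows "dist (y + v) z \<le> dist y z + norm v" "dist y z \<le> dist (y + v) z + norm v"
  using dist_triangle[of "y + v" z y] dist_triangle[of y z "y + v"] by (simp_all add: dist_norm)

text \<open>The points \<open>x + w\<close> and \<open>x - w\<close> are joined by the segment of length \<open>2 \<bar>w\<bar>\<close> through \<open>x\<close>.\<close>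
lemma symmetric_difference_square_integral_le:
  assumes u: "u \<in> H1" and S'[measurable]: "S' \<in> sets borel" and B[measurable]: "B \<in> sets borel"
    and sub: "\<And>x s. x \<in> S' \<Longrightarrow> \<bar>s\<bar> \<le> 1 \<Longrightarrow> x + s *\<^sub>R w \<in> B"
  shows "(LBINT x. indicator S' x * (u (x + w) - u (x - w))\<^sup>2)
    \<le> 4 * (norm w)\<^sup>2 * (LBINT x. indicator B x * (norm (wgrad u x))\<^sup>2)"
proof -
  note su = H1_square_integrable[OF u] and G = H1_wgrad[OF u]
  note [measurable] = square_integrable_measurable[OF su]
  have "(LBINT x. indicator S' x * (u (x + w) - u (x - w))\<^sup>2)
      = (LBINT x. indicator S' (x + w) * (u (x + w + w) - u (x + w - w))\<^sup>2)"
    by (rule lborel_integral_translate[symmetric]) measurable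
  also have "\<dots> = (LBINT x. indicator {x. x + w \<in> S'} x * (u (x + 2 *\<^sub>R w) - u x)\<^sup>2)"
    by (intro Bochner_Integration.integral_cong) (auto simp: indicator_def algebra_simps scaleR_2)
  also have "\<dots> \<le> (norm (2 *\<^sub>R w))\<^sup>2 * (LBINT x. indicator B x * (norm (wgrad u x))\<^sup>2)"
  proof (rule weak_gradient_difference_square_integral_le[OF G(1) su G(2)])
    show "{x. x + w \<in> S'} \<in> sets borel" by measurable
    fix x s assume x: "x \<in> {x. x + w \<in> S'}" and s: "0 \<le> s" "s \<le> (1::real)"
    have eq: "x + s *\<^sub>R (2 *\<^sub>R w) = (x + w) + (2 * s - 1) *\<^sub>R w"
      by (simp add: algebra_simps)
    show "x + s *\<^sub>R (2 *\<^sub>R w) \<in> B"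
      unfolding eq by (rule sub) (use x s in auto)
  qed (rule B)
  finally show ?thesis by (simp add: power_mult_distrib)
qed

text \<open>The term in which the derivative of the test function falls on the cutoff.  Both factors, the
  gradient and the difference of length \<open>2 h \<bar>e\<bar>\<close>, are controlled by the gradient on the shell, so the term
  is of order \<open>h\<close>.\<close>
lemma drift_term_bound:
  fixes u :: "real^3 \<Rightarrow> real"
  assumes u: "u \<in> H1" and r: "0 < r" and L: "\<And>x. norm (cutoff' z r x) \<le> L"
    and h: "0 < h" and w: "norm (h *\<^sub>R e) \<le> r / 4"
  shows "\<bar>LBINT x. (u (x + h *\<^sub>R e) - u (x - h *\<^sub>R e)) * (wgrad u x \<bullet> cutoff' z r x)\<bar>
    \<le> 2 * h * (L * ((norm e)\<^sup>2 + 1)) * (LBINT x. indicator (shell z r) x * (norm (wgrad u x))\<^sup>2)"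
proof -
  let ?S = "shell z r" and ?G = "wgrad u" and ?w = "h *\<^sub>R e"
  let ?d = "\<lambda>x. u (x + ?w) - u (x - ?w)"
  define I where "I = (LBINT x. indicator ?S x * (norm (?G x))\<^sup>2)"
  define S' where "S' = {x. r \<le> dist x z \<and> dist x z \<le> 2 * r}"
  have S'm[measurable]: "S' \<in> sets borel" unfolding S'_def by measurable
  have L0: "0 \<le> L" using L[of 0] norm_ge_zero order_trans by blast
  note su = H1_square_integrable[OF u] and G = H1_wgrad[OF u]
  have [measurable]: "u \<in> borel_measurable borel" "?G \<in> borel_measurable borel"
    using su G by (auto simp: square_integrable_def)
  have cm[measurable]: "cutoff' z r \<in> borel_measurable borel"
    by (rule borel_measurable_continuous_onI[OF continuous_cutoff'])
  have sd: "square_integrable ?d" by (rule square_integrable_symmetric_difference[OF su])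
  have iG: "integrable lborel (\<lambda>x. indicator ?S x * (norm (?G x))\<^sup>2)"
    by (rule integrable_indicator_sq[OF G(2)]) measurable
  have id: "integrable lborel (\<lambda>x. indicator S' x * (?d x)\<^sup>2)"
    using integrable_indicator_sq[OF sd S'm] by simp
  have "(LBINT x. indicator S' x * (?d x)\<^sup>2) \<le> 4 * (norm ?w)\<^sup>2 * I"
    unfolding I_def
  proof (rule symmetric_difference_square_integral_le[OF u S'm])
    fix x s assume x: "x \<in> S'" and s: "\<bar>s\<bar> \<le> (1::real)"
    have "norm (s *\<^sub>R ?w) \<le> 1 * norm ?w"
      unfolding norm_scaleR[of s] by (rule mult_right_mono) (use s in auto)
    then have n: "norm (s *\<^sub>R ?w) \<le> r / 4" using w by simp
    show "x + s *\<^sub>R ?w \<in> ?S"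
      using dist_add_le(1)[of x "s *\<^sub>R ?w" z] dist_add_le(2)[of x z "s *\<^sub>R ?w"] x n r unfolding S'_def shell_def mem_Collect_eq by linarith
  qed measurable
  then have dle: "(LBINT x. indicator S' x * (?d x)\<^sup>2) \<le> 4 * h\<^sup>2 * (norm e)\<^sup>2 * I"
    using h by (simp add: power_mult_distrib)
  have iR: "integrable lborel (\<lambda>x. (L / (2 * h)) * (indicator S' x * (?d x)\<^sup>2) + (2 * h * L) * (indicator ?S x * (norm (?G x))\<^sup>2))"
    by (intro Bochner_Integration.integrable_add integrable_mult_right id iG)
  have le: "\<bar>?d x * (?G x \<bullet> cutoff' z r x)\<bar>
      \<le> (L / (2 * h)) * (indicator S' x * (?d x)\<^sup>2) + (2 * h * L) * (indicator ?S x * (norm (?G x))\<^sup>2)" for x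
  proof (cases "x \<in> S'")
    case False
    then have "cutoff' z r x = 0" by (intro cutoff'_eq_0[OF r]) (auto simp: S'_def)
    then show ?thesis using h L0 by simp
  next
    case True
    then have xS: "x \<in> ?S" using r by (auto simp: S'_def shell_def)
    have "\<bar>?G x \<bullet> cutoff' z r x\<bar> \<le> norm (?G x) * L"
      by (rule order_trans[OF Cauchy_Schwarz_ineq2 mult_left_mono[OF L]]) simp
    then have "\<bar>?d x * (?G x \<bullet> cutoff' z r x)\<bar> \<le> \<bar>?d x\<bar> * (norm (?G x) * L)"
      unfolding abs_mult by (rule mult_left_mono) simp
    \<comment> \<open>The weight \<open>1 / 2h\<close> balances Young's inequality: the difference \<open>?d\<close> is of order \<open>h\<close>.\<close>
    also have "\<dots> = (2 * h * L) * ((\<bar>?d x\<bar> / (2 * h)) * norm (?G x))" using h by simp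
    also have "\<dots> \<le> (2 * h * L) * ((\<bar>?d x\<bar> / (2 * h))\<^sup>2 + (norm (?G x))\<^sup>2)"
      by (rule mult_left_mono[OF prod_le_sum_squares]) (use h L0 in auto)
    also have "\<dots> = (L / (2 * h)) * (?d x)\<^sup>2 + (2 * h * L) * (norm (?G x))\<^sup>2"
      using h by (simp add: field_simps power2_eq_square)
    finally show ?thesis using True xS by simp
  qed
  have "\<bar>LBINT x. ?d x * (?G x \<bullet> cutoff' z r x)\<bar>
      \<le> (LBINT x. (L / (2 * h)) * (indicator S' x * (?d x)\<^sup>2) + (2 * h * L) * (indicator ?S x * (norm (?G x))\<^sup>2))"
    by (rule abs_integral_le[OF iR _ le]) measurable
  also have "\<dots> = (L / (2 * h)) * (LBINT x. indicator S' x * (?d x)\<^sup>2) + (2 * h * L) * I"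
    using id iG by (simp add: I_def)
  also have "\<dots> \<le> (L / (2 * h)) * (4 * h\<^sup>2 * (norm e)\<^sup>2 * I) + (2 * h * L) * I"
    by (intro add_right_mono mult_left_mono dle) (use h L0 in auto)
  also have "\<dots> = 2 * h * (L * ((norm e)\<^sup>2 + 1)) * I"
    using h by (simp add: field_simps power2_eq_square)
  finally show ?thesis by (simp add: I_def)
qed

text \<open>By the mean value theorem the difference of \<open>t powr (p + 1) / (p + 1)\<close> is \<open>\<xi> powr p * (b - a)\<close> with \<open>\<xi>\<close>
  between \<open>a\<close> and \<open>b\<close>, and monotonicity keeps \<open>\<xi> powr p\<close> within \<open>\<omega>\<close> of \<open>q\<close>.\<close>
lemma powr_difference_estimate:
  fixes a b p q :: real
  assumes a: "0 < a" and b: "0 < b" and p: "0 < p"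
    and qa: "\<bar>a powr p - q\<bar> \<le> \<omega>" and qb: "\<bar>b powr p - q\<bar> \<le> \<omega>"
  shows "\<bar>q * (b - a) - (b powr (p + 1) / (p + 1) - a powr (p + 1) / (p + 1))\<bar> \<le> \<omega> * \<bar>b - a\<bar>"
proof -
  have main: "\<bar>q * (t - s) - (t powr (p + 1) / (p + 1) - s powr (p + 1) / (p + 1))\<bar> \<le> \<omega> * \<bar>t - s\<bar>"
    if st: "0 < s" "s < t" and q: "\<bar>s powr p - q\<bar> \<le> \<omega>" "\<bar>t powr p - q\<bar> \<le> \<omega>" for s t
  proof -
    have "\<exists>\<xi>. s < \<xi> \<and> \<xi> < t \<and> t powr (p + 1) / (p + 1) - s powr (p + 1) / (p + 1) = (t - s) * (\<xi> powr p)"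
    proof (rule MVT2[OF st(2)])
      fix \<xi> assume "s \<le> \<xi>" "\<xi> \<le> t"
      then have "0 < \<xi>" using st by simp
      from has_real_derivative_powr[OF this, of "p + 1"]
      have "DERIV (\<lambda>x. x powr (p + 1)) \<xi> :> (p + 1) * \<xi> powr p" by simp
      from DERIV_cdivide[OF this, of "p + 1"]
      show "DERIV (\<lambda>x. x powr (p + 1) / (p + 1)) \<xi> :> \<xi> powr p" using p by simp
    qed
    then obtain \<xi> where \<xi>: "s < \<xi>" "\<xi> < t"
      "t powr (p + 1) / (p + 1) - s powr (p + 1) / (p + 1) = (t - s) * (\<xi> powr p)" by blast
    have "s powr p \<le> \<xi> powr p" "\<xi> powr p \<le> t powr p" using \<xi> st p by (auto intro!: powr_mono2)
    then have "\<bar>q - \<xi> powr p\<bar> \<le> \<omega>" using q by linarith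
    then have "\<bar>(t - s) * (q - \<xi> powr p)\<bar> \<le> \<bar>t - s\<bar> * \<omega>" unfolding abs_mult by (rule mult_left_mono) simp
    then show ?thesis unfolding \<xi>(3) by (simp add: algebra_simps)
  qed
  consider "a < b" | "b < a" | "a = b" by linarith
  then show ?thesis
  proof cases
    case 2
    from main[OF b 2 qb qa] have "\<bar>- (q * (b - a) - (b powr (p + 1) / (p + 1) - a powr (p + 1) / (p + 1)))\<bar> \<le> \<omega> * \<bar>b - a\<bar>"
      by (simp add: algebra_simps abs_minus_commute)
    then show ?thesis by (simp only: abs_minus_cancel)
  qed (use main[OF a _ qa qb] in auto)
qed

lemma abs_le_add_square_divide:
  fixes d s :: real
  assumes "0 < s" shows "\<bar>d\<bar> \<le> s + d\<^sup>2 / s"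
proof -
  have "\<bar>d\<bar> = s * (1 * (\<bar>d\<bar> / s))" using assms by simp
  also have "\<dots> \<le> s * (1\<^sup>2 + (\<bar>d\<bar> / s)\<^sup>2)"
    by (rule mult_left_mono[OF prod_le_sum_squares]) (use assms in auto)
  also have "\<dots> = s + d\<^sup>2 / s" using assms by (simp add: power_divide distrib_left power2_eq_square)
  finally show ?thesis .
qed

lemma eventually_small_shift:
  fixes e :: "'a::real_normed_vector"
  assumes "0 < \<delta>" shows "\<forall>\<^sub>F h in at_right 0. 0 < h \<and> norm (h *\<^sub>R e) < \<delta>"
proof (rule eventually_conj)
  show "\<forall>\<^sub>F h::real in at_right 0. 0 < h" by (rule eventually_at_right_less)
  have "((\<lambda>h. norm (h *\<^sub>R e)) \<longlongrightarrow> norm (0 *\<^sub>R e)) (at_right 0)" by (intro tendsto_intros)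
  then have "((\<lambda>h. norm (h *\<^sub>R e)) \<longlongrightarrow> 0) (at_right 0)" by simp
  then show "\<forall>\<^sub>F h in at_right 0. norm (h *\<^sub>R e) < \<delta>" by (rule order_tendstoD) (rule assms)
qed

text \<open>With \<open>f = u\<^bsup>p+1\<^esup> / (p + 1)\<close>, the product \<open>u\<^sup>p (u(x + w) - u(x - w))\<close> differs from
  \<open>f(x + w) - f(x - w)\<close> by at most \<open>\<omega> \<bar>u(x + w) - u(x - w)\<bar>\<close>, where \<open>\<omega>\<close> is small by the uniform continuity of
  \<open>u\<^sup>p\<close> on a compact set.  The main part is translated onto the cutoff; the error is \<open>\<omega>\<close> times
  a quantity of order \<open>h\<close>.\<close>
lemma nonlinear_term_bound:
  fixes u :: "real^3 \<Rightarrow> real"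
  assumes u: "u \<in> H1" and cu: "continuous_on UNIV u" and pos: "\<And>x. 0 < u x" and p: "0 < p"
    and r: "0 < r" and L: "\<And>x. norm (cutoff' z r x) \<le> L" and \<tau>: "0 < \<tau>"
  shows "\<forall>\<^sub>F h in at_right 0.
    \<bar>LBINT x. u x powr p * (cutoff z r x * (u (x + h *\<^sub>R e) - u (x - h *\<^sub>R e)))\<bar>
      \<le> 2 * h * (L * norm e * (LBINT x. indicator (shell z r) x * u x powr (p + 1)) + \<tau>)"
proof -
  let ?S = "shell z r" and ?G = "wgrad u" and ?\<eta> = "cutoff z r"
  define K where "K = cball z (2 * r)"
  have K: "compact K" by (simp add: K_def)
  have [measurable]: "K \<in> sets borel" by (rule borel_compact[OF K])
  have L0: "0 \<le> L" using L[of 0] norm_ge_zero order_trans by blast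
  note su = H1_square_integrable[OF u]
  note [measurable] = square_integrable_measurable[OF su]
  note T = test_functionD[OF test_function_cutoff[OF r, of z]]
  have [measurable]: "?\<eta> \<in> borel_measurable borel" by (rule borel_measurable_continuous_onI[OF T(4)])
  have \<eta>0: "?\<eta> x = 0" if "x \<notin> K" for x using that by (intro cutoff_eq_0[OF r]) (auto simp: K_def dist_commute)
  \<comment> \<open>\<open>2 h Q\<close> will bound the integral of \<open>\<bar>u(x + h e) - u(x - h e)\<bar>\<close> over \<open>K\<close>.\<close>
  define Q where "Q = (LBINT x. indicator K x) + (norm e)\<^sup>2 * (LBINT x. (norm (?G x))\<^sup>2)"
  have Q0: "0 \<le> Q" unfolding Q_def by (intro add_nonneg_nonneg mult_nonneg_nonneg Bochner_Integration.integral_nonneg) auto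
  define \<omega> where "\<omega> = \<tau> / (Q + 1)"
  have \<omega>: "0 < \<omega>" using \<tau> Q0 by (simp add: \<omega>_def)
  have \<omega>Q: "\<omega> * Q \<le> \<tau>" using \<tau> Q0 by (simp add: \<omega>_def field_simps)
  have cp: "continuous_on UNIV (\<lambda>x. u x powr q)" for q
    by (rule continuous_on_powr[OF cu continuous_on_const]) (use pos in \<open>auto simp: less_imp_neq[symmetric]\<close>)
  have "uniformly_continuous_on (cball z (3 * r)) (\<lambda>x. u x powr p)"
    by (rule compact_uniformly_continuous[OF continuous_on_subset[OF cp]]) auto
  then obtain \<delta> where \<delta>: "0 < \<delta>" and uc: "\<And>x y. x \<in> cball z (3 * r) \<Longrightarrow> y \<in> cball z (3 * r) \<Longrightarrow> dist y x < \<delta>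
      \<Longrightarrow> dist (u y powr p) (u x powr p) < \<omega>"
    unfolding uniformly_continuous_on_def using \<omega> by metis
  have small: "0 < min \<delta> (r / 4)" using \<delta> r by simp
  have "\<bar>LBINT x. u x powr p * (?\<eta> x * (u (x + h *\<^sub>R e) - u (x - h *\<^sub>R e)))\<bar>
      \<le> 2 * h * (L * norm e * (LBINT x. indicator ?S x * u x powr (p + 1)) + \<tau>)"
    if hs: "0 < h \<and> norm (h *\<^sub>R e) < min \<delta> (r / 4)" for h
  proof -
    let ?w = "h *\<^sub>R e"
    let ?d = "\<lambda>x. u (x + ?w) - u (x - ?w)"
    have h: "0 < h" and w: "norm ?w < \<delta>" "norm ?w \<le> r / 4" using hs by auto
    define f where "f x = u x powr (p + 1) / (p + 1)" for x
    have cf: "continuous_on UNIV f" unfolding f_def by (intro continuous_intros cp) (use p in auto)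
    have [measurable]: "f \<in> borel_measurable borel" by (rule borel_measurable_continuous_onI[OF cf])
    have f0: "0 \<le> f x" and fle: "f x \<le> u x powr (p + 1)" for x
      using p by (auto simp: f_def divide_le_eq mult_left_le_one_le mult_le_cancel_left1)
    have tr: "continuous_on UNIV (\<lambda>x. k (x + v))" if "continuous_on UNIV k" for k :: "real^3 \<Rightarrow> real" and v
      by (rule continuous_on_compose2[OF that]) (auto intro: continuous_intros)
    have tr': "continuous_on UNIV (\<lambda>x. k (x - v))" if "continuous_on UNIV k" for k :: "real^3 \<Rightarrow> real" and v
      by (rule continuous_on_compose2[OF that]) (auto intro: continuous_intros)
    have cd: "continuous_on UNIV ?d" by (rule continuous_on_diff[OF tr[OF cu] tr'[OF cu]])
    have i1: "integrable lborel (\<lambda>x. ?\<eta> x * f (x + ?w))" "integrable lborel (\<lambda>x. ?\<eta> x * f (x - ?w))"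
      by (rule integrable_continuous_compact_support[OF K continuous_on_mult[OF T(4) tr[OF cf]]], simp add: \<eta>0)
        (rule integrable_continuous_compact_support[OF K continuous_on_mult[OF T(4) tr'[OF cf]]], simp add: \<eta>0)
    have i2: "integrable lborel (\<lambda>x. u x powr p * (?\<eta> x * ?d x))"
      by (rule integrable_continuous_compact_support[OF K continuous_on_mult[OF cp continuous_on_mult[OF T(4) cd]]])
        (simp add: \<eta>0)
    define err where "err x = u x powr p * ?d x - (f (x + ?w) - f (x - ?w))" for x
    have i3: "integrable lborel (\<lambda>x. ?\<eta> x * err x)"
      using Bochner_Integration.integrable_diff[OF i2 Bochner_Integration.integrable_diff[OF i1]]
      by (simp add: err_def algebra_simps)
    have split: "(LBINT x. u x powr p * (?\<eta> x * ?d x))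
        = (LBINT x. ?\<eta> x * err x) + ((LBINT x. ?\<eta> x * f (x + ?w)) - (LBINT x. ?\<eta> x * f (x - ?w)))"
    proof -
      have "(LBINT x. u x powr p * (?\<eta> x * ?d x))
          = (LBINT x. ?\<eta> x * err x + (?\<eta> x * f (x + ?w) - ?\<eta> x * f (x - ?w)))"
        by (simp add: err_def algebra_simps)
      then show ?thesis using i1 i3 by simp
    qed
    have j1: "integrable lborel (\<lambda>x. ?\<eta> (x - ?w) * f x)"
      using lborel_integrable_translate_iff[of "\<lambda>x. ?\<eta> (x - ?w) * f x" ?w] i1(1) by simp
    have j2: "integrable lborel (\<lambda>x. ?\<eta> (x + ?w) * f x)"
      using lborel_integrable_translate_iff[of "\<lambda>x. ?\<eta> (x + ?w) * f x" "- ?w"] i1(2) by simp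
    have e1: "(LBINT x. ?\<eta> x * f (x + ?w)) = (LBINT x. ?\<eta> (x - ?w) * f x)"
      using lborel_integral_translate[of "\<lambda>x. ?\<eta> (x - ?w) * f x" ?w] by simp
    have e2: "(LBINT x. ?\<eta> x * f (x - ?w)) = (LBINT x. ?\<eta> (x + ?w) * f x)"
      using lborel_integral_translate[of "\<lambda>x. ?\<eta> (x + ?w) * f x" "- ?w"] by simp
    have iS: "integrable lborel (\<lambda>x. indicator ?S x * u x powr (p + 1))"
    proof -
      show ?thesis
        using borel_integrable_compact[OF compact_shell continuous_on_subset[OF cp subset_UNIV]] by simp
    qed
    have "\<bar>(LBINT x. (?\<eta> (x - ?w) - ?\<eta> (x + ?w)) * f x)\<bar>
        \<le> (LBINT x. (2 * L * norm ?w) * (indicator ?S x * u x powr (p + 1)))"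
    proof (rule abs_integral_le[OF integrable_mult_right[OF iS]])
      fix x
      have "\<bar>?\<eta> (x + ?w) - ?\<eta> x\<bar> \<le> L * norm ?w * indicator ?S x"
        by (rule order_trans[OF cutoff_difference_bound[OF r L w(2)]]) (use L0 in \<open>auto simp: indicator_def\<close>)
      moreover have "\<bar>?\<eta> (x - ?w + ?w) - ?\<eta> (x - ?w)\<bar> \<le> L * norm ?w * indicator ?S x"
        by (rule order_trans[OF cutoff_difference_bound[OF r L w(2)]]) (use L0 in \<open>auto simp: indicator_def\<close>)
      ultimately have "\<bar>?\<eta> (x - ?w) - ?\<eta> (x + ?w)\<bar> \<le> 2 * L * norm ?w * indicator ?S x" by simp
      then have "\<bar>?\<eta> (x - ?w) - ?\<eta> (x + ?w)\<bar> * \<bar>f x\<bar> \<le> 2 * L * norm ?w * indicator ?S x * u x powr (p + 1)"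
        using f0[of x] fle[of x] by (intro mult_mono) auto
      then show "\<bar>(?\<eta> (x - ?w) - ?\<eta> (x + ?w)) * f x\<bar> \<le> (2 * L * norm ?w) * (indicator ?S x * u x powr (p + 1))"
        by (simp add: abs_mult mult.assoc)
    qed measurable
    also have "\<dots> = 2 * h * (L * norm e * (LBINT x. indicator ?S x * u x powr (p + 1)))"
      using h by simp
    finally have exact: "\<bar>(LBINT x. ?\<eta> x * f (x + ?w)) - (LBINT x. ?\<eta> x * f (x - ?w))\<bar>
        \<le> 2 * h * (L * norm e * (LBINT x. indicator ?S x * u x powr (p + 1)))"
      unfolding e1 e2 left_diff_distrib Bochner_Integration.integral_diff[OF j1 j2] .
    have sd: "square_integrable ?d" by (rule square_integrable_symmetric_difference[OF su])
    have iK: "integrable lborel (\<lambda>x. indicator K x :: real)" using integrable_const_indicator_compact[OF K, of 1] by simp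
    have id: "integrable lborel (\<lambda>x. indicator K x * (?d x)\<^sup>2)"
      using integrable_indicator_sq[OF sd, of K] by simp
    have dle: "(LBINT x. indicator K x * (?d x)\<^sup>2) \<le> 4 * (norm ?w)\<^sup>2 * (LBINT x. (norm (?G x))\<^sup>2)"
      using symmetric_difference_square_integral_le[OF u, of K UNIV ?w] by simp
    have le: "\<bar>?\<eta> x * err x\<bar> \<le> \<omega> * (2 * h * indicator K x + (indicator K x * (?d x)\<^sup>2) / (2 * h))" for x
    proof (cases "x \<in> K")
      case False then show ?thesis using \<eta>0 by simp
    next
      case True
      have in3: "x \<in> cball z (3 * r)" "x + ?w \<in> cball z (3 * r)" "x - ?w \<in> cball z (3 * r)"
        using True w(2) r dist_add_le(1)[of x ?w z] dist_add_le(1)[of x "- ?w" z]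
        by (auto simp: K_def dist_commute)
      have "dist (x + ?w) x < \<delta>" "dist (x - ?w) x < \<delta>" using w(1) by (auto simp: dist_norm)
      then have "\<bar>u (x + ?w) powr p - u x powr p\<bar> \<le> \<omega>" "\<bar>u (x - ?w) powr p - u x powr p\<bar> \<le> \<omega>"
        using uc[OF in3(1,2)] uc[OF in3(1,3)] by (auto simp: dist_real_def)
      then have "\<bar>err x\<bar> \<le> \<omega> * \<bar>?d x\<bar>"
        unfolding err_def f_def by (intro powr_difference_estimate pos p)
      then have "\<bar>?\<eta> x * err x\<bar> \<le> 1 * (\<omega> * \<bar>?d x\<bar>)"
        unfolding abs_mult using cutoff_bounds[of z r x] by (intro mult_mono) auto
      also have "\<bar>?d x\<bar> \<le> 2 * h + (?d x)\<^sup>2 / (2 * h)"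
        by (rule abs_le_add_square_divide) (use h in simp)
      finally show ?thesis using True \<omega> by (simp add: mult_left_mono)
    qed
    have iR: "integrable lborel (\<lambda>x. \<omega> * (2 * h * indicator K x + (indicator K x * (?d x)\<^sup>2) / (2 * h)))"
      by (intro integrable_mult_right Bochner_Integration.integrable_add integrable_divide id iK)
    have "\<bar>LBINT x. ?\<eta> x * err x\<bar>
        \<le> (LBINT x. \<omega> * (2 * h * indicator K x + (indicator K x * (?d x)\<^sup>2) / (2 * h)))"
      by (rule abs_integral_le[OF iR borel_measurable_integrable[OF i3] le])
    also have "\<dots> = \<omega> * (2 * h * (LBINT x. indicator K x) + (LBINT x. indicator K x * (?d x)\<^sup>2) / (2 * h))"
      using iK id by simp
    also have "\<dots> \<le> \<omega> * (2 * h * (LBINT x. indicator K x) + (4 * (norm ?w)\<^sup>2 * (LBINT x. (norm (?G x))\<^sup>2)) / (2 * h))"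
      by (intro mult_left_mono add_left_mono divide_right_mono dle) (use \<omega> h in auto)
    also have "\<dots> = 2 * h * (\<omega> * Q)"
      using h by (simp add: Q_def field_simps power2_eq_square)
    also have "\<dots> \<le> 2 * h * \<tau>" using \<omega>Q h by (intro mult_left_mono) auto
    finally have error: "\<bar>LBINT x. ?\<eta> x * err x\<bar> \<le> 2 * h * \<tau>" .
    show ?thesis using exact error unfolding split distrib_left by linarith
  qed
  then show ?thesis by (rule eventually_mono[OF eventually_small_shift[OF small, of e]])
qed

lemma directional_increase:
  fixes V :: "real^3 \<Rightarrow> real"
  assumes V: "\<And>x. GDERIV V x :> V' x" and h: "0 < h"
    and c: "\<And>t. 0 \<le> t \<Longrightarrow> t \<le> h \<Longrightarrow> c \<le> e \<bullet> V' (y + t *\<^sub>R e)"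
  shows "h * c \<le> V (y + h *\<^sub>R e) - V y"
proof -
  have d: "DERIV (\<lambda>t. V (y + t *\<^sub>R e)) t :> e \<bullet> V' (y + t *\<^sub>R e)" for t
  proof -
    have 1: "((\<lambda>t. y + t *\<^sub>R e) has_derivative (\<lambda>h. h *\<^sub>R e)) (at t)"
      using has_derivative_add[OF has_derivative_const has_derivative_scaleR_left[OF has_derivative_ident]] by simp
    from has_derivative_compose[OF 1 V[unfolded gderiv_def]] show ?thesis
      unfolding has_field_derivative_def by (rule has_derivative_eq_rhs) (simp add: fun_eq_iff mult.commute)
  qed
  have "\<exists>t. 0 < t \<and> t < h \<and> V (y + h *\<^sub>R e) - V (y + 0 *\<^sub>R e) = (h - 0) * (e \<bullet> V' (y + t *\<^sub>R e))"
    by (rule MVT2[OF h d])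
  then obtain t where t: "0 < t" "t < h" "V (y + h *\<^sub>R e) - V y = h * (e \<bullet> V' (y + t *\<^sub>R e))" by auto
  show ?thesis unfolding t(3) using c[of t] t h by (intro mult_left_mono) auto
qed

text \<open>After translation the increment of \<open>V \<eta>\<close> splits into an increment of \<open>V\<close>, which is at least \<open>h c\<close> on the
  support of the cutoff, and an increment of \<open>\<eta>\<close>, which is confined to the shell.  For the first part
  positivity of \<open>u\<close> gives the sign, and uniform continuity gives \<open>u(x - w) \<ge> u(x) / 2\<close> on the inner ball for small
  \<open>w\<close>.\<close>
lemma potential_term_bound:
  fixes u V :: "real^3 \<Rightarrow> real"
  assumes V: "\<And>x. GDERIV V x :> V' x" and M: "\<And>x. \<bar>V x\<bar> \<le> M"
    and c: "0 < c" "\<And>x. dist x z \<le> 3 * r \<Longrightarrow> c \<le> e \<bullet> V' x"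
    and u: "u \<in> H1" and cu: "continuous_on UNIV u" and pos: "\<And>x. 0 < u x"
    and r: "0 < r" and L: "\<And>x. norm (cutoff' z r x) \<le> L"
  shows "\<forall>\<^sub>F h in at_right 0.
    h * (c / 2 * (LBINT x. indicator (cball z r) x * (u x)\<^sup>2)
      - 2 * (M * L * norm e) * (LBINT x. indicator (shell z r) x * (u x)\<^sup>2))
    \<le> - (LBINT x. (V x * cutoff z r x) * (u x * (u (x + h *\<^sub>R e) - u (x - h *\<^sub>R e))))"
proof -
  let ?S = "shell z r" and ?\<eta> = "cutoff z r"
  have L0: "0 \<le> L" using L[of 0] norm_ge_zero order_trans by blast
  have M0: "0 \<le> M" using M[of 0] by linarith
  note su = H1_square_integrable[OF u]
  note [measurable] = square_integrable_measurable[OF su]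
  have [measurable]: "V \<in> borel_measurable borel"
    by (rule borel_measurable_continuous_onI[OF GDERIV_continuous[OF V]])
  have [measurable]: "?\<eta> \<in> borel_measurable borel"
    by (rule borel_measurable_continuous_onI[OF GDERIV_continuous[OF GDERIV_cutoff]])
  have \<eta>1: "\<bar>?\<eta> x\<bar> \<le> 1" for x using cutoff_bounds[of z r x] by auto
  obtain m0 where m0: "0 < m0" "\<And>x. x \<in> cball z r \<Longrightarrow> m0 \<le> u x"
  proof -
    have "\<exists>x\<in>cball z r. \<forall>y\<in>cball z r. u x \<le> u y"
      by (rule continuous_attains_inf[OF compact_cball _ continuous_on_subset[OF cu]]) (use r in auto)
    then show ?thesis using pos that by blast
  qed
  have "uniformly_continuous_on (cball z (2 * r)) u"
    by (rule compact_uniformly_continuous[OF continuous_on_subset[OF cu]]) auto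
  moreover have "0 < m0 / 2" using m0 by simp
  ultimately obtain \<delta> where \<delta>: "0 < \<delta>" and uc: "\<And>x y. x \<in> cball z (2 * r) \<Longrightarrow> y \<in> cball z (2 * r) \<Longrightarrow> dist y x < \<delta>
      \<Longrightarrow> dist (u y) (u x) < m0 / 2"
    unfolding uniformly_continuous_on_def by metis
  have small: "0 < min \<delta> (r / 4)" using \<delta> r by simp
  have "h * (c / 2 * (LBINT x. indicator (cball z r) x * (u x)\<^sup>2)
      - 2 * (M * L * norm e) * (LBINT x. indicator ?S x * (u x)\<^sup>2))
    \<le> - (LBINT x. (V x * ?\<eta> x) * (u x * (u (x + h *\<^sub>R e) - u (x - h *\<^sub>R e))))"
    if hs: "0 < h \<and> norm (h *\<^sub>R e) < min \<delta> (r / 4)" for h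
  proof -
    let ?w = "h *\<^sub>R e"
    have h: "0 < h" and w: "norm ?w < \<delta>" "norm ?w \<le> r / 4" using hs by auto
    have suw: "square_integrable (\<lambda>x. u (x + ?w))" "square_integrable (\<lambda>x. u (x - ?w))"
      using square_integrable_translate[OF su, of ?w] square_integrable_translate[OF su, of "- ?w"] by simp_all
    have bV: "\<bar>V x * ?\<eta> y\<bar> \<le> M" for x y
      using mult_mono[OF M[of x] \<eta>1[of y]] M0 by (simp add: abs_mult)
    have sym: "- (LBINT x. (V x * ?\<eta> x) * (u x * (u (x + ?w) - u (x - ?w))))
        = (LBINT x. (V (x + ?w) * ?\<eta> (x + ?w) - V x * ?\<eta> x) * (u x * u (x + ?w)))"
      using integral_symmetric_difference[OF su, of "\<lambda>x. V x * ?\<eta> x" M ?w] bV by simp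
    define k where "k x = ?\<eta> x * (V x - V (x - ?w)) * (u x * u (x - ?w))" for x
    have km[measurable]: "k \<in> borel_measurable borel" unfolding k_def by measurable
    have ik: "integrable lborel k"
    proof -
      have b: "\<bar>?\<eta> x * (V x - V (x - ?w))\<bar> \<le> 2 * M" for x
        using bV[of x x] bV[of "x - ?w" x] by (simp add: algebra_simps)
      have "square_integrable (\<lambda>x. (?\<eta> x * (V x - V (x - ?w))) *\<^sub>R u x)"
        by (rule square_integrable_bounded_mult[OF su _ b]) measurable
      from square_integrable_prod[OF this suw(2)] show ?thesis by (simp add: k_def[abs_def] mult_ac)
    qed
    have ik': "integrable lborel (\<lambda>x. k (x + ?w))" using lborel_integrable_translate_iff[OF km] ik by blast
    have ij: "integrable lborel (\<lambda>x. (V x * (?\<eta> (x + ?w) - ?\<eta> x)) * (u x * u (x + ?w)))"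
    proof -
      have b: "\<bar>V x * (?\<eta> (x + ?w) - ?\<eta> x)\<bar> \<le> 2 * M" for x
        using bV[of x x] bV[of x "x + ?w"] by (simp add: algebra_simps)
      have "square_integrable (\<lambda>x. (V x * (?\<eta> (x + ?w) - ?\<eta> x)) *\<^sub>R u x)"
        by (rule square_integrable_bounded_mult[OF su _ b]) measurable
      from square_integrable_prod[OF this suw(1)] show ?thesis by (simp add: mult_ac)
    qed
    have "(LBINT x. (V (x + ?w) * ?\<eta> (x + ?w) - V x * ?\<eta> x) * (u x * u (x + ?w)))
        = (LBINT x. k (x + ?w) + (V x * (?\<eta> (x + ?w) - ?\<eta> x)) * (u x * u (x + ?w)))"
      by (simp add: k_def algebra_simps)
    also have "\<dots> = (LBINT x. k (x + ?w)) + (LBINT x. (V x * (?\<eta> (x + ?w) - ?\<eta> x)) * (u x * u (x + ?w)))"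
      by (rule Bochner_Integration.integral_add[OF ik' ij])
    also have "(LBINT x. k (x + ?w)) = (LBINT x. k x)" by (rule lborel_integral_translate[OF km])
    finally have eq: "- (LBINT x. (V x * ?\<eta> x) * (u x * (u (x + ?w) - u (x - ?w))))
        = (LBINT x. k x) + (LBINT x. (V x * (?\<eta> (x + ?w) - ?\<eta> x)) * (u x * u (x + ?w)))"
      unfolding sym .
    have iB: "integrable lborel (\<lambda>x. indicator (cball z r) x * (u x)\<^sup>2)"
      using integrable_indicator_sq[OF su, of "cball z r"] by simp
    have inc: "h * c \<le> V x - V (x - ?w)" if x: "dist x z \<le> 2 * r" for x
    proof -
      have "h * c \<le> V ((x - ?w) + h *\<^sub>R e) - V (x - ?w)"
      proof (rule directional_increase[OF V h])
        fix t assume t: "0 \<le> t" "t \<le> h"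
        have eq: "x - ?w + t *\<^sub>R e = x + (- (h - t)) *\<^sub>R e" by (simp add: algebra_simps)
        have "norm ((- (h - t)) *\<^sub>R e) \<le> norm ?w"
          unfolding norm_scaleR by (rule mult_right_mono) (use t in auto)
        then have "dist (x - ?w + t *\<^sub>R e) z \<le> 3 * r"
          unfolding eq using dist_add_le(1)[of x "(- (h - t)) *\<^sub>R e" z] x w(2) r by linarith
        then show "c \<le> e \<bullet> V' (x - ?w + t *\<^sub>R e)" by (rule c(2))
      qed
      then show ?thesis by simp
    qed
    have "(LBINT x. (h * c / 2) * (indicator (cball z r) x * (u x)\<^sup>2)) \<le> (LBINT x. k x)"
    proof (rule integral_mono[OF integrable_mult_right[OF iB] ik])
      fix x
      show "(h * c / 2) * (indicator (cball z r) x * (u x)\<^sup>2) \<le> k x"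
      proof (cases "x \<in> cball z r")
        case True
        then have xr: "dist x z \<le> r" by (simp add: dist_commute)
        have in2: "x \<in> cball z (2 * r)" "x - ?w \<in> cball z (2 * r)"
          using xr w(2) r dist_add_le(1)[of x "- ?w" z] by (auto simp: dist_commute)
        have "dist (x - ?w) x < \<delta>" using w(1) by (simp add: dist_norm)
        then have "dist (u (x - ?w)) (u x) < m0 / 2" by (rule uc[OF in2])
        then have "u x / 2 \<le> u (x - ?w)" using m0(2)[OF True] by (auto simp: dist_real_def abs_if split: if_splits)
        then have uu: "u x * (u x / 2) \<le> u x * u (x - ?w)" using pos[of x] by (intro mult_left_mono) auto
        have "(h * c) * (u x * (u x / 2)) \<le> (V x - V (x - ?w)) * (u x * u (x - ?w))"
        proof (rule mult_mono)
          show hc: "h * c \<le> V x - V (x - ?w)" using inc[of x] xr r by simp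
          have "0 \<le> h * c" using h c by simp
          then show "0 \<le> V x - V (x - ?w)" using hc by linarith
          show "0 \<le> u x * (u x / 2)" using pos[of x] by simp
        qed (rule uu)
        moreover have "?\<eta> x = 1" by (rule cutoff_eq_1[OF r xr])
        ultimately show ?thesis using True by (simp add: k_def power2_eq_square)
      next
        case False
        have "0 \<le> k x"
        proof (cases "dist x z \<le> 2 * r")
          case True
          have "0 \<le> V x - V (x - ?w)" using inc[OF True] h c by (meson less_imp_le mult_nonneg_nonneg order_trans)
          then show ?thesis unfolding k_def using cutoff_bounds[of z r x] pos[of x] pos[of "x - ?w"]
            by (intro mult_nonneg_nonneg) auto
        next
          case False
          then have "?\<eta> x = 0" by (intro cutoff_eq_0[OF r]) auto
          then show ?thesis by (simp add: k_def)
        qed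
        then show ?thesis using False by simp
      qed
    qed
    then have A: "h * (c / 2 * (LBINT x. indicator (cball z r) x * (u x)\<^sup>2)) \<le> (LBINT x. k x)"
      by simp
    have "\<bar>LBINT x. (V x * (?\<eta> (x + ?w) - ?\<eta> x)) * (u x \<bullet> u (x + ?w))\<bar>
        \<le> 2 * (M * (L * norm ?w)) * (LBINT x. indicator ?S x * (norm (u x))\<^sup>2)"
    proof (rule integral_shifted_product_bound[OF su])
      fix x
      have "\<bar>V x\<bar> * \<bar>?\<eta> (x + ?w) - ?\<eta> x\<bar> \<le> M * (L * norm ?w * (indicator ?S x * indicator ?S (x + ?w)))"
        by (rule mult_mono[OF M cutoff_difference_bound[OF r L w(2)]]) (use M0 in auto)
      then show "\<bar>V x * (?\<eta> (x + ?w) - ?\<eta> x)\<bar> \<le> M * (L * norm ?w) * (indicator ?S x * indicator ?S (x + ?w))"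
        by (simp add: abs_mult mult.assoc)
    next
      show "0 \<le> M * (L * norm ?w)" using M0 L0 by (intro mult_nonneg_nonneg) auto
    qed measurable
    then have "\<bar>LBINT x. (V x * (?\<eta> (x + ?w) - ?\<eta> x)) * (u x * u (x + ?w))\<bar>
        \<le> h * (2 * (M * L * norm e) * (LBINT x. indicator ?S x * (u x)\<^sup>2))"
      using h by (simp add: mult_ac)
    then show ?thesis using A unfolding eq right_diff_distrib[of h] by linarith
  qed
  then show ?thesis by (rule eventually_mono[OF eventually_small_shift[OF small, of e]])
qed

lemma gradient_term_bound:
  fixes u :: "real^3 \<Rightarrow> real"
  assumes u: "u \<in> H1" and r: "0 < r" and L: "\<And>x. norm (cutoff' z r x) \<le> L"
    and h: "0 < h" and w: "norm (h *\<^sub>R e) \<le> r / 4"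
  shows "\<bar>LBINT x. cutoff z r x * (wgrad u x \<bullet> (wgrad u (x + h *\<^sub>R e) - wgrad u (x - h *\<^sub>R e)))\<bar>
    \<le> 2 * h * (L * norm e) * (LBINT x. indicator (shell z r) x * (norm (wgrad u x))\<^sup>2)"
proof -
  note G = H1_wgrad(2)[OF u]
  have L0: "0 \<le> L" using L[of 0] norm_ge_zero order_trans by blast
  have [measurable]: "cutoff z r \<in> borel_measurable borel"
    by (rule borel_measurable_continuous_onI[OF GDERIV_continuous[OF GDERIV_cutoff]])
  have b: "\<bar>cutoff z r x\<bar> \<le> 1" for x using cutoff_bounds[of z r x] by auto
  have "\<bar>LBINT x. (cutoff z r (x + h *\<^sub>R e) - cutoff z r x) * (wgrad u x \<bullet> wgrad u (x + h *\<^sub>R e))\<bar>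
      \<le> 2 * (L * norm (h *\<^sub>R e)) * (LBINT x. indicator (shell z r) x * (norm (wgrad u x))\<^sup>2)"
    by (rule integral_shifted_product_bound[OF G _ _ _ cutoff_difference_bound[OF r L w]])
      (measurable, use L0 in simp)
  then show ?thesis
    unfolding integral_symmetric_difference[OF G \<open>cutoff z r \<in> borel_measurable borel\<close> b] using h by (simp add: mult_ac)
qed

text \<open>Testing the equation with \<open>\<eta> (u(x + h e) - u(x - h e))\<close> and collecting the bounds for the four terms gives
  the estimate up to an error \<open>\<tau>\<close>, after division by \<open>h\<close>.  The constant comes from the cutoff and the
  bounds on \<open>V\<close> only, which is what allows \<open>u\<close> and \<open>m\<close> to vary with \<open>\<epsilon>\<close>.\<close>
lemma local_pohozaev_estimate:
  fixes V :: "real^3 \<Rightarrow> real"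
  assumes V: "\<And>x. GDERIV V x :> V' x" and M: "\<And>x. \<bar>V x\<bar> \<le> M"
    and c: "0 < c" "\<And>x. dist x z \<le> 3 * r \<Longrightarrow> c \<le> e \<bullet> V' x"
    and r: "0 < r" and p: "0 < p"
  shows "\<exists>C\<ge>0. \<forall>m u. 0 \<le> m \<longrightarrow> positive_solution m V p u \<longrightarrow>
    (LBINT x. indicator (cball z r) x * (u x)\<^sup>2)
      \<le> C * (m * (LBINT x. indicator (shell z r) x * (norm (wgrad u x))\<^sup>2)
        + (LBINT x. indicator (shell z r) x * (u x)\<^sup>2)
        + (LBINT x. indicator (shell z r) x * u x powr (p + 1)))"
proof -
  obtain L where L0: "0 \<le> L" and L: "\<And>x. norm (cutoff' z r x) \<le> L" using cutoff'_bounded[OF r] by blast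
  have M0: "0 \<le> M" using M[of 0] by linarith
  define E where "E = norm e"
  have E0: "0 \<le> E" by (simp add: E_def)
  \<comment> \<open>A common bound for the coefficients of the three shell integrals.\<close>
  define C1 where "C1 = 2 * L * (E\<^sup>2 + 1 + E) * (M + 1)"
  have C1: "0 \<le> C1" unfolding C1_def using L0 E0 M0 by simp
  have C1m: "2 * (L * (E\<^sup>2 + 1)) + 2 * (L * E) \<le> C1" "2 * (M * L * E) \<le> C1" "2 * (L * E) \<le> C1"
  proof -
    have "2 * L * (E\<^sup>2 + 1 + E) * 1 \<le> C1" unfolding C1_def using L0 E0 M0 by (intro mult_left_mono) auto
    then show "2 * (L * (E\<^sup>2 + 1)) + 2 * (L * E) \<le> C1" by (simp add: algebra_simps)
    have "(2 * L) * E * M \<le> C1" unfolding C1_def using L0 E0 M0 by (intro mult_mono) auto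
    then show "2 * (M * L * E) \<le> C1" by (simp add: mult_ac)
    have "(2 * L) * E * 1 \<le> C1" unfolding C1_def using L0 E0 M0 by (intro mult_mono) auto
    then show "2 * (L * E) \<le> C1" by (simp add: mult_ac)
  qed
  show ?thesis
  proof (intro exI[of _ "2 / c * C1"] conjI allI impI)
    show "0 \<le> 2 / c * C1" using c C1 by simp
    fix m u assume m: "0 \<le> m" and sol: "positive_solution m V p u"
    let ?\<eta> = "cutoff z r" and ?G = "wgrad u"
    have u: "u \<in> H1" and cu: "continuous_on UNIV u" and pos: "\<And>x. 0 < u x"
      and weak: "\<And>v. v \<in> H1 \<Longrightarrow> (LBINT x. m * (?G x \<bullet> wgrad v x) + V x * u x * v x)
            = (LBINT x. u x powr p * v x)"
      using sol by (auto simp: positive_solution_def)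
    note su = H1_square_integrable[OF u] and wG = H1_wgrad(1)[OF u] and G = H1_wgrad(2)[OF u]
    have [measurable]: "u \<in> borel_measurable borel" "?G \<in> borel_measurable borel"
      using su G by (auto simp: square_integrable_def)
    have [measurable]: "V \<in> borel_measurable borel"
      by (rule borel_measurable_continuous_onI[OF GDERIV_continuous[OF V]])
    have \<eta>m[measurable]: "?\<eta> \<in> borel_measurable borel"
      by (rule borel_measurable_continuous_onI[OF GDERIV_continuous[OF GDERIV_cutoff]])
    have \<eta>'m[measurable]: "cutoff' z r \<in> borel_measurable borel"
      by (rule borel_measurable_continuous_onI[OF continuous_cutoff'])
    have \<eta>b: "\<bar>?\<eta> x\<bar> \<le> 1" for x using cutoff_bounds[of z r x] by auto
    define I1 where "I1 = (LBINT x. indicator (shell z r) x * (norm (?G x))\<^sup>2)"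
    define I2 where "I2 = (LBINT x. indicator (shell z r) x * (u x)\<^sup>2)"
    define I3 where "I3 = (LBINT x. indicator (shell z r) x * u x powr (p + 1))"
    define B where "B = (LBINT x. indicator (cball z r) x * (u x)\<^sup>2)"
    have I0: "0 \<le> I1" "0 \<le> I2" "0 \<le> I3"
      unfolding I1_def I2_def I3_def by (auto intro!: Bochner_Integration.integral_nonneg)
    have main: "c / 2 * B \<le> C1 * (m * I1 + I2 + I3) + 2 * \<tau>" if \<tau>: "0 < \<tau>" for \<tau>
    proof -
      have "0 < r / 4" using r by simp
      note ev3 = eventually_small_shift[OF this, of e]
      have "\<forall>\<^sub>F h in at_right 0. (0 < h \<and> norm (h *\<^sub>R e) < r / 4) \<and>
        \<bar>LBINT x. u x powr p * (?\<eta> x * (u (x + h *\<^sub>R e) - u (x - h *\<^sub>R e)))\<bar> \<le> 2 * h * (L * norm e * I3 + \<tau>) \<and>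
        h * (c / 2 * B - 2 * (M * L * norm e) * I2)
          \<le> - (LBINT x. (V x * ?\<eta> x) * (u x * (u (x + h *\<^sub>R e) - u (x - h *\<^sub>R e))))"
        unfolding I3_def I2_def B_def
        by (intro eventually_conj ev3 nonlinear_term_bound[OF u cu pos p r L \<tau>]
            potential_term_bound[OF V M c u cu pos r L])
      then obtain h where h: "norm (h *\<^sub>R e) \<le> r / 4" "0 < h" and
        N: "\<bar>LBINT x. u x powr p * (?\<eta> x * (u (x + h *\<^sub>R e) - u (x - h *\<^sub>R e)))\<bar> \<le> 2 * h * (L * norm e * I3 + \<tau>)" and
        P: "h * (c / 2 * B - 2 * (M * L * norm e) * I2)
          \<le> - (LBINT x. (V x * ?\<eta> x) * (u x * (u (x + h *\<^sub>R e) - u (x - h *\<^sub>R e))))"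
        using eventually_happens'[OF trivial_limit_at_right_real] less_imp_le by blast
      let ?w = "h *\<^sub>R e"
      let ?d = "\<lambda>x. u (x + ?w) - u (x - ?w)" and ?dG = "\<lambda>x. ?G (x + ?w) - ?G (x - ?w)"
      have dH: "?d \<in> H1"
        using H1_add[OF H1_affine[OF u, of 1 ?w] H1_cmult[OF H1_affine[OF u, of 1 "- ?w"], of "-1"]]
        by (simp add: add.commute)
      have dG: "weak_gradient ?d ?dG"
        using weak_gradient_add[OF weak_gradient_affine[OF wG, of 1 ?w]
            weak_gradient_cmult[OF weak_gradient_affine[OF wG, of 1 "- ?w"], of "-1"]]
        by (simp add: add.commute)
      note sd = H1_square_integrable[OF dH]
      have sdG: "square_integrable ?dG" by (rule square_integrable_symmetric_difference[OF G])
      have vH: "(\<lambda>x. ?\<eta> x * ?d x) \<in> H1" by (rule H1_mult[OF dH test_function_cutoff[OF r]])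
      have "weak_gradient (\<lambda>x. ?\<eta> x * ?d x) (\<lambda>x. ?d x *\<^sub>R cutoff' z r x + ?\<eta> x *\<^sub>R ?dG x)"
        by (rule weak_gradient_mult[OF dG GDERIV_cutoff continuous_cutoff'])
      note vG = wgrad_AE[OF this]
      have i1: "integrable lborel (\<lambda>x. ?d x * (?G x \<bullet> cutoff' z r x))"
      proof -
        have "square_integrable (\<lambda>x. ?d x *\<^sub>R cutoff' z r x)"
        proof (rule square_integrable_dominated[OF sd, of _ L])
          show "norm (?d x *\<^sub>R cutoff' z r x) \<le> L * norm (?d x)" for x
            using mult_left_mono[OF L[of x], of "\<bar>?d x\<bar>"] by (simp add: mult.commute)
        qed measurable
        from square_integrable_inner[OF G this] show ?thesis by simp
      qed
      have i2: "integrable lborel (\<lambda>x. ?\<eta> x * (?G x \<bullet> ?dG x))"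
        using square_integrable_inner[OF square_integrable_bounded_mult[OF G \<eta>m \<eta>b] sdG] by simp
      have i3: "integrable lborel (\<lambda>x. (V x * ?\<eta> x) * (u x * ?d x))"
      proof -
        have "\<bar>V x * ?\<eta> x\<bar> \<le> M" for x using mult_mono[OF M[of x] \<eta>b[of x]] M0 by (simp add: abs_mult)
        then have "square_integrable (\<lambda>x. (V x * ?\<eta> x) *\<^sub>R u x)"
          by (intro square_integrable_bounded_mult[OF su]) measurable
        from square_integrable_prod[OF this sd] show ?thesis by (simp add: mult_ac)
      qed
      have [measurable]: "wgrad (\<lambda>x. ?\<eta> x * ?d x) \<in> borel_measurable borel"
        using H1_wgrad(2)[OF vH] by (simp add: square_integrable_def)
      have "(LBINT x. u x powr p * (?\<eta> x * ?d x))
          = (LBINT x. m * (?G x \<bullet> wgrad (\<lambda>x. ?\<eta> x * ?d x) x) + V x * u x * (?\<eta> x * ?d x))"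
        by (rule weak[OF vH, symmetric])
      also have "\<dots> = (LBINT x. (m * (?d x * (?G x \<bullet> cutoff' z r x)) + m * (?\<eta> x * (?G x \<bullet> ?dG x)))
            + (V x * ?\<eta> x) * (u x * ?d x))"
      proof (rule integral_cong_AE)
        show "AE x in lborel. m * (?G x \<bullet> wgrad (\<lambda>x. ?\<eta> x * ?d x) x) + V x * u x * (?\<eta> x * ?d x)
          = (m * (?d x * (?G x \<bullet> cutoff' z r x)) + m * (?\<eta> x * (?G x \<bullet> ?dG x))) + (V x * ?\<eta> x) * (u x * ?d x)"
          using vG
        proof eventually_elim
          case (elim x) show ?case unfolding elim inner_add_right inner_scaleR_right by (simp add: algebra_simps)
        qed
      qed measurable
      also have "\<dots> = m * (LBINT x. ?d x * (?G x \<bullet> cutoff' z r x)) + m * (LBINT x. ?\<eta> x * (?G x \<bullet> ?dG x))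
            + (LBINT x. (V x * ?\<eta> x) * (u x * ?d x))"
        using Bochner_Integration.integral_add[OF Bochner_Integration.integrable_add[OF integrable_mult_right[OF i1, of m] integrable_mult_right[OF i2, of m]] i3]
          Bochner_Integration.integral_add[OF integrable_mult_right[OF i1, of m] integrable_mult_right[OF i2, of m]]
        by (simp only: integral_mult_right_zero)
      finally have W: "(LBINT x. u x powr p * (?\<eta> x * ?d x))
          = m * (LBINT x. ?d x * (?G x \<bullet> cutoff' z r x)) + m * (LBINT x. ?\<eta> x * (?G x \<bullet> ?dG x))
            + (LBINT x. (V x * ?\<eta> x) * (u x * ?d x))" .
      have D1: "m * (LBINT x. ?d x * (?G x \<bullet> cutoff' z r x)) \<le> m * (2 * h * (L * (E\<^sup>2 + 1)) * I1)"
        using drift_term_bound[OF u r L h(2,1)] by (intro mult_left_mono[OF _ m]) (simp add: I1_def E_def)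
      have D2: "m * (LBINT x. ?\<eta> x * (?G x \<bullet> ?dG x)) \<le> m * (2 * h * (L * E) * I1)"
        using gradient_term_bound[OF u r L h(2,1)] by (intro mult_left_mono[OF _ m]) (simp add: I1_def E_def)
      have "h * (c / 2 * B - 2 * (M * L * E) * I2)
          \<le> m * (2 * h * (L * (E\<^sup>2 + 1)) * I1) + m * (2 * h * (L * E) * I1) + 2 * h * (L * E * I3 + \<tau>)"
        using P N W D1 D2 unfolding E_def[symmetric] by linarith
      also have "\<dots> = h * ((2 * (L * (E\<^sup>2 + 1)) + 2 * (L * E)) * (m * I1) + (2 * (L * E)) * I3 + 2 * \<tau>)"
        by (simp add: algebra_simps)
      finally have "c / 2 * B - 2 * (M * L * E) * I2
          \<le> (2 * (L * (E\<^sup>2 + 1)) + 2 * (L * E)) * (m * I1) + (2 * (L * E)) * I3 + 2 * \<tau>"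
        using h(2) by (simp only: mult_le_cancel_left_pos)
      moreover have "(2 * (L * (E\<^sup>2 + 1)) + 2 * (L * E)) * (m * I1) \<le> C1 * (m * I1)"
        by (rule mult_right_mono[OF C1m(1)]) (use m I0 in simp)
      moreover have "2 * (M * L * E) * I2 \<le> C1 * I2" by (rule mult_right_mono[OF C1m(2) I0(2)])
      moreover have "(2 * (L * E)) * I3 \<le> C1 * I3" by (rule mult_right_mono[OF C1m(3) I0(3)])
      ultimately show ?thesis unfolding distrib_left by linarith
    qed
    have "c / 2 * B \<le> C1 * (m * I1 + I2 + I3)"
    proof (rule field_le_epsilon)
      fix \<tau> :: real assume "0 < \<tau>"
      then show "c / 2 * B \<le> C1 * (m * I1 + I2 + I3) + \<tau>" using main[of "\<tau> / 2"] by simp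
    qed
    then have "B \<le> 2 / c * C1 * (m * I1 + I2 + I3)" using c by (simp add: field_simps)
    then show "(LBINT x. indicator (cball z r) x * (u x)\<^sup>2)
      \<le> 2 / c * C1 * (m * (LBINT x. indicator (shell z r) x * (norm (wgrad u x))\<^sup>2)
        + (LBINT x. indicator (shell z r) x * (u x)\<^sup>2)
        + (LBINT x. indicator (shell z r) x * u x powr (p + 1)))"
      by (simp add: B_def I1_def I2_def I3_def)
  qed
qed

section \<open>Energy of rescaled profiles\<close>

lemma integral_tail_small:
  fixes f :: "'a::euclidean_space \<Rightarrow> real"
  assumes f: "integrable lborel f" and \<tau>: "0 < \<tau>"
  shows "\<exists>R>0. (LBINT z. indicator {z. R \<le> norm z} z * f z) < \<tau>"
proof -
  have [measurable]: "f \<in> borel_measurable borel" using f by simp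
  have "(\<lambda>n. LBINT z. indicator {z. real n \<le> norm z} z * f z) \<longlonglongrightarrow> (LINT z::'a|lborel. 0 :: real)"
  proof (rule integral_dominated_convergence)
    show "integrable lborel (\<lambda>z. norm (f z))" using f by (rule integrable_norm)
    show "AE z in lborel. norm (indicator {z. real n \<le> norm z} z * f z) \<le> norm (f z)" for n
      by (rule AE_I2) (auto simp: indicator_def)
    show "AE z in lborel. (\<lambda>n. indicator {z. real n \<le> norm z} z * f z) \<longlonglongrightarrow> 0"
    proof (rule AE_I2)
      fix z :: 'a
      obtain N :: nat where "norm z < real N" using reals_Archimedean2 by blast
      then have "\<forall>\<^sub>F n in sequentially. indicator {z. real n \<le> norm z} z * f z = 0"
        by (intro eventually_sequentiallyI[of N]) auto
      then show "(\<lambda>n. indicator {z. real n \<le> norm z} z * f z) \<longlonglongrightarrow> 0" by (rule tendsto_eventually)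
    qed
  qed measurable
  then have "\<forall>\<^sub>F n in sequentially. (LBINT z. indicator {z. real n \<le> norm z} z * f z) < \<tau>"
    using \<tau> by (intro order_tendstoD(2)) auto
  then obtain N where N: "\<And>n. N \<le> n \<Longrightarrow> (LBINT z. indicator {z. real n \<le> norm z} z * f z) < \<tau>"
    unfolding eventually_sequentially by blast
  show ?thesis by (rule exI[of _ "real (Suc N)"]) (use N[of "Suc N"] in auto)
qed

lemma weak_gradient_zero: "weak_gradient (\<lambda>x. 0) (\<lambda>x. 0)"
  unfolding weak_gradient_alt locally_integrable_def set_integrable_def by auto

lemma H1_zero: "(\<lambda>x. 0) \<in> H1"
  by (rule H1I[OF _ weak_gradient_zero]) (auto simp: square_integrable_def)

lemma H1_sum:
  assumes "finite J" and "\<And>j. j \<in> J \<Longrightarrow> f j \<in> H1"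
  shows "(\<lambda>x. \<Sum>j\<in>J. f j x) \<in> H1"
  using assms by (induction J rule: finite_induct) (simp_all add: H1_zero H1_add)

lemma weak_gradient_sum:
  assumes "finite J" and "\<And>j. j \<in> J \<Longrightarrow> weak_gradient (f j) (g j)"
  shows "weak_gradient (\<lambda>x. \<Sum>j\<in>J. f j x) (\<lambda>x. \<Sum>j\<in>J. g j x)"
  using assms by (induction J rule: finite_induct) (simp_all add: weak_gradient_zero weak_gradient_add)

lemma norm_sum_square_le:
  fixes f :: "'i \<Rightarrow> 'b::real_normed_vector"
  shows "(norm (\<Sum>j\<in>J. f j))\<^sup>2 \<le> real (card J) * (\<Sum>j\<in>J. (norm (f j))\<^sup>2)"
proof -
  have "(norm (\<Sum>j\<in>J. f j))\<^sup>2 \<le> (\<Sum>j\<in>J. norm (f j))\<^sup>2" by (rule power_mono[OF norm_sum]) simp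
  also have "\<dots> \<le> (\<Sum>j\<in>J. (norm (f j))\<^sup>2) * real (card J)" by (rule sum_squared_le_sum_of_squares)
  finally show ?thesis by (simp add: mult.commute)
qed

definition rescaled :: "real \<Rightarrow> real^3 \<Rightarrow> (real^3 \<Rightarrow> real) \<Rightarrow> real^3 \<Rightarrow> real" where
  "rescaled \<epsilon> y w x = w ((x - y) /\<^sub>R \<epsilon>)"

lemma rescale_eq: "(x - y) /\<^sub>R \<epsilon> = - (y /\<^sub>R \<epsilon>) + inverse \<epsilon> *\<^sub>R (x::'a::real_vector)"
  by (simp add: scaleR_diff_right)

lemma rescaled_H1: "w \<in> H1 \<Longrightarrow> 0 < \<epsilon> \<Longrightarrow> rescaled \<epsilon> y w \<in> H1"
  unfolding rescaled_def[abs_def] rescale_eq by (rule H1_affine) auto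

lemma integral_rescale:
  fixes f :: "real^3 \<Rightarrow> real"
  assumes "0 < \<epsilon>" "f \<in> borel_measurable borel"
  shows "(LBINT x. f ((x - y) /\<^sub>R \<epsilon>)) = \<epsilon> ^ 3 * (LBINT x. f x)"
  unfolding rescale_eq using lborel_integral_affine[OF _ assms(2), of "inverse \<epsilon>" "- (y /\<^sub>R \<epsilon>)"] assms(1)
  by (simp add: power_inverse)

lemma integrable_rescale:
  fixes f :: "real^3 \<Rightarrow> real"
  assumes "0 < \<epsilon>" "integrable lborel f"
  shows "integrable lborel (\<lambda>x. f ((x - y) /\<^sub>R \<epsilon>))"
  unfolding rescale_eq using lborel_integrable_affine_iff[of "inverse \<epsilon>" f "- (y /\<^sub>R \<epsilon>)"] assms by auto

lemma wgrad_rescaled: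
  assumes "w \<in> H1" "0 < \<epsilon>"
  shows "AE x in lborel. wgrad (rescaled \<epsilon> y w) x = wgrad w ((x - y) /\<^sub>R \<epsilon>) /\<^sub>R \<epsilon>"
proof -
  have "weak_gradient (rescaled \<epsilon> y w) (\<lambda>x. inverse \<epsilon> *\<^sub>R wgrad w (- (y /\<^sub>R \<epsilon>) + inverse \<epsilon> *\<^sub>R x))"
    unfolding rescaled_def[abs_def] rescale_eq by (rule weak_gradient_affine[OF H1_wgrad(1)[OF assms(1)]]) (use assms in simp)
  from wgrad_AE[OF this] show ?thesis unfolding rescale_eq .
qed

text \<open>The scaling \<open>x \<mapsto> (x - y) / \<epsilon>\<close> turns \<open>\<epsilon>\<^sup>2 \<bar>\<nabla>u\<bar>\<^sup>2 + u\<^sup>2\<close> into this density, up to the volume factor \<open>\<epsilon>\<^sup>3\<close>.\<close>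
definition energy_density :: "(real^3 \<Rightarrow> real) \<Rightarrow> real^3 \<Rightarrow> real" where
  "energy_density w z = (norm (wgrad w z))\<^sup>2 + (w z)\<^sup>2"

lemma integrable_energy_density: "w \<in> H1 \<Longrightarrow> integrable lborel (energy_density w)"
  unfolding energy_density_def[abs_def]
  using H1_square_integrable[of w] H1_wgrad(2)[of w] by (simp add: square_integrable_def)

lemma rescaled_energy_le:
  assumes w: "w \<in> H1" and \<epsilon>: "0 < \<epsilon>" and S[measurable]: "S \<in> sets borel" and T[measurable]: "T \<in> sets borel"
    and ST: "\<And>x. x \<in> S \<Longrightarrow> (x - y) /\<^sub>R \<epsilon> \<in> T"
  shows "(LBINT x. indicator S x * (\<epsilon>\<^sup>2 * (norm (wgrad (rescaled \<epsilon> y w) x))\<^sup>2 + (rescaled \<epsilon> y w x)\<^sup>2))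
    \<le> \<epsilon> ^ 3 * (LBINT z. indicator T z * energy_density w z)" (is "?l \<le> _")
proof -
  note sw = H1_square_integrable[OF w] H1_wgrad(2)[OF w]
  note sr = H1_square_integrable[OF rescaled_H1[OF w \<epsilon>, of y]] H1_wgrad(2)[OF rescaled_H1[OF w \<epsilon>, of y]]
  have [measurable]: "w \<in> borel_measurable borel" "wgrad w \<in> borel_measurable borel"
    "rescaled \<epsilon> y w \<in> borel_measurable borel" "wgrad (rescaled \<epsilon> y w) \<in> borel_measurable borel"
    using sw sr by (auto simp: square_integrable_def)
  have em[measurable]: "energy_density w \<in> borel_measurable borel"
    unfolding energy_density_def[abs_def] by measurable
  have iT: "integrable lborel (\<lambda>z. indicator T z * energy_density w z)"
    using integrable_mult_indicator[of T lborel "energy_density w"] integrable_energy_density[OF w] by simp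
  have iL: "integrable lborel (\<lambda>x. indicator S x * (\<epsilon>\<^sup>2 * (norm (wgrad (rescaled \<epsilon> y w) x))\<^sup>2 + (rescaled \<epsilon> y w x)\<^sup>2))"
    using integrable_mult_indicator[of S lborel "\<lambda>x. \<epsilon>\<^sup>2 * (norm (wgrad (rescaled \<epsilon> y w) x))\<^sup>2 + (rescaled \<epsilon> y w x)\<^sup>2"] sr
    by (simp add: square_integrable_def)
  have "?l \<le> (LBINT x. indicator T ((x - y) /\<^sub>R \<epsilon>) * energy_density w ((x - y) /\<^sub>R \<epsilon>))"
  proof (rule integral_mono_AE[OF iL integrable_rescale[OF \<epsilon> iT]])
    show "AE x in lborel. indicator S x * (\<epsilon>\<^sup>2 * (norm (wgrad (rescaled \<epsilon> y w) x))\<^sup>2 + (rescaled \<epsilon> y w x)\<^sup>2)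
      \<le> indicator T ((x - y) /\<^sub>R \<epsilon>) * energy_density w ((x - y) /\<^sub>R \<epsilon>)"
      using wgrad_rescaled[OF w \<epsilon>, of y]
    proof eventually_elim
      case (elim x)
      have "\<epsilon>\<^sup>2 * (norm (wgrad (rescaled \<epsilon> y w) x))\<^sup>2 + (rescaled \<epsilon> y w x)\<^sup>2 = energy_density w ((x - y) /\<^sub>R \<epsilon>)"
        unfolding elim using \<epsilon> by (simp add: energy_density_def rescaled_def power_mult_distrib power_inverse)
      moreover have "0 \<le> energy_density w ((x - y) /\<^sub>R \<epsilon>)" by (simp add: energy_density_def)
      ultimately show ?case using ST[of x] by (auto simp: indicator_def)
    qed
  qed
  also have "\<dots> = \<epsilon> ^ 3 * (LBINT z. indicator T z * energy_density w z)"
    by (rule integral_rescale[OF \<epsilon>]) measurable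
  finally show ?thesis .
qed

text \<open>The set \<open>T\<close> collects the rescaled positions of \<open>S\<close> relative to all peaks.  In the application it is
  the complement of a large ball, so that the last integral is a small tail.\<close>
lemma energy_away_from_peaks_le:
  assumes J: "finite J" and w: "\<And>j. j \<in> J \<Longrightarrow> w j \<in> H1" and \<epsilon>: "0 < \<epsilon>" and \<phi>: "\<phi> \<in> H1"
    and u: "\<And>x. u x = (\<Sum>j\<in>J. rescaled \<epsilon> (y j) (w j) x) + \<phi> x"
    and S[measurable]: "S \<in> sets borel" and T[measurable]: "T \<in> sets borel"
    and ST: "\<And>x j. x \<in> S \<Longrightarrow> j \<in> J \<Longrightarrow> (x - y j) /\<^sub>R \<epsilon> \<in> T"
  shows "\<epsilon>\<^sup>2 * (LBINT x. indicator S x * (norm (wgrad u x))\<^sup>2) + (LBINT x. indicator S x * (u x)\<^sup>2)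
    \<le> 2 * (\<epsilon>\<^sup>2 * (LBINT x. (norm (wgrad \<phi> x))\<^sup>2) + (LBINT x. (\<phi> x)\<^sup>2))
      + 2 * real (card J) * \<epsilon> ^ 3 * (LBINT z. indicator T z * (\<Sum>j\<in>J. energy_density (w j) z))"
proof -
  let ?W = "\<lambda>j. rescaled \<epsilon> (y j) (w j)"
  have W: "?W j \<in> H1" if "j \<in> J" for j by (rule rescaled_H1[OF w[OF that] \<epsilon>])
  have ueq: "u = (\<lambda>x. (\<Sum>j\<in>J. ?W j x) + \<phi> x)" using u by blast
  have uH: "u \<in> H1" unfolding ueq by (intro H1_add H1_sum J W \<phi>)
  have "weak_gradient u (\<lambda>x. (\<Sum>j\<in>J. wgrad (?W j) x) + wgrad \<phi> x)"
    unfolding ueq by (intro weak_gradient_add weak_gradient_sum J H1_wgrad(1) W \<phi>)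
  note AE_u = wgrad_AE[OF this]
  note su = H1_square_integrable[OF uH] H1_wgrad(2)[OF uH]
  note s\<phi> = H1_square_integrable[OF \<phi>] H1_wgrad(2)[OF \<phi>]
  let ?q = "\<lambda>v x. \<epsilon>\<^sup>2 * (norm (wgrad v x))\<^sup>2 + (v x)\<^sup>2"
  have iq: "integrable lborel (?q v)" if "v \<in> H1" for v
    using H1_square_integrable[OF that] H1_wgrad(2)[OF that] by (simp add: square_integrable_def)
  have iSq: "integrable lborel (\<lambda>x. indicator S x * ?q v x)" if "v \<in> H1" for v
    using integrable_mult_indicator[of S lborel "?q v"] iq[OF that] by simp
  have split: "\<epsilon>\<^sup>2 * (LBINT x. indicator S x * (norm (wgrad u x))\<^sup>2) + (LBINT x. indicator S x * (u x)\<^sup>2)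
      = (LBINT x. indicator S x * ?q u x)"
  proof -
    have "integrable lborel (\<lambda>x. indicator S x * (norm (wgrad u x))\<^sup>2)" "integrable lborel (\<lambda>x. indicator S x * (u x)\<^sup>2)"
      using integrable_indicator_sq[OF su(2) S] integrable_indicator_sq[OF su(1) S] by simp_all
    then have "\<epsilon>\<^sup>2 * (LBINT x. indicator S x * (norm (wgrad u x))\<^sup>2) + (LBINT x. indicator S x * (u x)\<^sup>2)
        = (LBINT x. \<epsilon>\<^sup>2 * (indicator S x * (norm (wgrad u x))\<^sup>2) + indicator S x * (u x)\<^sup>2)" by simp
    then show ?thesis by (simp add: algebra_simps)
  qed
  have "(LBINT x. indicator S x * ?q u x)
      \<le> (LBINT x. 2 * ?q \<phi> x + 2 * real (card J) * (\<Sum>j\<in>J. indicator S x * ?q (?W j) x))"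
  proof (rule integral_mono_AE[OF iSq[OF uH]])
    show "integrable lborel (\<lambda>x. 2 * ?q \<phi> x + 2 * real (card J) * (\<Sum>j\<in>J. indicator S x * ?q (?W j) x))"
      by (intro Bochner_Integration.integrable_add integrable_mult_right Bochner_Integration.integrable_sum iq[OF \<phi>] iSq W)
    show "AE x in lborel. indicator S x * ?q u x \<le> 2 * ?q \<phi> x + 2 * real (card J) * (\<Sum>j\<in>J. indicator S x * ?q (?W j) x)"
      using AE_u
    proof eventually_elim
      case (elim x)
      show ?case
      proof (cases "x \<in> S")
        case False then show ?thesis by simp
      next
        case True
        have "(norm (wgrad u x))\<^sup>2 \<le> 2 * (norm (\<Sum>j\<in>J. wgrad (?W j) x))\<^sup>2 + 2 * (norm (wgrad \<phi> x))\<^sup>2"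
          unfolding elim by (rule norm_add_sq_le)
        also have "\<dots> \<le> 2 * (real (card J) * (\<Sum>j\<in>J. (norm (wgrad (?W j) x))\<^sup>2)) + 2 * (norm (wgrad \<phi> x))\<^sup>2"
          using norm_sum_square_le[of "\<lambda>j. wgrad (?W j) x" J] by simp
        finally have 1: "\<epsilon>\<^sup>2 * (norm (wgrad u x))\<^sup>2
            \<le> \<epsilon>\<^sup>2 * (2 * (real (card J) * (\<Sum>j\<in>J. (norm (wgrad (?W j) x))\<^sup>2)) + 2 * (norm (wgrad \<phi> x))\<^sup>2)"
          by (rule mult_left_mono) simp
        have "(norm (u x))\<^sup>2 \<le> 2 * (norm (\<Sum>j\<in>J. ?W j x))\<^sup>2 + 2 * (norm (\<phi> x))\<^sup>2"
          unfolding u by (rule norm_add_sq_le)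
        also have "\<dots> \<le> 2 * (real (card J) * (\<Sum>j\<in>J. (norm (?W j x))\<^sup>2)) + 2 * (norm (\<phi> x))\<^sup>2"
          using norm_sum_square_le[of "\<lambda>j. ?W j x" J] by simp
        finally have 2: "(u x)\<^sup>2 \<le> 2 * (real (card J) * (\<Sum>j\<in>J. (?W j x)\<^sup>2)) + 2 * (\<phi> x)\<^sup>2" by simp
        have "?q u x \<le> \<epsilon>\<^sup>2 * (2 * (real (card J) * (\<Sum>j\<in>J. (norm (wgrad (?W j) x))\<^sup>2)) + 2 * (norm (wgrad \<phi> x))\<^sup>2)
            + (2 * (real (card J) * (\<Sum>j\<in>J. (?W j x)\<^sup>2)) + 2 * (\<phi> x)\<^sup>2)"
          by (rule add_mono[OF 1 2])
        also have "\<dots> = 2 * ?q \<phi> x + 2 * real (card J) * (\<Sum>j\<in>J. ?q (?W j) x)"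
          by (simp add: sum.distrib sum_distrib_left[symmetric] algebra_simps)
        finally show ?thesis using True by simp
      qed
    qed
  qed
  also have "\<dots> = (LBINT x. 2 * ?q \<phi> x) + (LBINT x. 2 * real (card J) * (\<Sum>j\<in>J. indicator S x * ?q (?W j) x))"
    by (intro Bochner_Integration.integral_add integrable_mult_right Bochner_Integration.integrable_sum iq[OF \<phi>] iSq W)
  also have "(LBINT x. 2 * ?q \<phi> x) = 2 * (\<epsilon>\<^sup>2 * (LBINT x. (norm (wgrad \<phi> x))\<^sup>2) + (LBINT x. (\<phi> x)\<^sup>2))"
    using s\<phi> by (simp add: square_integrable_def)
  also have "(LBINT x. 2 * real (card J) * (\<Sum>j\<in>J. indicator S x * ?q (?W j) x))
      = 2 * real (card J) * (\<Sum>j\<in>J. LBINT x. indicator S x * ?q (?W j) x)"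
    unfolding integral_mult_right_zero by (subst Bochner_Integration.integral_sum[OF iSq[OF W]]) simp_all
  also have "\<dots> \<le> 2 * real (card J) * (\<Sum>j\<in>J. \<epsilon> ^ 3 * (LBINT z. indicator T z * energy_density (w j) z))"
    by (intro mult_left_mono sum_mono rescaled_energy_le w \<epsilon> S T ST) auto
  also have "(\<Sum>j\<in>J. \<epsilon> ^ 3 * (LBINT z. indicator T z * energy_density (w j) z))
      = \<epsilon> ^ 3 * (LBINT z. indicator T z * (\<Sum>j\<in>J. energy_density (w j) z))"
  proof -
    have iT: "integrable lborel (\<lambda>z. indicator T z * energy_density (w j) z)" if "j \<in> J" for j
      using integrable_mult_indicator[of T lborel "energy_density (w j)"] integrable_energy_density[OF w[OF that]] by simp
    have "(\<Sum>j\<in>J. LBINT z. indicator T z * energy_density (w j) z)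
        = (LBINT z. (\<Sum>j\<in>J. indicator T z * energy_density (w j) z))"
      by (rule Bochner_Integration.integral_sum[OF iT, symmetric])
    also have "\<dots> = (LBINT z. indicator T z * (\<Sum>j\<in>J. energy_density (w j) z))"
      by (simp only: sum_distrib_left)
    finally show ?thesis unfolding sum_distrib_left[of "\<epsilon> ^ 3", symmetric] by simp
  qed
  finally show ?thesis unfolding split by (simp add: mult.assoc)
qed

lemma eps_norm_lower_bound:
  assumes v: "v \<in> H1" and Vc: "continuous_on UNIV V" and M: "\<And>x. \<bar>V x\<bar> \<le> M" and V0: "\<And>x. V0 \<le> V x"
    and \<kappa>: "\<kappa> \<le> a" "\<kappa> \<le> V0" "0 < \<kappa>"
  shows "\<kappa> * (\<epsilon>\<^sup>2 * (LBINT x. (norm (wgrad v x))\<^sup>2) + (LBINT x. (v x)\<^sup>2)) \<le> (eps_norm a V \<epsilon> v)\<^sup>2"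
proof -
  note s = H1_square_integrable[OF v] H1_wgrad(2)[OF v]
  have Vm: "V \<in> borel_measurable borel" by (rule borel_measurable_continuous_onI[OF Vc])
  have iV: "integrable lborel (\<lambda>x. V x * (v x)\<^sup>2)"
    using square_integrable_prod[OF square_integrable_bounded_mult[OF s(1) Vm M] s(1)]
    by (simp add: power2_eq_square mult.assoc)
  have i: "integrable lborel (\<lambda>x. (norm (wgrad v x))\<^sup>2)" "integrable lborel (\<lambda>x. (v x)\<^sup>2)"
    using s by (simp_all add: square_integrable_def)
  have "\<kappa> * (\<epsilon>\<^sup>2 * (LBINT x. (norm (wgrad v x))\<^sup>2) + (LBINT x. (v x)\<^sup>2))
      = (LBINT x. \<kappa> * (\<epsilon>\<^sup>2 * (norm (wgrad v x))\<^sup>2 + (v x)\<^sup>2))"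
    using i by simp
  also have "\<dots> \<le> (LBINT x. \<epsilon>\<^sup>2 * a * (norm (wgrad v x))\<^sup>2 + V x * (v x)\<^sup>2)"
  proof (rule integral_mono)
    fix x
    have "\<kappa> * (\<epsilon>\<^sup>2 * (norm (wgrad v x))\<^sup>2) \<le> a * (\<epsilon>\<^sup>2 * (norm (wgrad v x))\<^sup>2)"
      by (rule mult_right_mono[OF \<kappa>(1)]) simp
    moreover have "\<kappa> * (v x)\<^sup>2 \<le> V x * (v x)\<^sup>2"
      by (rule mult_right_mono) (use \<kappa>(2) V0[of x] in auto)
    ultimately show "\<kappa> * (\<epsilon>\<^sup>2 * (norm (wgrad v x))\<^sup>2 + (v x)\<^sup>2) \<le> \<epsilon>\<^sup>2 * a * (norm (wgrad v x))\<^sup>2 + V x * (v x)\<^sup>2"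
      by (simp add: distrib_left mult_ac)
  next
    show "integrable lborel (\<lambda>x. \<kappa> * (\<epsilon>\<^sup>2 * (norm (wgrad v x))\<^sup>2 + (v x)\<^sup>2))"
      by (intro integrable_mult_right Bochner_Integration.integrable_add i)
    show "integrable lborel (\<lambda>x. \<epsilon>\<^sup>2 * a * (norm (wgrad v x))\<^sup>2 + V x * (v x)\<^sup>2)"
      by (intro integrable_mult_right Bochner_Integration.integrable_add i iV)
  qed
  also have "\<dots> = (eps_norm a V \<epsilon> v)\<^sup>2"
  proof -
    have "0 \<le> (LBINT x. \<epsilon>\<^sup>2 * a * (norm (wgrad v x))\<^sup>2 + V x * (v x)\<^sup>2)"
    proof (rule Bochner_Integration.integral_nonneg)
      fix x show "0 \<le> \<epsilon>\<^sup>2 * a * (norm (wgrad v x))\<^sup>2 + V x * (v x)\<^sup>2"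
        using \<kappa> V0[of x] by (intro add_nonneg_nonneg mult_nonneg_nonneg) auto
    qed
    then show ?thesis unfolding eps_norm_def by simp
  qed
  finally show ?thesis .
qed

lemma norm_rescale: "0 < \<epsilon> \<Longrightarrow> norm ((x - y) /\<^sub>R \<epsilon>) = norm (x - y) / \<epsilon>"
  unfolding norm_scaleR by (simp add: divide_inverse mult.commute)

text \<open>All profiles are positive, so \<open>u - \<phi>\<close> dominates each single one; the other peaks can only add mass.\<close>
lemma peak_mass_lower_bound:
  assumes J: "finite J" "i \<in> J" and w: "\<And>j. j \<in> J \<Longrightarrow> w j \<in> H1" and wpos: "\<And>j x. j \<in> J \<Longrightarrow> 0 < w j x"
    and \<epsilon>: "0 < \<epsilon>" and \<phi>: "\<phi> \<in> H1" and uH: "u \<in> H1"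
    and u: "\<And>x. u x = (\<Sum>j\<in>J. rescaled \<epsilon> (y j) (w j) x) + \<phi> x"
    and S[measurable]: "S \<in> sets borel" and BS: "cball (y i) \<epsilon> \<subseteq> S"
  shows "\<epsilon> ^ 3 * (LBINT z. indicator (cball 0 1) z * (w i z)\<^sup>2)
    \<le> 2 * (LBINT x. indicator S x * (u x)\<^sup>2) + 2 * (LBINT x. (\<phi> x)\<^sup>2)"
proof -
  let ?W = "rescaled \<epsilon> (y i) (w i)" and ?B = "cball (0 :: real^3) 1"
  note wi = w[OF J(2)]
  have [measurable]: "w i \<in> borel_measurable borel"
    using H1_square_integrable[OF wi] by (simp add: square_integrable_def)
  note sW = H1_square_integrable[OF rescaled_H1[OF wi \<epsilon>, of "y i"]]
  have iu: "integrable lborel (\<lambda>x. indicator S x * (u x)\<^sup>2)"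
    using integrable_indicator_sq[OF H1_square_integrable[OF uH] S] by simp
  have i\<phi>: "integrable lborel (\<lambda>x. (\<phi> x)\<^sup>2)"
    using H1_square_integrable[OF \<phi>] by (simp add: square_integrable_def)
  have iB: "integrable lborel (\<lambda>z. indicator ?B z * (w i z)\<^sup>2)"
    using integrable_indicator_sq[OF H1_square_integrable[OF wi], of ?B] by simp
  have "\<epsilon> ^ 3 * (LBINT z. indicator ?B z * (w i z)\<^sup>2)
      = (LBINT x. indicator ?B ((x - y i) /\<^sub>R \<epsilon>) * (w i ((x - y i) /\<^sub>R \<epsilon>))\<^sup>2)"
    using integral_rescale[OF \<epsilon>, of "\<lambda>z. indicator ?B z * (w i z)\<^sup>2" "y i"] borel_measurable_integrable[OF iB] by simp
  also have "\<dots> \<le> (LBINT x. 2 * (indicator S x * (u x)\<^sup>2) + 2 * (\<phi> x)\<^sup>2)"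
  proof (rule integral_mono[OF integrable_rescale[OF \<epsilon> iB]])
    show "integrable lborel (\<lambda>x. 2 * (indicator S x * (u x)\<^sup>2) + 2 * (\<phi> x)\<^sup>2)"
      by (intro Bochner_Integration.integrable_add integrable_mult_right iu i\<phi>)
    fix x
    show "indicator ?B ((x - y i) /\<^sub>R \<epsilon>) * (w i ((x - y i) /\<^sub>R \<epsilon>))\<^sup>2 \<le> 2 * (indicator S x * (u x)\<^sup>2) + 2 * (\<phi> x)\<^sup>2"
    proof (cases "(x - y i) /\<^sub>R \<epsilon> \<in> ?B")
      case False then show ?thesis by simp
    next
      case True
      then have "norm (x - y i) \<le> \<epsilon>" using \<epsilon> unfolding mem_cball_0 norm_rescale[OF \<epsilon>] by (simp add: field_simps)
      then have xS: "x \<in> S" using BS by (auto simp: dist_norm norm_minus_commute)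
      have "?W x \<le> (\<Sum>j\<in>J. rescaled \<epsilon> (y j) (w j) x)"
        using J wpos by (intro member_le_sum) (auto simp: rescaled_def less_imp_le)
      then have "?W x \<le> u x - \<phi> x" unfolding u by simp
      moreover have "0 < ?W x" using wpos[OF J(2)] by (simp add: rescaled_def)
      ultimately have "(?W x)\<^sup>2 \<le> (u x - \<phi> x)\<^sup>2" by (intro power_mono) auto
      also have "\<dots> \<le> 2 * (u x)\<^sup>2 + 2 * (\<phi> x)\<^sup>2" using norm_add_sq_le[of "u x" "- \<phi> x"] by simp
      finally show ?thesis using True xS by (simp add: rescaled_def)
    qed
  qed
  also have "\<dots> = 2 * (LBINT x. indicator S x * (u x)\<^sup>2) + 2 * (LBINT x. (\<phi> x)\<^sup>2)"
    using iu i\<phi> by simp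
  finally show ?thesis .
qed

lemma positive_mass_on_ball:
  assumes w: "w \<in> H1" and pos: "\<And>x. 0 < w x"
  shows "0 < (LBINT z. indicator (cball 0 1) z * (w z)\<^sup>2)"
proof (rule ccontr)
  assume "\<not> ?thesis"
  moreover have i: "integrable lborel (\<lambda>z. indicator (cball 0 1) z * (w z)\<^sup>2)"
    using integrable_indicator_sq[OF H1_square_integrable[OF w], of "cball 0 1"] by simp
  moreover have "0 \<le> (LBINT z. indicator (cball 0 1) z * (w z)\<^sup>2)"
    by (rule Bochner_Integration.integral_nonneg) simp
  ultimately have "(LBINT z. indicator (cball 0 1) z * (w z)\<^sup>2) = 0" by linarith
  then have "AE z in lborel. indicator (cball 0 1) z * (w z)\<^sup>2 = 0"
    by (subst (asm) integral_nonneg_eq_0_iff_AE[OF i]) auto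
  then have "AE z in lborel. z \<notin> ball (0::real^3) 1"
  proof eventually_elim
    case (elim z) then show ?case using pos[of z] by (auto simp: indicator_def split: if_splits)
  qed
  then have "emeasure lborel (ball (0::real^3) 1) = 0"
    by (subst (asm) AE_iff_measurable[of "ball 0 1"]) auto
  then show False using content_ball_pos[of 1 "0::real^3"] by (simp add: measure_def)
qed

section \<open>Peaks concentrate at critical points\<close>

theorem lemma2p6:
  fixes a b p :: real and k :: nat
    and V :: "real^3 \<Rightarrow> real"
    and \<xi> :: "nat \<Rightarrow> real^3"
    and y :: "real \<Rightarrow> nat \<Rightarrow> real^3"
    and u \<phi> :: "real \<Rightarrow> real^3 \<Rightarrow> real"
    and w :: "nat \<Rightarrow> real^3 \<Rightarrow> real"
  assumes "a > 0" and "b > 0" and "1 < p" and "p < 5" and "k \<ge> 2"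
    and "bounded (range V)" and "0 < (INF x. V x)" and "C1 V"
    and "inj_on \<xi> {1..k}"
    and "k_peak_solution a b p V k u y \<xi>"
    and "limit_system_solution a b p V k \<xi> w"
    and "\<And>w'. limit_system_solution a b p V k \<xi> w' \<Longrightarrow> \<forall>i\<in>{1..k}. w' i = w i"
    and "\<forall>\<^sub>F \<epsilon> in at_right 0. \<forall>x.
           u \<epsilon> x = (\<Sum>i=1..k. w i ((x - y \<epsilon> i) /\<^sub>R \<epsilon>)) + \<phi> \<epsilon> x"
    and "(\<lambda>\<epsilon>. eps_norm a V \<epsilon> (\<phi> \<epsilon>)) \<in> o[at_right 0](\<lambda>\<epsilon>. \<epsilon> powr (3/2))"
  shows "\<forall>i\<in>{1..k}. GDERIV V (\<xi> i) :> 0"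
proof
  fix i assume i: "i \<in> {1..k}"
  let ?J = "{1..k}"
  obtain V' where V: "\<And>x. GDERIV V x :> V' x" and V'c: "continuous_on UNIV V'"
    using \<open>C1 V\<close> by (auto simp: C1_def)
  have Vc: "continuous_on UNIV V" by (rule GDERIV_continuous[OF V])
  obtain M where M: "\<And>x. \<bar>V x\<bar> \<le> M" using \<open>bounded (range V)\<close> by (auto simp: bounded_iff)
  define V0 where "V0 = (INF x. V x)"
  have V0: "0 < V0" "V0 \<le> V x" for x
    using \<open>0 < (INF x. V x)\<close> cINF_lower[OF bounded_imp_bdd_below[OF \<open>bounded (range V)\<close>], of x]
    by (auto simp: V0_def)
  have w: "w j \<in> H1" and wpos: "0 < w j x" if "j \<in> ?J" for j x
    using \<open>limit_system_solution a b p V k \<xi> w\<close> that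
    by (auto simp: limit_system_solution_def positive_solution_def)
  have "V' (\<xi> i) = 0"
  proof (rule ccontr)
    define e where "e = V' (\<xi> i)"
    assume "V' (\<xi> i) \<noteq> 0"
    then have e: "0 < (norm e)\<^sup>2" by (simp add: e_def)
    define c where "c = (norm e)\<^sup>2 / 2"
    have c: "0 < c" using e by (simp add: c_def)
    have "continuous_on UNIV (\<lambda>x. e \<bullet> V' x)" by (intro continuous_intros V'c)
    then have "isCont (\<lambda>x. e \<bullet> V' x) (\<xi> i)" by (simp add: continuous_on_eq_continuous_at)
    then have "((\<lambda>x. e \<bullet> V' x) \<longlongrightarrow> e \<bullet> V' (\<xi> i)) (at (\<xi> i))" by (simp add: isCont_def)
    moreover have "c < e \<bullet> V' (\<xi> i)" using e by (simp add: c_def e_def[symmetric] power2_norm_eq_inner)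
    ultimately have "\<forall>\<^sub>F x in at (\<xi> i). c < e \<bullet> V' x" by (rule order_tendstoD(1))
    then obtain \<rho> where \<rho>: "0 < \<rho>" "\<And>x. x \<noteq> \<xi> i \<Longrightarrow> dist x (\<xi> i) < \<rho> \<Longrightarrow> c < e \<bullet> V' x"
      unfolding eventually_at by auto
    have \<rho>': "c \<le> e \<bullet> V' x" if "dist x (\<xi> i) < \<rho>" for x
      using \<rho>(2)[of x] that \<open>c < e \<bullet> V' (\<xi> i)\<close> by (cases "x = \<xi> i") auto
    \<comment> \<open>The shell of radius \<open>r\<close> below avoids the points \<open>\<xi> j\<close> because
      \<open>4 * r \<le> D\<close>, and \<open>V\<close> increases in direction \<open>e\<close> on the ball of radius \<open>3 * r\<close>.\<close>
    define D where "D = Min (insert 1 ((\<lambda>j. dist (\<xi> j) (\<xi> i)) ` (?J - {i})))"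
    have dpos: "0 < dist (\<xi> j) (\<xi> i)" if "j \<in> ?J - {i}" for j
      using inj_onD[OF \<open>inj_on \<xi> ?J\<close> _ _ i, of j] that by auto
    have "\<forall>d \<in> insert 1 ((\<lambda>j. dist (\<xi> j) (\<xi> i)) ` (?J - {i})). 0 < d"
      using dpos by (auto simp only: ball_simps zero_less_one)
    then have D0: "0 < D" unfolding D_def by (subst Min_gr_iff) simp_all
    have Dle: "D \<le> dist (\<xi> j) (\<xi> i)" if "j \<in> ?J" "j \<noteq> i" for j
      unfolding D_def using that by (intro Min_le) auto
    define r where "r = min (\<rho> / 4) (D / 4)"
    have r: "0 < r" "3 * r < \<rho>" "4 * r \<le> D" using \<rho>(1) D0 by (auto simp: r_def)
    define S where "S = shell (\<xi> i) r"
    have Sm[measurable]: "S \<in> sets borel" by (simp add: S_def)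
    have cV: "c \<le> e \<bullet> V' x" if "dist x (\<xi> i) \<le> 3 * r" for x using \<rho>'[of x] that r by linarith
    have Sfar: "r / 2 \<le> dist x (\<xi> j)" if "x \<in> S" "j \<in> ?J" for x j
    proof (cases "j = i")
      case True then show ?thesis using that by (simp add: S_def shell_def)
    next
      case False
      from Dle[OF that(2) this] r that(1) dist_triangle[of "\<xi> j" "\<xi> i" x] show ?thesis
        by (simp add: S_def shell_def dist_commute)
    qed
    obtain C where C0: "0 \<le> C" and C: "\<And>m v. 0 \<le> m \<Longrightarrow> positive_solution m V p v \<Longrightarrow>
      (LBINT x. indicator (cball (\<xi> i) r) x * (v x)\<^sup>2)
        \<le> C * (m * (LBINT x. indicator S x * (norm (wgrad v x))\<^sup>2)
          + (LBINT x. indicator S x * (v x)\<^sup>2)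
          + (LBINT x. indicator S x * v x powr (p + 1)))"
      using local_pohozaev_estimate[of V V' M c "\<xi> i" r e p, OF V M c cV r(1)] \<open>1 < p\<close> unfolding S_def by auto
    define c0 where "c0 = (LBINT z. indicator (cball 0 1) z * (w i z)\<^sup>2)"
    have c0: "0 < c0" unfolding c0_def by (rule positive_mass_on_ball[OF w[OF i] wpos[OF i]])
    note peak = \<open>k_peak_solution a b p V k u y \<xi>\<close>[unfolded k_peak_solution_def]
    from peak obtain C2 where C2: "0 < C2" "\<forall>\<^sub>F \<epsilon> in at_right 0.
        (LBINT x. \<epsilon>\<^sup>2 * a * (norm (wgrad (u \<epsilon>) x))\<^sup>2 + (u \<epsilon> x)\<^sup>2) \<le> C2 * \<epsilon> ^ 3" by blast
    from peak have "\<exists>R>1. \<forall>\<^sub>F \<epsilon> in at_right 0.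
        \<forall>x. x \<notin> (\<Union>j\<in>{1..k}. ball (y \<epsilon> j) (R * \<epsilon>)) \<longrightarrow> \<bar>u \<epsilon> x\<bar> \<le> 1"
      using zero_less_one by blast
    then obtain R where R: "1 < R" "\<forall>\<^sub>F \<epsilon> in at_right 0.
        \<forall>x. x \<notin> (\<Union>j\<in>{1..k}. ball (y \<epsilon> j) (R * \<epsilon>)) \<longrightarrow> \<bar>u \<epsilon> x\<bar> \<le> 1" by blast
    from peak have sol: "\<forall>\<^sub>F \<epsilon> in at_right 0. kirchhoff_solution a b p V \<epsilon> (u \<epsilon>)" by blast
    have yev: "\<forall>\<^sub>F \<epsilon> in at_right 0. \<forall>j\<in>?J. dist (y \<epsilon> j) (\<xi> j) < r / 4"
    proof (rule eventually_ball_finite)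
      from peak have lim: "((\<lambda>\<epsilon>. y \<epsilon> j) \<longlongrightarrow> \<xi> j) (at_right 0)" if "j \<in> ?J" for j using that by blast
      have "0 < r / 4" using r(1) by simp
      then show "\<forall>j\<in>?J. \<forall>\<^sub>F \<epsilon> in at_right 0. dist (y \<epsilon> j) (\<xi> j) < r / 4"
        by (intro ballI tendstoD[OF lim])
    qed simp
    define \<kappa> where "\<kappa> = min a V0"
    have \<kappa>: "0 < \<kappa>" "\<kappa> \<le> a" "\<kappa> \<le> V0" using \<open>a > 0\<close> V0(1) by (auto simp: \<kappa>_def)
    \<comment> \<open>Twice the Pohozaev constant times the factor in \<open>m * I1 + I2 + I3 \<le> (\<dots>) * (\<epsilon>\<^sup>2 * I1 + I2)\<close> below:
      \<open>m\<close> is at most \<open>(a + b * (C2 / a)) * \<epsilon>\<^sup>2\<close>, and \<open>I3 \<le> I2\<close> accounts for the 2.\<close>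
    define A where "A = 2 * C * (a + b * (C2 / a) + 2)"
    have A0: "0 \<le> A" unfolding A_def using C0 C2(1) \<open>a > 0\<close> \<open>b > 0\<close> by simp
    \<comment> \<open>The final inequality reads \<open>c0 \<le> (A * (2 + 2 * real k) + 2) * \<sigma>\<close>; this \<open>\<sigma>\<close> violates it.\<close>
    define \<sigma> where "\<sigma> = c0 / (2 * (A * (2 + 2 * real k) + 2))"
    have den: "0 < A * (2 + 2 * real k) + 2" using A0 by (intro add_nonneg_pos) auto
    have \<sigma>: "0 < \<sigma>" unfolding \<sigma>_def using c0 den by (intro divide_pos_pos) auto
    have \<sigma>c: "(A * (2 + 2 * real k) + 2) * \<sigma> < c0"
    proof -
      have "(A * (2 + 2 * real k) + 2) * \<sigma> = c0 / 2" unfolding \<sigma>_def using den by (simp add: field_simps)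
      then show ?thesis using c0 by simp
    qed
    define F where "F z = (\<Sum>j\<in>?J. energy_density (w j) z)" for z
    have "integrable lborel F" unfolding F_def[abs_def]
      by (intro Bochner_Integration.integrable_sum integrable_energy_density w)
    from integral_tail_small[OF this \<sigma>] obtain \<Lambda> where \<Lambda>: "0 < \<Lambda>"
      "(LBINT z. indicator {z. \<Lambda> \<le> norm z} z * F z) < \<sigma>" by blast
    have "0 < sqrt (\<kappa> * \<sigma>)" using \<kappa> \<sigma> by simp
    from landau_o.smallD[OF assms(14) this]
    have small: "\<forall>\<^sub>F \<epsilon> in at_right 0. norm (eps_norm a V \<epsilon> (\<phi> \<epsilon>)) \<le> sqrt (\<kappa> * \<sigma>) * norm (\<epsilon> powr (3/2))" .
    \<comment> \<open>The three bounds put the shell outside the balls of radius \<open>R * \<epsilon>\<close>, put it into the tails of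
      the profiles, and put the ball of radius \<open>\<epsilon>\<close> around the \<open>i\<close>-th peak inside the inner ball.\<close>
    define \<epsilon>0 where "\<epsilon>0 = min (r / 4 / R) (min (r / 4 / \<Lambda>) (r / 2))"
    have \<epsilon>0: "0 < \<epsilon>0" using r(1) R(1) \<Lambda>(1) by (auto simp: \<epsilon>0_def)
    have evlt: "\<forall>\<^sub>F \<epsilon> in at_right 0. 0 < \<epsilon> \<and> \<epsilon> < \<epsilon>0"
      using \<epsilon>0 by (auto simp: eventually_at_right_field)
    \<comment> \<open>Every small \<open>\<epsilon>\<close> leads to a contradiction, expressed by \<open>\<epsilon> \<noteq> \<epsilon>\<close>.\<close>
    have "\<forall>\<^sub>F \<epsilon> in at_right (0::real). \<epsilon> \<noteq> \<epsilon>"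
      using evlt sol yev C2(2) R(2) small assms(13)
    proof eventually_elim
      case (elim \<epsilon>)
      then have \<epsilon>: "0 < \<epsilon>" "\<epsilon> < r / 4 / R" "\<epsilon> < r / 4 / \<Lambda>" "\<epsilon> < r / 2" by (auto simp: \<epsilon>0_def)
      let ?u = "u \<epsilon>" and ?y = "y \<epsilon>" and ?\<phi> = "\<phi> \<epsilon>"
      define m where "m = \<epsilon>\<^sup>2 * a + \<epsilon> * b * dirichlet ?u"
      have ps: "positive_solution m V p ?u" using elim(2) by (simp add: kirchhoff_solution_def m_def)
      have uH: "?u \<in> H1" and ucont: "continuous_on UNIV ?u" and upos: "\<And>x. 0 < ?u x"
        using ps by (auto simp: positive_solution_def)
      have ueq: "?u x = (\<Sum>j\<in>?J. rescaled \<epsilon> (?y j) (w j) x) + ?\<phi> x" for x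
        using elim(7) by (simp add: rescaled_def)
      have \<phi>H: "?\<phi> \<in> H1"
      proof -
        have "(\<lambda>x. ?u x + (-1) * (\<Sum>j\<in>?J. rescaled \<epsilon> (?y j) (w j) x)) \<in> H1"
          by (intro H1_add uH H1_cmult H1_sum rescaled_H1 w \<epsilon>) auto
        moreover have "?\<phi> = (\<lambda>x. ?u x + (-1) * (\<Sum>j\<in>?J. rescaled \<epsilon> (?y j) (w j) x))" using ueq by auto
        ultimately show ?thesis by simp
      qed
      note su = H1_square_integrable[OF uH] H1_wgrad(2)[OF uH]
      define E\<phi> where "E\<phi> = \<epsilon>\<^sup>2 * (LBINT x. (norm (wgrad ?\<phi> x))\<^sup>2) + (LBINT x. (?\<phi> x)\<^sup>2)"
      have E\<phi>: "E\<phi> \<le> \<sigma> * \<epsilon> ^ 3"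
      proof -
        have "\<bar>eps_norm a V \<epsilon> ?\<phi>\<bar> \<le> sqrt (\<kappa> * \<sigma>) * \<epsilon> powr (3/2)" using elim(6) by simp
        then have "(eps_norm a V \<epsilon> ?\<phi>)\<^sup>2 \<le> (sqrt (\<kappa> * \<sigma>) * \<epsilon> powr (3/2))\<^sup>2"
          by (subst power2_le_iff_abs_le) (use \<kappa> \<sigma> in auto)
        also have "\<dots> = (\<kappa> * \<sigma>) * \<epsilon> ^ 3"
          using \<kappa> \<sigma> \<epsilon> by (simp add: power_mult_distrib powr_power powr_numeral)
        finally have "\<kappa> * E\<phi> \<le> \<kappa> * (\<sigma> * \<epsilon> ^ 3)"
          using eps_norm_lower_bound[OF \<phi>H Vc M V0(2) \<kappa>(2,3,1), of \<epsilon>] by (simp add: E\<phi>_def mult.assoc)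
        then show ?thesis using \<kappa>(1) by simp
      qed
      define I1 where "I1 = (LBINT x. indicator S x * (norm (wgrad ?u x))\<^sup>2)"
      define I2 where "I2 = (LBINT x. indicator S x * (?u x)\<^sup>2)"
      define I3 where "I3 = (LBINT x. indicator S x * ?u x powr (p + 1))"
      have I0: "0 \<le> I1" "0 \<le> I2" unfolding I1_def I2_def by (auto intro!: Bochner_Integration.integral_nonneg)
      have far: "r / 4 \<le> dist x (?y j)" if "x \<in> S" "j \<in> ?J" for x j
        using Sfar[OF that] elim(3) that(2) dist_triangle[of x "\<xi> j" "?y j"] by force
      have shellE: "\<epsilon>\<^sup>2 * I1 + I2 \<le> (2 + 2 * real k) * (\<sigma> * \<epsilon> ^ 3)"
      proof -
        have "\<epsilon>\<^sup>2 * I1 + I2 \<le> 2 * E\<phi> + 2 * real (card ?J) * \<epsilon> ^ 3 * (LBINT z. indicator {z. \<Lambda> \<le> norm z} z * F z)"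
          unfolding I1_def I2_def E\<phi>_def F_def
        proof (rule energy_away_from_peaks_le[OF _ w \<epsilon>(1) \<phi>H ueq Sm])
          fix x j assume "x \<in> S" "j \<in> ?J"
          from far[OF this] have "r / 4 \<le> norm (x - ?y j)" by (simp add: dist_norm)
          moreover have "\<Lambda> * \<epsilon> < r / 4" using \<epsilon>(3) \<Lambda>(1) by (simp add: field_simps)
          ultimately have "\<Lambda> * \<epsilon> \<le> norm (x - ?y j)" by linarith
          then show "(x - ?y j) /\<^sub>R \<epsilon> \<in> {z. \<Lambda> \<le> norm z}"
            unfolding mem_Collect_eq norm_rescale[OF \<epsilon>(1)] using \<epsilon>(1) by (simp add: pos_le_divide_eq)
        qed (auto)
        also have "\<dots> \<le> 2 * (\<sigma> * \<epsilon> ^ 3) + 2 * real (card ?J) * \<epsilon> ^ 3 * \<sigma>"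
          using E\<phi> \<Lambda>(2) \<epsilon>(1) by (intro add_mono mult_left_mono) auto
        also have "\<dots> = (2 + 2 * real k) * (\<sigma> * \<epsilon> ^ 3)" by (simp add: algebra_simps)
        finally show ?thesis .
      qed
      have le1: "?u x \<le> 1" if "x \<in> S" for x
      proof -
        have "R * \<epsilon> < r / 4" using \<epsilon>(2) R(1) by (simp add: field_simps)
        then have "x \<notin> (\<Union>j\<in>{1..k}. ball (?y j) (R * \<epsilon>))" using far[OF that] by (force simp: dist_commute)
        then show ?thesis using elim(5) by fastforce
      qed
      have I3: "I3 \<le> I2"
        unfolding I3_def I2_def
      proof (rule integral_mono)
        have "continuous_on UNIV (\<lambda>x. ?u x powr (p + 1))"
          by (rule continuous_on_powr[OF ucont continuous_on_const]) (use upos in \<open>auto simp: less_imp_neq[symmetric]\<close>)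
        from borel_integrable_compact[OF compact_shell continuous_on_subset[OF this subset_UNIV], of "\<xi> i" r]
        show "integrable lborel (\<lambda>x. indicator S x * ?u x powr (p + 1))" by (simp add: S_def)
        show "integrable lborel (\<lambda>x. indicator S x * (?u x)\<^sup>2)"
          using integrable_indicator_sq[OF su(1) Sm] by simp
        fix x show "indicator S x * ?u x powr (p + 1) \<le> indicator S x * (?u x)\<^sup>2"
        proof (cases "x \<in> S")
          case True
          have "?u x powr (p + 1) \<le> ?u x powr 2"
            by (rule powr_mono') (use le1[OF True] upos[of x] \<open>1 < p\<close> in auto)
          then show ?thesis using True upos[of x] by (simp add: powr_numeral)
        qed simp
      qed
      have dir0: "0 \<le> dirichlet ?u" unfolding dirichlet_def by (rule Bochner_Integration.integral_nonneg) simp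
      \<comment> \<open>The energy bound makes the Dirichlet integral of order \<open>\<epsilon>\<close>, so the coefficient of the Laplacian is of
        order \<open>\<epsilon>\<^sup>2\<close>, and the gradient part of the shell energy enters with the right weight.\<close>
      have dir: "dirichlet ?u \<le> C2 / a * \<epsilon>"
      proof -
        have "\<epsilon>\<^sup>2 * a * dirichlet ?u + (LBINT x. (?u x)\<^sup>2)
            = (LBINT x. \<epsilon>\<^sup>2 * a * (norm (wgrad ?u x))\<^sup>2 + (?u x)\<^sup>2)"
          using su by (simp add: dirichlet_def square_integrable_def)
        moreover have "0 \<le> (LBINT x. (?u x)\<^sup>2)" by (rule Bochner_Integration.integral_nonneg) simp
        ultimately have "\<epsilon>\<^sup>2 * a * dirichlet ?u \<le> C2 * \<epsilon> ^ 3" using elim(4) by linarith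
        then have "\<epsilon>\<^sup>2 * (a * dirichlet ?u) \<le> \<epsilon>\<^sup>2 * (C2 * \<epsilon>)" by (simp add: power3_eq_cube power2_eq_square mult_ac)
        then have "a * dirichlet ?u \<le> C2 * \<epsilon>" using \<epsilon>(1) by simp
        then show ?thesis using \<open>a > 0\<close> by (simp add: field_simps)
      qed
      have m0: "0 \<le> m" unfolding m_def using \<open>a > 0\<close> \<open>b > 0\<close> \<epsilon>(1) dir0 by simp
      have mle: "m \<le> (a + b * (C2 / a)) * \<epsilon>\<^sup>2"
      proof -
        have "\<epsilon> * b * dirichlet ?u \<le> \<epsilon> * b * (C2 / a * \<epsilon>)" by (rule mult_left_mono[OF dir]) (use \<open>b > 0\<close> \<epsilon> in simp)
        then show ?thesis unfolding m_def by (simp add: algebra_simps power2_eq_square)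
      qed
      define B where "B = (LBINT x. indicator (cball (\<xi> i) r) x * (?u x)\<^sup>2)"
      have "B \<le> C * (m * I1 + I2 + I3)"
        unfolding B_def I1_def I2_def I3_def by (rule C[OF m0 ps])
      also have "\<dots> \<le> C * ((a + b * (C2 / a) + 2) * (\<epsilon>\<^sup>2 * I1 + I2))"
      proof (rule mult_left_mono[OF _ C0])
        have "m * I1 \<le> (a + b * (C2 / a)) * \<epsilon>\<^sup>2 * I1" by (rule mult_right_mono[OF mle I0(1)])
        moreover have "0 \<le> (a + b * (C2 / a)) * I2" "0 \<le> \<epsilon>\<^sup>2 * I1"
          using \<open>a > 0\<close> \<open>b > 0\<close> C2(1) I0 by auto
        ultimately have "m * I1 + I2 + I3 \<le> (a + b * (C2 / a)) * \<epsilon>\<^sup>2 * I1 + 2 * I2 + (a + b * (C2 / a)) * I2 + 2 * (\<epsilon>\<^sup>2 * I1)"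
          using I3 by linarith
        then show "m * I1 + I2 + I3 \<le> (a + b * (C2 / a) + 2) * (\<epsilon>\<^sup>2 * I1 + I2)" by (simp add: algebra_simps)
      qed
      also have "\<dots> \<le> C * ((a + b * (C2 / a) + 2) * ((2 + 2 * real k) * (\<sigma> * \<epsilon> ^ 3)))"
        using shellE C0 C2(1) \<open>a > 0\<close> \<open>b > 0\<close> by (intro mult_left_mono) auto
      finally have B: "2 * B \<le> A * (2 + 2 * real k) * \<sigma> * \<epsilon> ^ 3" unfolding A_def mult.assoc by linarith
      have "\<epsilon> ^ 3 * c0 \<le> 2 * B + 2 * (LBINT x. (?\<phi> x)\<^sup>2)"
        unfolding c0_def B_def
      proof (rule peak_mass_lower_bound[OF _ i w wpos \<epsilon>(1) \<phi>H uH ueq])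
        show "cball (?y i) \<epsilon> \<subseteq> cball (\<xi> i) r"
        proof
          fix x assume "x \<in> cball (?y i) \<epsilon>"
          then show "x \<in> cball (\<xi> i) r"
            using elim(3) i \<epsilon>(4) dist_triangle[of "\<xi> i" x "?y i"] r(1) by (force simp: dist_commute)
        qed
      qed auto
      moreover have "(LBINT x. (?\<phi> x)\<^sup>2) \<le> \<sigma> * \<epsilon> ^ 3"
      proof -
        have "0 \<le> \<epsilon>\<^sup>2 * (LBINT x. (norm (wgrad ?\<phi> x))\<^sup>2)"
          by (intro mult_nonneg_nonneg Bochner_Integration.integral_nonneg) auto
        then show ?thesis using E\<phi> unfolding E\<phi>_def by linarith
      qed
      ultimately have "\<epsilon> ^ 3 * c0 \<le> A * (2 + 2 * real k) * \<sigma> * \<epsilon> ^ 3 + 2 * (\<sigma> * \<epsilon> ^ 3)" using B by linarith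
      also have "\<dots> = \<epsilon> ^ 3 * ((A * (2 + 2 * real k) + 2) * \<sigma>)" by (simp add: algebra_simps)
      also have "\<dots> < \<epsilon> ^ 3 * c0" by (rule mult_strict_left_mono[OF \<sigma>c]) (use \<epsilon> in simp)
      finally show ?case by simp
    qed
    then show False by simp
  qed
  then show "GDERIV V (\<xi> i) :> 0" using V[of "\<xi> i"] by simp
qed

end
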